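(* Let $(M,H)$ be an $n$-dimensional Carnot manifold, $a\in M$, $(X_1,\ldots,X_n)$ an $H$-frame near $a$, and let local coordinates $x=(x_1,\ldots,x_n)$ near $a$ be given. Then the $\varepsilon$-Carnot coordinates (given by $x\mapsto\varepsilon_a(x)$) are the unique Carnot coordinates at $a$ adapted to the $H$-frame $(X_1,\ldots,X_n)$ that arise from a change of coordinates of the form $x\mapsto(\hat\varepsilon\circ T)(x)$, where $T$ is an affine map such that $T(a)=0$, and $\hat\varepsilon$ is a polynomial diffeomorphism whose components $\hat\varepsilon_k$, $k=1,\ldots,n$, are of the form $$\hat\varepsilon_k(x)=x_k+\sum_{\substack{\langle\alpha\rangle\le w_k\\ |\alpha|\ge2}}d_{k\alpha}x^\alpha,\qquad d_{k\alpha}\in\mathbb{R}.$$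
   Context: A Carnot manifold of step $r$ is a smooth manifold $M$ ($\dim M=n$) with a filtration by subbundles $H_1\subset\cdots\subset H_r=TM$ such that the Lie bracket of local sections of $H_w$ and $H_{w'}$ is a section of $H_{w+w'}$ whenever $w+w'\le r$. Its weights are $w_j=\min\{w:\ j\le \mathrm{rk}\,H_w\}$, $1\le j\le n$. An $H$-frame near $a$ is a tangent frame $(X_1,\ldots,X_n)$ near $a$ with each $X_j$ a section of $H_{w_j}$; then $[X_i,X_j]=\sum_{w_k\le w_i+w_j}L_{ij}^k X_k$ with smooth functions $L_{ij}^k$ near $a$. For $\alpha\in\mathbb{N}_0^n$: $|\alpha|=\sum\alpha_j$, $\langle\alpha\rangle=\sum w_j\alpha_j$. The point $a$ is identified with its coordinate vector in the given coordinates. Dilations on $\mathbb{R}^n$: $\delta_t(x)=t\cdot x=(t^{w_1}x_1,\ldots,t^{w_n}x_n)$. For a vector field $X=\sum a_j(x)\partial_j$, $\delta_t^*X=\sum_j t^{-w_j}a_j(t\cdot x)\partial_j$. Order and privileged coordinates: for $I=(i_1,\ldots,i_k)$, $k\ge 0$, put $X_I=X_{i_1}\cdots X_{i_k}$, $\langle I\rangle=w_{i_1}+\cdots+w_{i_k}$. A smooth $f$ near $a$ has order $N$ at $a$ if $X_If(a)=0$ whenever $\langle I\rangle<N$ and $X_If(a)\ne0$ for some $I$ with $\langle I\rangle=N$. Local coordinates centered at $a$ are linearly adapted to the $H$-frame if $X_j(0)=\partial_j$ for all $j$; they are privileged coordinates at $a$ adapted to $(X_1,\ldots,X_n)$ if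 moreover each coordinate $x_j$ has order $w_j$ at $a$. In privileged coordinates, $t^{w_j}\delta_t^*X_j$ converges as $t\to0$ ($C^\infty$ uniformly on compact sets) to a polynomial vector field $X_j^{(a)}$ on $\mathbb{R}^n$, the model vector field of $X_j$. The group $G(a)$: equip $\mathbb{R}^n$, with canonical basis $(\epsilon_j)$, with the nilpotent Lie bracket $[\epsilon_i,\epsilon_j]=\sum_{w_k=w_i+w_j}L_{ij}^k(a)\epsilon_k$ (zero if $w_i+w_j>r$). $G(a)$ is $\mathbb{R}^n$ with the Dynkin (Baker-Campbell-Hausdorff) product $x\cdot y=x+y+\frac12[x,y]+\frac1{12}([x,[x,y]]+[y,[y,x]])+\cdots$ (finite sum). $X_j^a$ is the left-invariant vector field on $G(a)$ with $X_j^a(0)=\partial_j$. Carnot coordinates at $a$ adapted to $(X_1,\ldots,X_n)$ are privileged coordinates at $a$ adapted to $(X_1,\ldots,X_n)$ in which the model vector field of $X_j$ is $X_j^a$ for every $j$. The $\varepsilon$-Carnot coordinates: in the given local coordinates, $T_a$ is the unique affine map such that $x\mapsto T_a(x)$ gives coordinates centered at $a$ and linearly adapted to the $H$-frame. Starting from the latter coordinates there is (known fact) a unique polynomial change of coordinates $\hat\psi_a$ with components $\hat\psi_{a}(y)_k=y_k+\sum_{\langle\alpha\rangle<w_k,\,|\alpha|\ge2}a_{k\alpha}y^\alpha$, $a_{k\alpha}\in\mathbb{R}$, which produces privileged coordinates at $a$ adapted to the $H$-frame. Put $\psi_a=\hat\psi_a\circ T_a$; let $X_j^{(a)}$ be the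 model vector fields in the privileged coordinates given by $\psi_a$, and let $\exp_{X^{(a)}}(x)$ be the time-one flow of $x_1X_1^{(a)}+\cdots+x_nX_n^{(a)}$ starting at $0$ (a polynomial diffeomorphism of $\mathbb{R}^n$). Then $\varepsilon_a=\exp_{X^{(a)}}^{-1}\circ\psi_a:\mathbb{R}^n\to\mathbb{R}^n$, and the coordinates given by $x\mapsto\varepsilon_a(x)$ are called $\varepsilon$-Carnot coordinates. *)

theory Defs
  imports "HOL-Analysis.Analysis"
begin

section \<open>Smooth maps and vector fields on open subsets of Euclidean space\<close>

fun iter_dir_deriv ::
  "'a::real_normed_vector list \<Rightarrow> ('a \<Rightarrow> 'b::real_normed_vector) \<Rightarrow> 'a \<Rightarrow> 'b" where
  "iter_dir_deriv [] f = f"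
| "iter_dir_deriv (v # vs) f = (\<lambda>x. frechet_derivative (iter_dir_deriv vs f) (at x) v)"

(* Intended for open S, where this is the usual notion of a map of class C^infinity. *)
definition smooth_on :: "'a::real_normed_vector set \<Rightarrow> ('a \<Rightarrow> 'b::real_normed_vector) \<Rightarrow> bool" where
  "smooth_on S f \<longleftrightarrow> (\<forall>vs. \<forall>x\<in>S. iter_dir_deriv vs f differentiable (at x))"

definition vf_apply ::
  "('a::real_normed_vector \<Rightarrow> 'a) \<Rightarrow> ('a \<Rightarrow> real) \<Rightarrow> 'a \<Rightarrow> real" where
  "vf_apply X f = (\<lambda>x. frechet_derivative f (at x) (X x))"

definition vf_bracket ::
  "('a::real_normed_vector \<Rightarrow> 'a) \<Rightarrow> ('a \<Rightarrow> 'a) \<Rightarrow> 'a \<Rightarrow> 'a" where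
  "vf_bracket X Y =
     (\<lambda>x. frechet_derivative Y (at x) (X x) - frechet_derivative X (at x) (Y x))"

section \<open>Smooth manifolds, vector fields and subbundles\<close>

text \<open>The manifold is the whole type \<open>'m\<close>; a chart is a domain together with a coordinate map
  (whose values off the domain are irrelevant), and a smooth structure is a maximal atlas.\<close>

type_synonym ('m, 'n) chart = "'m set \<times> ('m \<Rightarrow> real ^ 'n)"

definition chart_inv :: "('m, 'n::finite) chart \<Rightarrow> real ^ 'n \<Rightarrow> 'm" where
  "chart_inv c = inv_into (fst c) (snd c)"

definition is_chart :: "('m::topological_space, 'n::finite) chart \<Rightarrow> bool" where
  "is_chart c \<longleftrightarrow> open (fst c) \<and> open (snd c ` fst c) \<and>
     homeomorphism (fst c) (snd c ` fst c) (snd c) (chart_inv c)"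

definition transition ::
  "('m, 'n::finite) chart \<Rightarrow> ('m, 'n) chart \<Rightarrow> real ^ 'n \<Rightarrow> real ^ 'n" where
  "transition c d = snd d \<circ> chart_inv c"

definition compatible_charts :: "('m, 'n::finite) chart \<Rightarrow> ('m, 'n) chart \<Rightarrow> bool" where
  "compatible_charts c d \<longleftrightarrow>
     smooth_on (snd c ` (fst c \<inter> fst d)) (transition c d) \<and>
     smooth_on (snd d ` (fst c \<inter> fst d)) (transition d c)"

definition smooth_structure :: "('m::topological_space, 'n::finite) chart set \<Rightarrow> bool" where
  "smooth_structure A \<longleftrightarrow>
     (\<forall>c\<in>A. is_chart c) \<and> (\<Union>c\<in>A. fst c) = UNIV \<and>
     (\<forall>c\<in>A. \<forall>d\<in>A. compatible_charts c d) \<and>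
     (\<forall>c. is_chart c \<and> (\<forall>d\<in>A. compatible_charts c d) \<longrightarrow> c \<in> A)"

text \<open>A tangent vector at \<open>p\<close> assigns to every chart around \<open>p\<close> its component vector, subject to
  the transformation law; it is \<open>0\<close> on all other charts, so that evaluation at a chart around \<open>p\<close>
  is a bijection from the tangent space onto \<open>real ^ 'n\<close>.\<close>

type_synonym ('m, 'n) tvec = "('m, 'n) chart \<Rightarrow> real ^ 'n"

definition tangent_space :: "('m, 'n::finite) chart set \<Rightarrow> 'm \<Rightarrow> ('m, 'n) tvec set" where
  "tangent_space A p =
     {v. (\<forall>c\<in>A. \<forall>d\<in>A. p \<in> fst c \<inter> fst d \<longrightarrow>
            v d = frechet_derivative (transition c d) (at (snd c p)) (v c)) \<and>
         (\<forall>c. \<not> (c \<in> A \<and> p \<in> fst c) \<longrightarrow> v c = 0)}"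

(* the vector field X expressed in the coordinates c *)
definition in_chart ::
  "('m, 'n::finite) chart \<Rightarrow> ('m \<Rightarrow> ('m, 'n) tvec) \<Rightarrow> real ^ 'n \<Rightarrow> real ^ 'n" where
  "in_chart c X = (\<lambda>x. X (chart_inv c x) c)"

definition smooth_vector_field ::
  "('m::topological_space, 'n::finite) chart set \<Rightarrow> 'm set \<Rightarrow> ('m \<Rightarrow> ('m, 'n) tvec) \<Rightarrow> bool" where
  "smooth_vector_field A W X \<longleftrightarrow> open W \<and> (\<forall>p\<in>W. X p \<in> tangent_space A p) \<and>
     (\<forall>c\<in>A. smooth_on (snd c ` (fst c \<inter> W)) (in_chart c X))"

definition lie_bracket ::
  "('m, 'n::finite) chart set \<Rightarrow> ('m \<Rightarrow> ('m, 'n) tvec) \<Rightarrow> ('m \<Rightarrow> ('m, 'n) tvec)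
     \<Rightarrow> 'm \<Rightarrow> ('m, 'n) tvec" where
  "lie_bracket A X Y = (\<lambda>p c. if c \<in> A \<and> p \<in> fst c
     then vf_bracket (in_chart c X) (in_chart c Y) (snd c p) else 0)"

definition subbundle ::
  "('m::topological_space, 'n::finite) chart set \<Rightarrow> nat \<Rightarrow> ('m \<Rightarrow> ('m, 'n) tvec set) \<Rightarrow> bool" where
  "subbundle A k E \<longleftrightarrow>
     (\<forall>p. E p \<subseteq> tangent_space A p) \<and>
     (\<forall>p. \<exists>W F. open W \<and> p \<in> W \<and> (\<forall>i<k. smooth_vector_field A W (F i)) \<and>
        (\<forall>q\<in>W. \<forall>c\<in>A. q \<in> fst c \<longrightarrow>
           inj_on (\<lambda>i. F i q c) {..<k} \<and> independent ((\<lambda>i. F i q c) ` {..<k}) \<and>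
           (\<lambda>v. v c) ` E q = span ((\<lambda>i. F i q c) ` {..<k})))"

definition smooth_section ::
  "('m::topological_space, 'n::finite) chart set \<Rightarrow> ('m \<Rightarrow> ('m, 'n) tvec set) \<Rightarrow> 'm set
     \<Rightarrow> ('m \<Rightarrow> ('m, 'n) tvec) \<Rightarrow> bool" where
  "smooth_section A E W X \<longleftrightarrow> smooth_vector_field A W X \<and> (\<forall>p\<in>W. X p \<in> E p)"

section \<open>Carnot manifolds\<close>

text \<open>\<open>r\<close> is the step, \<open>H s\<close> (for \<open>1 \<le> s \<le> r\<close>) the filtration and \<open>d s\<close> the rank of \<open>H s\<close>.\<close>

definition carnot_manifold ::
  "('m::topological_space, 'n::finite) chart set \<Rightarrow> nat \<Rightarrow> (nat \<Rightarrow> nat)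
     \<Rightarrow> (nat \<Rightarrow> 'm \<Rightarrow> ('m, 'n) tvec set) \<Rightarrow> bool" where
  "carnot_manifold A r d H \<longleftrightarrow>
     smooth_structure A \<and> 1 \<le> r \<and>
     (\<forall>s\<in>{1..r}. subbundle A (d s) (H s)) \<and>
     (\<forall>s\<in>{1..<r}. \<forall>p. H s p \<subseteq> H (Suc s) p) \<and>
     (\<forall>p. H r p = tangent_space A p) \<and>
     (\<forall>s\<ge>1. \<forall>s'\<ge>1. s + s' \<le> r \<longrightarrow>
        (\<forall>W X Y. smooth_section A (H s) W X \<and> smooth_section A (H s') W Y \<longrightarrow>
           smooth_section A (H (s + s')) W (lie_bracket A X Y)))"

text \<open>The indices \<open>1, ..., n\<close> are the elements of the finite linear order \<open>'n\<close>; the position of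
  \<open>j\<close> is \<open>card {..j}\<close>.\<close>

definition weight :: "(nat \<Rightarrow> nat) \<Rightarrow> 'n::{finite,linorder} \<Rightarrow> nat" where
  "weight d j = (LEAST s. 1 \<le> s \<and> card {..j} \<le> d s)"

definition H_frame_near ::
  "('m::topological_space, 'n::{finite,linorder}) chart set \<Rightarrow> (nat \<Rightarrow> nat)
     \<Rightarrow> (nat \<Rightarrow> 'm \<Rightarrow> ('m, 'n) tvec set) \<Rightarrow> 'm \<Rightarrow> 'm set \<Rightarrow> ('n \<Rightarrow> 'm \<Rightarrow> ('m, 'n) tvec) \<Rightarrow> bool" where
  "H_frame_near A d H a W X \<longleftrightarrow>
     open W \<and> a \<in> W \<and>
     (\<forall>j. smooth_section A (H (weight d j)) W (X j)) \<and>
     (\<forall>p\<in>W. \<forall>c\<in>A. p \<in> fst c \<longrightarrow>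
        inj (\<lambda>j. X j p c) \<and> independent (range (\<lambda>j. X j p c)))"

section \<open>Privileged coordinates and model vector fields\<close>

text \<open>From here on \<open>Y\<close> is a frame on an open subset \<open>\<Omega>\<close> of \<open>real ^ 'n\<close> (an \<open>H\<close>-frame expressed in
  the given local coordinates), \<open>a \<in> \<Omega>\<close>, and \<open>w\<close> are the weights. New local coordinates near
  \<open>a\<close> are given by \<open>x \<mapsto> \<epsilon> x\<close> on a neighborhood \<open>V\<close> of \<open>a\<close>.\<close>

type_synonym 'n vfield = "real ^ 'n \<Rightarrow> real ^ 'n"

definition local_coords ::
  "(real ^ 'n::finite) set \<Rightarrow> real ^ 'n \<Rightarrow> (real ^ 'n) set \<Rightarrow> (real ^ 'n \<Rightarrow> real ^ 'n) \<Rightarrow> bool" where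
  "local_coords \<Omega> a V \<epsilon> \<longleftrightarrow>
     open V \<and> a \<in> V \<and> V \<subseteq> \<Omega> \<and> inj_on \<epsilon> V \<and> smooth_on V \<epsilon> \<and>
     open (\<epsilon> ` V) \<and> smooth_on (\<epsilon> ` V) (inv_into V \<epsilon>)"

definition pushforward ::
  "(real ^ 'n::finite) set \<Rightarrow> (real ^ 'n \<Rightarrow> real ^ 'n) \<Rightarrow> 'n vfield \<Rightarrow> 'n vfield" where
  "pushforward V \<epsilon> X =
     (\<lambda>y. frechet_derivative \<epsilon> (at (inv_into V \<epsilon> y)) (X (inv_into V \<epsilon> y)))"

definition index_weight :: "('n \<Rightarrow> nat) \<Rightarrow> 'n list \<Rightarrow> nat" where
  "index_weight w I = sum_list (map w I)"

(* X_I f with X_I = X_(i_1) ... X_(i_k) *)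
definition frame_apply ::
  "('n::finite \<Rightarrow> 'n vfield) \<Rightarrow> 'n list \<Rightarrow> (real ^ 'n \<Rightarrow> real) \<Rightarrow> real ^ 'n \<Rightarrow> real" where
  "frame_apply Y I f = foldr (\<lambda>i g. vf_apply (Y i) g) I f"

definition has_order ::
  "('n::finite \<Rightarrow> nat) \<Rightarrow> ('n \<Rightarrow> 'n vfield) \<Rightarrow> (real ^ 'n \<Rightarrow> real) \<Rightarrow> real ^ 'n \<Rightarrow> nat \<Rightarrow> bool" where
  "has_order w Y f a N \<longleftrightarrow>
     (\<forall>I. index_weight w I < N \<longrightarrow> frame_apply Y I f a = 0) \<and>
     (\<exists>I. index_weight w I = N \<and> frame_apply Y I f a \<noteq> 0)"

definition linearly_adapted ::
  "(real ^ 'n::finite) set \<Rightarrow> ('n \<Rightarrow> 'n vfield) \<Rightarrow> real ^ 'n \<Rightarrow> (real ^ 'n) set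
     \<Rightarrow> (real ^ 'n \<Rightarrow> real ^ 'n) \<Rightarrow> bool" where
  "linearly_adapted \<Omega> Y a V \<epsilon> \<longleftrightarrow>
     local_coords \<Omega> a V \<epsilon> \<and> \<epsilon> a = 0 \<and> (\<forall>j. pushforward V \<epsilon> (Y j) 0 = axis j 1)"

definition privileged ::
  "(real ^ 'n::finite) set \<Rightarrow> ('n \<Rightarrow> nat) \<Rightarrow> ('n \<Rightarrow> 'n vfield) \<Rightarrow> real ^ 'n \<Rightarrow> (real ^ 'n) set
     \<Rightarrow> (real ^ 'n \<Rightarrow> real ^ 'n) \<Rightarrow> bool" where
  "privileged \<Omega> w Y a V \<epsilon> \<longleftrightarrow>
     linearly_adapted \<Omega> Y a V \<epsilon> \<and> (\<forall>j. has_order w Y (\<lambda>x. \<epsilon> x $ j) a (w j))"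

definition dilation :: "('n::finite \<Rightarrow> nat) \<Rightarrow> real \<Rightarrow> real ^ 'n \<Rightarrow> real ^ 'n" where
  "dilation w t x = (\<chi> j. t ^ w j * x $ j)"

definition dilation_pullback ::
  "('n::finite \<Rightarrow> nat) \<Rightarrow> real \<Rightarrow> 'n vfield \<Rightarrow> 'n vfield" where
  "dilation_pullback w t X = (\<lambda>x. \<chi> j. X (dilation w t x) $ j / t ^ w j)"

(* Every compact K is eventually mapped by the dilations into the domain of the vector field, so
   the values of X off its domain play no role in the limit. *)
definition is_model_field ::
  "('n::finite \<Rightarrow> nat) \<Rightarrow> 'n \<Rightarrow> 'n vfield \<Rightarrow> 'n vfield \<Rightarrow> bool" where
  "is_model_field w j X M \<longleftrightarrow>
     (\<forall>vs K. compact K \<longrightarrow>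
        uniform_limit K
          (\<lambda>t. iter_dir_deriv vs (\<lambda>x. t ^ w j *\<^sub>R dilation_pullback w t X x))
          (iter_dir_deriv vs M) (at 0))"

section \<open>The group \<open>G(a)\<close> and Carnot coordinates\<close>

definition structure_coeff ::
  "('n::finite \<Rightarrow> 'n vfield) \<Rightarrow> real ^ 'n \<Rightarrow> 'n \<Rightarrow> 'n \<Rightarrow> real ^ 'n" where
  "structure_coeff Y x i j =
     (THE L. vf_bracket (Y i) (Y j) x = (\<Sum>k\<in>UNIV. (L $ k) *\<^sub>R Y k x))"

definition model_bracket ::
  "('n::finite \<Rightarrow> nat) \<Rightarrow> ('n \<Rightarrow> 'n vfield) \<Rightarrow> real ^ 'n \<Rightarrow> real ^ 'n \<Rightarrow> real ^ 'n \<Rightarrow> real ^ 'n" where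
  "model_bracket w Y a x y =
     (\<chi> k. \<Sum>i\<in>UNIV. \<Sum>j\<in>UNIV.
        if w k = w i + w j then x $ i * y $ j * structure_coeff Y a i j $ k else 0)"

(* [v_1, [v_2, [..., v_m]]] *)
fun nested_bracket :: "('a \<Rightarrow> 'a \<Rightarrow> 'a) \<Rightarrow> 'a::zero list \<Rightarrow> 'a" where
  "nested_bracket B [] = 0"
| "nested_bracket B [v] = v"
| "nested_bracket B (v # u # us) = B v (nested_bracket B (u # us))"

text \<open>Dynkin's formula
  \<open>x \<cdot> y = \<Sum> (-1)^(m-1) / m * [x^p1 y^q1 ... x^pm y^qm] / ((\<Sum>i. pi + qi) * (\<Prod>i. pi! qi!))\<close>,
  summed over all \<open>m \<ge> 1\<close> and all \<open>(p1,q1), ..., (pm,qm)\<close> with \<open>pi + qi > 0\<close>. As brackets of length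
  greater than the step \<open>r\<close> vanish, only the terms of total degree at most \<open>r\<close> are kept.\<close>

definition dynkin_product ::
  "nat \<Rightarrow> ('a \<Rightarrow> 'a \<Rightarrow> 'a) \<Rightarrow> 'a::real_vector \<Rightarrow> 'a \<Rightarrow> 'a" where
  "dynkin_product r B x y =
     (\<Sum>ps\<in>{ps :: (nat \<times> nat) list. ps \<noteq> [] \<and> (\<forall>(p, q)\<in>set ps. 0 < p + q) \<and>
                (\<Sum>(p, q)\<leftarrow>ps. p + q) \<le> r}.
        ((- 1) ^ (length ps - 1) /
           (real (length ps) * real (\<Sum>(p, q)\<leftarrow>ps. p + q) *
            (\<Prod>(p, q)\<leftarrow>ps. fact p * fact q))) *\<^sub>R
        nested_bracket B (concat (map (\<lambda>(p, q). replicate p x @ replicate q y) ps)))"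

(* The left-invariant field with value v at the unit 0: its value at x is the image of v under
   the differential at 0 of the left translation by x. *)
definition left_invariant_field ::
  "('a \<Rightarrow> 'a \<Rightarrow> 'a) \<Rightarrow> 'a::real_normed_vector \<Rightarrow> 'a \<Rightarrow> 'a" where
  "left_invariant_field prd v = (\<lambda>x. frechet_derivative (prd x) (at 0) v)"

definition carnot_coords ::
  "(real ^ 'n::finite) set \<Rightarrow> nat \<Rightarrow> ('n \<Rightarrow> nat) \<Rightarrow> ('n \<Rightarrow> 'n vfield) \<Rightarrow> real ^ 'n
     \<Rightarrow> (real ^ 'n) set \<Rightarrow> (real ^ 'n \<Rightarrow> real ^ 'n) \<Rightarrow> bool" where
  "carnot_coords \<Omega> r w Y a V \<epsilon> \<longleftrightarrow>
     privileged \<Omega> w Y a V \<epsilon> \<and>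
     (\<forall>j. is_model_field w j (pushforward V \<epsilon> (Y j))
            (left_invariant_field (dynkin_product r (model_bracket w Y a)) (axis j 1)))"

section \<open>The \<open>\<epsilon>\<close>-Carnot coordinates\<close>

definition affine_map :: "('a::real_vector \<Rightarrow> 'b::real_vector) \<Rightarrow> bool" where
  "affine_map T \<longleftrightarrow> (\<exists>L b. linear L \<and> T = (\<lambda>x. L x + b))"

definition monomial :: "('n::finite \<Rightarrow> nat) \<Rightarrow> real ^ 'n \<Rightarrow> real" where
  "monomial \<alpha> x = (\<Prod>j\<in>UNIV. x $ j ^ \<alpha> j)"

definition multi_degree :: "('n::finite \<Rightarrow> nat) \<Rightarrow> nat" where
  "multi_degree \<alpha> = (\<Sum>j\<in>UNIV. \<alpha> j)"

definition multi_weight :: "('n::finite \<Rightarrow> nat) \<Rightarrow> ('n \<Rightarrow> nat) \<Rightarrow> nat" where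
  "multi_weight w \<alpha> = (\<Sum>j\<in>UNIV. w j * \<alpha> j)"

definition lower_weight_form ::
  "('n::finite \<Rightarrow> nat) \<Rightarrow> (real ^ 'n \<Rightarrow> real ^ 'n) \<Rightarrow> bool" where
  "lower_weight_form w p \<longleftrightarrow>
     (\<exists>c. \<forall>y k. p y $ k = y $ k +
        (\<Sum>\<alpha>\<in>{\<alpha>. multi_weight w \<alpha> < w k \<and> 2 \<le> multi_degree \<alpha>}. c k \<alpha> * monomial \<alpha> y))"

definition at_most_weight_form ::
  "('n::finite \<Rightarrow> nat) \<Rightarrow> (real ^ 'n \<Rightarrow> real ^ 'n) \<Rightarrow> bool" where
  "at_most_weight_form w p \<longleftrightarrow>
     (\<exists>c. \<forall>y k. p y $ k = y $ k +
        (\<Sum>\<alpha>\<in>{\<alpha>. multi_weight w \<alpha> \<le> w k \<and> 2 \<le> multi_degree \<alpha>}. c k \<alpha> * monomial \<alpha> y))"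

definition polynomial_diffeomorphism :: "(real ^ 'n::finite \<Rightarrow> real ^ 'n) \<Rightarrow> bool" where
  "polynomial_diffeomorphism p \<longleftrightarrow>
     polynomial_function p \<and> bij p \<and> smooth_on UNIV (inv p)"

definition T_map ::
  "(real ^ 'n::finite) set \<Rightarrow> ('n \<Rightarrow> 'n vfield) \<Rightarrow> real ^ 'n \<Rightarrow> real ^ 'n \<Rightarrow> real ^ 'n" where
  "T_map \<Omega> Y a = (THE T. affine_map T \<and> (\<exists>V. linearly_adapted \<Omega> Y a V T))"

definition psi_hat ::
  "(real ^ 'n::finite) set \<Rightarrow> ('n \<Rightarrow> nat) \<Rightarrow> ('n \<Rightarrow> 'n vfield) \<Rightarrow> real ^ 'n \<Rightarrow> real ^ 'n \<Rightarrow> real ^ 'n" where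
  "psi_hat \<Omega> w Y a =
     (THE p. lower_weight_form w p \<and> (\<exists>V. privileged \<Omega> w Y a V (p \<circ> T_map \<Omega> Y a)))"

definition psi_map ::
  "(real ^ 'n::finite) set \<Rightarrow> ('n \<Rightarrow> nat) \<Rightarrow> ('n \<Rightarrow> 'n vfield) \<Rightarrow> real ^ 'n \<Rightarrow> real ^ 'n \<Rightarrow> real ^ 'n" where
  "psi_map \<Omega> w Y a = psi_hat \<Omega> w Y a \<circ> T_map \<Omega> Y a"

(* model vector field of Y j in the privileged coordinates given by psi_map *)
definition psi_model ::
  "(real ^ 'n::finite) set \<Rightarrow> ('n \<Rightarrow> nat) \<Rightarrow> ('n \<Rightarrow> 'n vfield) \<Rightarrow> real ^ 'n \<Rightarrow> 'n \<Rightarrow> 'n vfield" where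
  "psi_model \<Omega> w Y a j =
     (THE M. \<exists>V. privileged \<Omega> w Y a V (psi_map \<Omega> w Y a) \<and>
                 is_model_field w j (pushforward V (psi_map \<Omega> w Y a) (Y j)) M)"

(* time-one flow from 0 of the field x_1 M_1 + ... + x_n M_n *)
definition frame_exp :: "('n::finite \<Rightarrow> 'n vfield) \<Rightarrow> real ^ 'n \<Rightarrow> real ^ 'n" where
  "frame_exp M x =
     (THE y. \<exists>\<gamma>. \<gamma> 0 = 0 \<and> \<gamma> 1 = y \<and>
        (\<forall>t\<in>{0..1}. (\<gamma> has_vector_derivative (\<Sum>j\<in>UNIV. (x $ j) *\<^sub>R M j (\<gamma> t)))
                      (at t within {0..1})))"

definition eps_carnot ::
  "(real ^ 'n::finite) set \<Rightarrow> ('n \<Rightarrow> nat) \<Rightarrow> ('n \<Rightarrow> 'n vfield) \<Rightarrow> real ^ 'n \<Rightarrow> real ^ 'n \<Rightarrow> real ^ 'n" where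
  "eps_carnot \<Omega> w Y a = inv (frame_exp (psi_model \<Omega> w Y a)) \<circ> psi_map \<Omega> w Y a"

end

theory Submission
  imports Defs
begin

text \<open>
  Order at \<open>a\<close> is intrinsic, and in coordinates linearly adapted to the frame a polynomial of weight
  at most \<open>N\<close> and order greater than \<open>N\<close> vanishes: on its lowest-degree part \<open>X\<^sub>I\<close> acts at the
  origin like the partial derivative with the same indices. Uniqueness follows, because for Carnot
  coordinates \<open>\<epsilon> = p \<circ> T\<close> the values \<open>X\<^sub>I \<epsilon>\<^sub>k (a)\<close> with \<open>\<langle>I\<rangle> \<le> w\<^sub>k\<close> are determined: they are \<open>0\<close> for
  \<open>\<langle>I\<rangle> < w\<^sub>k\<close>, and for \<open>\<langle>I\<rangle> = w\<^sub>k\<close> they are invariant under the dilations, hence equal to the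
  corresponding values for the model fields, which are the left-invariant fields of \<open>G(a)\<close>.

  For existence, the model fields of the privileged coordinates \<open>\<psi>\<close> are homogeneous polynomial fields
  spanning a Lie algebra with the structure constants of \<open>G(a)\<close>. In the exponential coordinates of
  such a frame the fields become \<open>F(ad x) e\<^sub>j\<close>, \<open>e\<^sub>j\<close> the basis vectors, with \<open>F(z) = z / (1 - exp (-z))\<close>, which is also the part
  of the Dynkin product linear in the second factor. The exponential map commutes with the dilations,
  so composing \<open>\<psi>\<close> with its inverse keeps the coordinates privileged and carries the model fields
  over.
\<close>

section \<open>Smooth functions\<close>

text \<open>The series z / (1 - exp (-z)) is reached from two sides that share no argument. In
  exponential coordinates it enters only through its Riccati equation, which comes from
  differentiating along rays; on the group it comes from counting the Dynkin words with a single
  second factor, summed by generating functions in exp z - 1. The sequence \<open>dyn\<close> found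
  in the second way is shown to satisfy \<open>riccati\<close>, and the two sides meet in
  \<open>dird_E_Xa\<close>. The recurring device is triangularity: weights are positive, so a
  monomial of degree at least 2 and weight at most \<open>w k\<close> contains only coordinates of
  weight below \<open>w k\<close>. It inverts the coordinate changes by polynomials, solves the flow
  equation weight by weight and makes long brackets vanish. The privileged coordinates \<psi> are
  obtained by correcting each coordinate degree by degree: new terms are not seen by shorter words,
  and reordering a word is harmless by the bracket condition of the filtration. The maps that make
  up \<epsilon> are definite descriptions, so each is proved to exist uniquely before it is computed
  with.\<close>

definition dird :: "'a::real_normed_vector \<Rightarrow> ('a \<Rightarrow> 'b::real_normed_vector) \<Rightarrow> 'a \<Rightarrow> 'b" where
  "dird v f = (\<lambda>x. frechet_derivative f (at x) v)"

lemma iter_dir_deriv_Cons: "iter_dir_deriv (v # vs) f = dird v (iter_dir_deriv vs f)"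
  by (simp add: dird_def)

declare iter_dir_deriv.simps(2) [simp del]

text \<open>Peeling off the innermost derivative instead of the outermost lets an induction on the
  list replace the function itself by one of its derivatives.\<close>

lemma iter_dir_deriv_snoc: "iter_dir_deriv (vs @ [v]) f = iter_dir_deriv vs (dird v f)"
  by (induction vs) (simp_all add: iter_dir_deriv_Cons)

lemma dird_eqI: "(f has_derivative f') (at x) \<Longrightarrow> dird v f x = f' v"
  unfolding dird_def using frechet_derivative_at by metis

lemma has_derivative_dird:
  "f differentiable at x \<Longrightarrow> (f has_derivative (\<lambda>v. dird v f x)) (at x)"
  unfolding dird_def by (simp add: frechet_derivative_works)

lemma linear_dird: "f differentiable at x \<Longrightarrow> linear (\<lambda>v. dird v f x)"
  unfolding dird_def by (rule linear_frechet_derivative)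

lemma has_derivative_cong_open:
  assumes "open S" "x \<in> S" "\<And>y. y \<in> S \<Longrightarrow> f y = g y"
  shows "(f has_derivative D) (at x) \<longleftrightarrow> (g has_derivative D) (at x)"
  using assms has_derivative_transform_within_open[of f D x UNIV S g]
    has_derivative_transform_within_open[of g D x UNIV S f] by auto

lemma differentiable_cong_open:
  assumes "open S" "x \<in> S" "\<And>y. y \<in> S \<Longrightarrow> f y = g y"
  shows "f differentiable at x \<longleftrightarrow> g differentiable at x"
  unfolding differentiable_def using has_derivative_cong_open[of S x f g] assms by simp

text \<open>\<open>frechet_derivative\<close> is a choice among all derivatives, so locally equal
  functions give equal values even where neither is differentiable.\<close>

lemma dird_cong_open:
  assumes "open S" "x \<in> S" "\<And>y. y \<in> S \<Longrightarrow> f y = g y"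
  shows "dird v f x = dird v g x"
  unfolding dird_def frechet_derivative_def using has_derivative_cong_open[of S x f g] assms by simp

lemma iter_dir_deriv_cong_open:
  assumes "open S" "x \<in> S" "\<And>y. y \<in> S \<Longrightarrow> f y = g y"
  shows "iter_dir_deriv vs f x = iter_dir_deriv vs g x"
  using assms(2)
proof (induction vs arbitrary: x)
  case (Cons v vs)
  then show ?case
    unfolding iter_dir_deriv_Cons by (intro dird_cong_open[OF assms(1)])
qed (simp add: assms)

text \<open>Closure of \<open>smooth_on\<close> under products and compositions is awkward list by
  list, since a derivative of a product is a sum of products. Recursion on the order, with the
  function free to vary, provides the induction for these proofs.\<close>

fun Ck :: "nat \<Rightarrow> 'a::real_normed_vector set \<Rightarrow> ('a \<Rightarrow> 'b::real_normed_vector) \<Rightarrow> bool" where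
  "Ck 0 S f \<longleftrightarrow> True"
| "Ck (Suc k) S f \<longleftrightarrow> (\<forall>x\<in>S. f differentiable at x) \<and> (\<forall>v. Ck k S (dird v f))"

lemma Ck_iff: "Ck k S f \<longleftrightarrow> (\<forall>vs. length vs < k \<longrightarrow> (\<forall>x\<in>S. iter_dir_deriv vs f differentiable at x))"
proof (induction k arbitrary: f)
  case (Suc k)
  show ?case
  proof
    assume C: "Ck (Suc k) S f"
    show "\<forall>vs. length vs < Suc k \<longrightarrow> (\<forall>x\<in>S. iter_dir_deriv vs f differentiable at x)"
    proof (intro allI impI ballI)
      fix vs :: "'a list" and x assume "length vs < Suc k" "x \<in> S"
      then show "iter_dir_deriv vs f differentiable at x"
        using C Suc.IH by (cases vs rule: rev_cases) (auto simp: iter_dir_deriv_snoc)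
    qed
  next
    assume R: "\<forall>vs. length vs < Suc k \<longrightarrow> (\<forall>x\<in>S. iter_dir_deriv vs f differentiable at x)"
    have "Ck k S (dird v f)" for v
      unfolding Suc.IH iter_dir_deriv_snoc[symmetric] using R by auto
    moreover have "\<forall>x\<in>S. f differentiable at x" using R[rule_format, of "[]"] by simp
    ultimately show "Ck (Suc k) S f" by simp
  qed
qed simp

lemma smooth_on_iff_Ck: "smooth_on S f \<longleftrightarrow> (\<forall>k. Ck k S f)"
  unfolding smooth_on_def Ck_iff by (meson lessI)

lemma Ck_mono: "Ck (Suc k) S f \<Longrightarrow> Ck k S f"
  unfolding Ck_iff by simp

lemma smooth_on_subset: "smooth_on S f \<Longrightarrow> T \<subseteq> S \<Longrightarrow> smooth_on T f"
  unfolding smooth_on_def by blast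

lemma smooth_on_differentiable: "smooth_on S f \<Longrightarrow> x \<in> S \<Longrightarrow> f differentiable at x"
  unfolding smooth_on_def by (metis iter_dir_deriv.simps(1))

lemma smooth_on_dird: "smooth_on S f \<Longrightarrow> smooth_on S (dird v f)"
  unfolding smooth_on_iff_Ck by (meson Ck.simps(2))

lemma smooth_on_iter: "smooth_on S f \<Longrightarrow> smooth_on S (iter_dir_deriv vs f)"
  by (induction vs) (auto simp: iter_dir_deriv_Cons intro: smooth_on_dird)

lemma smooth_on_continuous: "smooth_on S f \<Longrightarrow> continuous_on S f"
  by (meson smooth_on_differentiable differentiable_imp_continuous_within
      continuous_at_imp_continuous_on)

lemma Ck_cong:
  assumes "open S" "\<And>y. y \<in> S \<Longrightarrow> f y = g y"
  shows "Ck k S f \<longleftrightarrow> Ck k S g"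
proof -
  have "iter_dir_deriv vs f differentiable at x \<longleftrightarrow> iter_dir_deriv vs g differentiable at x"
    if "x \<in> S" for x vs
    by (rule differentiable_cong_open[OF assms(1) that]) (rule iter_dir_deriv_cong_open[OF assms(1) _ assms(2)])
  then show ?thesis unfolding Ck_iff by blast
qed

lemma smooth_on_cong:
  assumes "open S" "\<And>y. y \<in> S \<Longrightarrow> f y = g y"
  shows "smooth_on S f \<longleftrightarrow> smooth_on S g"
  unfolding smooth_on_iff_Ck using Ck_cong[of S f g] assms by simp

lemma dird_const [simp]: "dird v (\<lambda>x. c) = (\<lambda>x. 0)"
  by (simp add: dird_def)

lemma Ck_const: "Ck k S (\<lambda>x. c)"
  by (induction k arbitrary: c) auto

lemma smooth_on_const [intro!, simp]: "smooth_on S (\<lambda>x. c)"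
  by (simp add: smooth_on_iff_Ck Ck_const)

lemma dird_bounded_linear: "bounded_linear f \<Longrightarrow> dird v f = (\<lambda>x. f v)"
  using dird_eqI bounded_linear_imp_has_derivative by fast

lemma smooth_on_bounded_linear: "bounded_linear f \<Longrightarrow> smooth_on S f"
  unfolding smooth_on_iff_Ck
proof
  fix k assume "bounded_linear f" then show "Ck k S f"
    by (cases k) (auto simp: dird_bounded_linear Ck_const bounded_linear_imp_differentiable)
qed

lemma smooth_on_id [simp]: "smooth_on S (\<lambda>x. x)"
  by (simp add: smooth_on_bounded_linear bounded_linear_ident)

lemma dird_compose_linear:
  assumes "bounded_linear h" "f differentiable at x"
  shows "dird v (\<lambda>x. h (f x)) x = h (dird v f x)"
  by (rule dird_eqI, rule bounded_linear.has_derivative[OF assms(1)], rule has_derivative_dird[OF assms(2)])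

lemma Ck_compose_linear:
  assumes "bounded_linear h" "open S"
  shows "Ck k S f \<Longrightarrow> Ck k S (\<lambda>x. h (f x))"
proof (induction k arbitrary: f)
  case (Suc k)
  have "Ck k S (dird v (\<lambda>x. h (f x)))" for v
  proof -
    have "Ck k S (dird v (\<lambda>x. h (f x))) \<longleftrightarrow> Ck k S (\<lambda>x. h (dird v f x))"
      using Suc.prems by (intro Ck_cong assms dird_compose_linear) auto
    then show ?thesis using Suc by simp
  qed
  moreover have "(\<lambda>x. h (f x)) differentiable at x" if "x \<in> S" for x
    using Suc.prems that bounded_linear.has_derivative[OF assms(1) has_derivative_dird[of f x]]
    unfolding differentiable_def[of "\<lambda>x. h (f x)"] by auto
  ultimately show ?case by simp
qed simp

lemma smooth_on_compose_linear:
  "bounded_linear h \<Longrightarrow> open S \<Longrightarrow> smooth_on S f \<Longrightarrow> smooth_on S (\<lambda>x. h (f x))"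
  unfolding smooth_on_iff_Ck by (simp add: Ck_compose_linear)

lemma dird_add:
  "f differentiable at x \<Longrightarrow> g differentiable at x \<Longrightarrow> dird v (\<lambda>x. f x + g x) x = dird v f x + dird v g x"
  by (rule dird_eqI, rule has_derivative_add) (auto intro: has_derivative_dird)

lemma dird_sum:
  "(\<And>i. i \<in> I \<Longrightarrow> f i differentiable at x) \<Longrightarrow> dird v (\<lambda>x. \<Sum>i\<in>I. f i x) x = (\<Sum>i\<in>I. dird v (f i) x)"
  by (rule dird_eqI, rule has_derivative_sum) (auto intro: has_derivative_dird)

lemma Ck_add: "open S \<Longrightarrow> Ck k S f \<Longrightarrow> Ck k S g \<Longrightarrow> Ck k S (\<lambda>x. f x + g x)"
proof (induction k arbitrary: f g)
  case (Suc k)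
  have "Ck k S (dird v (\<lambda>x. f x + g x)) \<longleftrightarrow> Ck k S (\<lambda>x. dird v f x + dird v g x)" for v
    using Suc.prems by (intro Ck_cong dird_add) auto
  then show ?case using Suc by auto
qed simp

lemma smooth_on_add [intro]: "open S \<Longrightarrow> smooth_on S f \<Longrightarrow> smooth_on S g \<Longrightarrow> smooth_on S (\<lambda>x. f x + g x)"
  unfolding smooth_on_iff_Ck by (simp add: Ck_add)

lemma Ck_sum: "open S \<Longrightarrow> (\<And>i. i \<in> I \<Longrightarrow> Ck k S (f i)) \<Longrightarrow> Ck k S (\<lambda>x. \<Sum>i\<in>I. f i x)"
  by (induction I rule: infinite_finite_induct) (simp_all add: Ck_add Ck_const)

lemma smooth_on_sum [intro]:
  "open S \<Longrightarrow> (\<And>i. i \<in> I \<Longrightarrow> smooth_on S (f i)) \<Longrightarrow> smooth_on S (\<lambda>x. \<Sum>i\<in>I. f i x)"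
  unfolding smooth_on_iff_Ck by (simp add: Ck_sum)

lemma dird_scaleR:
  fixes f :: "'a::real_normed_vector \<Rightarrow> real"
  shows "f differentiable at x \<Longrightarrow> g differentiable at x \<Longrightarrow>
     dird v (\<lambda>x. f x *\<^sub>R g x) x = f x *\<^sub>R dird v g x + dird v f x *\<^sub>R g x"
  by (rule dird_eqI, rule has_derivative_scaleR) (auto intro: has_derivative_dird)

lemma Ck_scaleR:
  fixes f :: "'a::real_normed_vector \<Rightarrow> real"
  shows "open S \<Longrightarrow> Ck k S f \<Longrightarrow> Ck k S g \<Longrightarrow> Ck k S (\<lambda>x. f x *\<^sub>R g x)"
proof (induction k arbitrary: f g)
  case (Suc k)
  have e: "Ck k S (dird v (\<lambda>x. f x *\<^sub>R g x)) \<longleftrightarrow> Ck k S (\<lambda>x. f x *\<^sub>R dird v g x + dird v f x *\<^sub>R g x)" for v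
    using Suc.prems by (intro Ck_cong dird_scaleR) auto
  have "Ck k S f" "Ck k S g" using Suc.prems Ck_mono by blast+
  then show ?case using Suc e by (auto intro!: Ck_add)
qed simp

lemma smooth_on_scaleR [intro]:
  fixes f :: "'a::real_normed_vector \<Rightarrow> real"
  shows "open S \<Longrightarrow> smooth_on S f \<Longrightarrow> smooth_on S g \<Longrightarrow> smooth_on S (\<lambda>x. f x *\<^sub>R g x)"
  unfolding smooth_on_iff_Ck by (simp add: Ck_scaleR)

lemma dird_mult:
  fixes f g :: "'a::real_normed_vector \<Rightarrow> real"
  shows "f differentiable at x \<Longrightarrow> g differentiable at x \<Longrightarrow>
     dird v (\<lambda>x. f x * g x) x = dird v f x * g x + f x * dird v g x"
  using dird_scaleR[of f x g v] by simp

lemma dird_cmult: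
  fixes f :: "'a::real_normed_vector \<Rightarrow> real"
  shows "f differentiable at x \<Longrightarrow> dird v (\<lambda>x. c * f x) x = c * dird v f x"
  using dird_mult[of "\<lambda>x. c" x f v] by simp

lemma smooth_on_mult [intro]:
  fixes f g :: "'a::real_normed_vector \<Rightarrow> real"
  shows "open S \<Longrightarrow> smooth_on S f \<Longrightarrow> smooth_on S g \<Longrightarrow> smooth_on S (\<lambda>x. f x * g x)"
  using smooth_on_scaleR[of S f g] by simp

lemma smooth_on_uminus:
  fixes f :: "'a::real_normed_vector \<Rightarrow> 'b::real_normed_vector"
  shows "open S \<Longrightarrow> smooth_on S f \<Longrightarrow> smooth_on S (\<lambda>x. - f x)"
  using smooth_on_scaleR[of S "\<lambda>x. -1" f] by simp

lemma smooth_on_diff [intro]: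
  fixes f :: "'a::real_normed_vector \<Rightarrow> 'b::real_normed_vector"
  shows "open S \<Longrightarrow> smooth_on S f \<Longrightarrow> smooth_on S g \<Longrightarrow> smooth_on S (\<lambda>x. f x - g x)"
  using smooth_on_add[of S f "\<lambda>x. - g x"] smooth_on_uminus[of S g] by simp

lemma smooth_on_prod [intro]:
  fixes f :: "'i \<Rightarrow> 'a::real_normed_vector \<Rightarrow> real"
  shows "open S \<Longrightarrow> (\<And>i. i \<in> I \<Longrightarrow> smooth_on S (f i)) \<Longrightarrow> smooth_on S (\<lambda>x. \<Prod>i\<in>I. f i x)"
  by (induction I rule: infinite_finite_induct) auto

lemma smooth_on_power [intro]:
  fixes f :: "'a::real_normed_vector \<Rightarrow> real"
  shows "open S \<Longrightarrow> smooth_on S f \<Longrightarrow> smooth_on S (\<lambda>x. f x ^ n)"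
  by (induction n) auto

lemma Ck_inverse:
  fixes f :: "'a::real_normed_vector \<Rightarrow> real"
  assumes "open S" "\<And>x. x \<in> S \<Longrightarrow> f x \<noteq> 0"
  shows "Ck k S f \<Longrightarrow> Ck k S (\<lambda>x. inverse (f x))"
proof (induction k)
  case (Suc k)
  have d: "((\<lambda>x. inverse (f x)) has_derivative (\<lambda>v. - (inverse (f x) * dird v f x * inverse (f x)))) (at x)"
    if "x \<in> S" for x
    using Suc.prems that assms
    by (intro Deriv.has_derivative_inverse[where f = f] has_derivative_dird) auto
  have e: "Ck k S (dird v (\<lambda>x. inverse (f x))) \<longleftrightarrow>
      Ck k S (\<lambda>x. (- 1 * inverse (f x) * dird v f x) *\<^sub>R inverse (f x))" for v
    using assms by (intro Ck_cong) (auto intro!: dird_eqI[OF d, THEN trans])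
  have "Ck k S (\<lambda>x. inverse (f x))" using Suc Ck_mono by blast
  moreover have "Ck k S (dird v f)" for v using Suc.prems by simp
  ultimately have "Ck k S (\<lambda>x. (- 1 *\<^sub>R inverse (f x) *\<^sub>R dird v f x) *\<^sub>R inverse (f x))" for v
    using assms by (intro Ck_scaleR Ck_const) auto
  then show ?case using e d by (auto simp: differentiable_def)
qed simp

lemma smooth_on_divide:
  fixes f g :: "'a::real_normed_vector \<Rightarrow> real"
  assumes "open S" "smooth_on S f" "smooth_on S g" "\<And>x. x \<in> S \<Longrightarrow> g x \<noteq> 0"
  shows "smooth_on S (\<lambda>x. f x / g x)"
proof -
  have "smooth_on S (\<lambda>x. inverse (g x))"
    using Ck_inverse[of S g] assms unfolding smooth_on_iff_Ck by blast
  from smooth_on_mult[OF assms(1,2) this] show ?thesis unfolding divide_inverse .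
qed

lemma smooth_on_nth: "open S \<Longrightarrow> smooth_on S f \<Longrightarrow> smooth_on S (\<lambda>x. f x $ k)"
  by (rule smooth_on_compose_linear[OF bounded_linear_vec_nth])

lemma dird_nth: "f differentiable at x \<Longrightarrow> dird v (\<lambda>x. f x $ k) x = dird v f x $ k"
  by (rule dird_compose_linear[OF bounded_linear_vec_nth])

lemma iter_dir_deriv_nth:
  "open S \<Longrightarrow> smooth_on S f \<Longrightarrow> x \<in> S \<Longrightarrow>
    iter_dir_deriv vs (\<lambda>x. f x $ k) x = iter_dir_deriv vs f x $ k"
proof (induction vs arbitrary: x)
  case (Cons v vs)
  have "dird v (iter_dir_deriv vs (\<lambda>x. f x $ k)) x = dird v (\<lambda>x. iter_dir_deriv vs f x $ k) x"
    by (rule dird_cong_open[OF \<open>open S\<close> \<open>x \<in> S\<close>]) (rule Cons.IH[OF \<open>open S\<close> \<open>smooth_on S f\<close>])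
  also have "\<dots> = dird v (iter_dir_deriv vs f) x $ k"
    by (rule dird_nth, rule smooth_on_differentiable[OF smooth_on_iter]) (fact Cons.prems)+
  finally show ?case unfolding iter_dir_deriv_Cons .
qed simp

lemma vec_eq_sum_axis: "(x :: real ^ 'n) = (\<Sum>k\<in>UNIV. x $ k *\<^sub>R axis k 1)"
  by (simp add: vec_eq_iff axis_def if_distrib cong: if_cong)

lemma smooth_on_vec:
  fixes f :: "'a::real_normed_vector \<Rightarrow> real ^ 'n"
  assumes "open S" "\<And>k. smooth_on S (\<lambda>x. f x $ k)"
  shows "smooth_on S f"
proof -
  have "smooth_on S (\<lambda>x. \<Sum>k\<in>UNIV. (f x $ k) *\<^sub>R axis k (1::real))"
    using assms by (intro smooth_on_sum smooth_on_scaleR) auto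
  then show ?thesis by (simp flip: vec_eq_sum_axis)
qed

lemma dird_expand:
  fixes f :: "real ^ 'n \<Rightarrow> 'b::real_normed_vector"
  assumes "f differentiable at x"
  shows "dird v f x = (\<Sum>k\<in>UNIV. v $ k *\<^sub>R dird (axis k 1) f x)"
proof -
  have "dird v f x = dird (\<Sum>k\<in>UNIV. v $ k *\<^sub>R axis k 1) f x"
    by (simp flip: vec_eq_sum_axis)
  also have "\<dots> = (\<Sum>k\<in>UNIV. v $ k *\<^sub>R dird (axis k 1) f x)"
    by (simp add: linear_sum[OF linear_dird[OF assms]] linear_scale[OF linear_dird[OF assms]])
  finally show ?thesis .
qed

lemma dird_compose:
  assumes "g differentiable at x" "f differentiable at (g x)"
  shows "dird v (\<lambda>x. f (g x)) x = dird (dird v g x) f (g x)"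
  by (rule dird_eqI, rule has_derivative_compose) (auto intro: has_derivative_dird assms)

text \<open>The chain rule yields a derivative of \<open>f\<close> in a direction that varies with
  the point. Expanding this direction in the coordinate basis gives products of fixed directional
  derivatives of \<open>f\<close>, composed with \<open>g\<close>, and components of derivatives of
  \<open>g\<close>, to which the induction on the order applies.\<close>

lemma Ck_compose:
  fixes f :: "real ^ 'n \<Rightarrow> 'b::real_normed_vector" and g :: "'a::real_normed_vector \<Rightarrow> real ^ 'n"
  assumes "open S" "g ` S \<subseteq> T"
  shows "Ck k T f \<Longrightarrow> Ck k S g \<Longrightarrow> Ck k S (\<lambda>x. f (g x))"
proof (induction k arbitrary: f)
  case (Suc k)
  have dg: "g differentiable at x" and df: "f differentiable at (g x)" if "x \<in> S" for x
    using Suc.prems assms that by auto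
  have e: "Ck k S (dird v (\<lambda>x. f (g x))) \<longleftrightarrow>
       Ck k S (\<lambda>x. \<Sum>k\<in>UNIV. (dird v g x $ k) *\<^sub>R dird (axis k 1) f (g x))" for v
    using assms by (intro Ck_cong) (auto simp: dird_compose dg df intro!: dird_expand)
  have "Ck k S g" using Suc.prems Ck_mono by blast
  then have "Ck k S (\<lambda>x. dird u f (g x))" for u using Suc by simp
  moreover have "Ck k S (\<lambda>x. dird v g x $ j)" for v j
    by (rule Ck_compose_linear[OF bounded_linear_vec_nth assms(1)]) (use Suc.prems(2) in simp)
  ultimately have "Ck k S (dird v (\<lambda>x. f (g x)))" for v
    unfolding e by (intro Ck_sum Ck_scaleR assms(1))
  moreover have "(\<lambda>x. f (g x)) differentiable at x" if "x \<in> S" for x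
    using differentiable_chain_at[OF dg df, OF that that] by (simp add: o_def)
  ultimately show ?case by simp
qed simp

lemma smooth_on_compose:
  fixes f :: "real ^ 'n \<Rightarrow> 'b::real_normed_vector" and g :: "'a::real_normed_vector \<Rightarrow> real ^ 'n"
  assumes "open S" "g ` S \<subseteq> T" "smooth_on T f" "smooth_on S g"
  shows "smooth_on S (\<lambda>x. f (g x))"
  using Ck_compose[OF assms(1,2), of _ f] assms(3,4) unfolding smooth_on_iff_Ck by simp

lemma smooth_on_dird_field:
  fixes f :: "real ^ 'n \<Rightarrow> 'b::real_normed_vector"
  assumes "open S" "smooth_on S f" "smooth_on S X"
  shows "smooth_on S (\<lambda>x. dird (X x) f x)"
proof -
  have "smooth_on S (\<lambda>x. \<Sum>k\<in>UNIV. (X x $ k) *\<^sub>R dird (axis k 1) f x)"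
    using assms by (intro smooth_on_sum smooth_on_scaleR smooth_on_nth smooth_on_dird) auto
  then show ?thesis
    using smooth_on_cong[OF assms(1), of "\<lambda>x. dird (X x) f x"
        "\<lambda>x. \<Sum>k\<in>UNIV. (X x $ k) *\<^sub>R dird (axis k 1) f x"]
      dird_expand[OF smooth_on_differentiable[OF assms(2)]] by simp
qed

lemma dird_along_line:
  assumes "f differentiable at (x + s *\<^sub>R u)"
  shows "((\<lambda>s. f (x + s *\<^sub>R u)) has_vector_derivative dird u f (x + s *\<^sub>R u)) (at s within T)"
proof -
  have 1: "((\<lambda>s. x + s *\<^sub>R u) has_derivative (\<lambda>h. h *\<^sub>R u)) (at s within T)"
    by (auto intro!: derivative_eq_intros)
  have "((\<lambda>s. f (x + s *\<^sub>R u)) has_derivative (\<lambda>h. dird (h *\<^sub>R u) f (x + s *\<^sub>R u))) (at s within T)"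
    by (rule has_derivative_compose[OF 1]) (rule has_derivative_dird[OF assms])
  then show ?thesis
    unfolding has_vector_derivative_def using linear_scale[OF linear_dird[OF assms]] by simp
qed

text \<open>The mean value theorem is applied in the direction \<open>u\<close> to the difference of
  \<open>f\<close> and its translate by \<open>h\<close> times \<open>v\<close>, and then in the
  direction \<open>v\<close> to \<open>dird u f\<close>.\<close>

lemma second_difference_mvt:
  fixes f :: "'a::real_normed_vector \<Rightarrow> real"
  assumes S: "\<And>s t. 0 \<le> s \<Longrightarrow> s \<le> h \<Longrightarrow> 0 \<le> t \<Longrightarrow> t \<le> h \<Longrightarrow> x + s *\<^sub>R u + t *\<^sub>R v \<in> S"
    and f: "smooth_on S f" and h: "0 < h"
  obtains s t where "0 < s" "s < h" "0 < t" "t < h"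
    "f (x + h *\<^sub>R u + h *\<^sub>R v) - f (x + h *\<^sub>R u) - f (x + h *\<^sub>R v) + f x
       = h * h * dird v (dird u f) (x + s *\<^sub>R u + t *\<^sub>R v)"
proof -
  note fd = smooth_on_differentiable[OF f]
  have d1: "((\<lambda>s. f (x + h *\<^sub>R v + s *\<^sub>R u) - f (x + s *\<^sub>R u)) has_real_derivative
      (dird u f (x + h *\<^sub>R v + s *\<^sub>R u) - dird u f (x + s *\<^sub>R u))) (at s)" if "0 \<le> s" "s \<le> h" for s
  proof -
    have "x + s *\<^sub>R u \<in> S" using S[of s 0] that h by simp
    moreover have "x + h *\<^sub>R v + s *\<^sub>R u \<in> S" using S[of s h] that h by (simp add: algebra_simps)
    ultimately show ?thesis
      unfolding has_real_derivative_iff_has_vector_derivative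
      by (intro has_vector_derivative_diff dird_along_line fd)
  qed
  obtain s where s: "0 < s" "s < h" and
    es: "(f (x + h *\<^sub>R v + h *\<^sub>R u) - f (x + h *\<^sub>R u)) - (f (x + h *\<^sub>R v + 0 *\<^sub>R u) - f (x + 0 *\<^sub>R u))
      = (h - 0) * (dird u f (x + h *\<^sub>R v + s *\<^sub>R u) - dird u f (x + s *\<^sub>R u))"
    using MVT2[OF h, of "\<lambda>s. f (x + h *\<^sub>R v + s *\<^sub>R u) - f (x + s *\<^sub>R u)", OF d1] by blast
  have d2: "((\<lambda>t. dird u f (x + s *\<^sub>R u + t *\<^sub>R v)) has_real_derivative
      (dird v (dird u f) (x + s *\<^sub>R u + t *\<^sub>R v))) (at t)" if "0 \<le> t" "t \<le> h" for t
  proof -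
    have "x + s *\<^sub>R u + t *\<^sub>R v \<in> S" using S[of s t] that s by simp
    then show ?thesis
      unfolding has_real_derivative_iff_has_vector_derivative
      by (intro dird_along_line smooth_on_differentiable[OF smooth_on_dird[OF f]])
  qed
  obtain t where t: "0 < t" "t < h" and
    et: "dird u f (x + s *\<^sub>R u + h *\<^sub>R v) - dird u f (x + s *\<^sub>R u + 0 *\<^sub>R v)
      = (h - 0) * dird v (dird u f) (x + s *\<^sub>R u + t *\<^sub>R v)"
    using MVT2[OF h, of "\<lambda>t. dird u f (x + s *\<^sub>R u + t *\<^sub>R v)", OF d2] by blast
  show thesis
    by (rule that[OF s t]) (use es et in \<open>simp add: algebra_simps\<close>)
qed

text \<open>The second difference over a parallelogram is symmetric in \<open>u\<close> and
  \<open>v\<close>, so one mixed derivative at some nearby point equals the other one at another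
  nearby point; continuity at \<open>x\<close> then excludes different values there.\<close>

lemma dird_commute:
  fixes f :: "'a::real_normed_vector \<Rightarrow> real"
  assumes "open S" "x \<in> S" "smooth_on S f"
  shows "dird u (dird v f) x = dird v (dird u f) x"
proof (rule ccontr)
  define p where "p = dird u (dird v f)"
  define q where "q = dird v (dird u f)"
  assume "dird u (dird v f) x \<noteq> dird v (dird u f) x"
  then have ne: "\<bar>p x - q x\<bar> > 0" by (simp add: p_def q_def)
  define e where "e = \<bar>p x - q x\<bar> / 2"
  have e: "e > 0" using ne by (simp add: e_def)
  have "isCont p x" "isCont q x"
    using assms smooth_on_continuous smooth_on_dird unfolding p_def q_def
    by (metis continuous_on_eq_continuous_at)+
  then obtain d1 d2 where d: "d1 > 0" "d2 > 0"
    "\<And>y. dist y x < d1 \<Longrightarrow> dist (p y) (p x) < e" "\<And>y. dist y x < d2 \<Longrightarrow> dist (q y) (q x) < e"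
    using e unfolding continuous_at_eps_delta by (metis dist_commute)
  obtain d3 where d3: "d3 > 0" "ball x d3 \<subseteq> S"
    using assms openE by blast
  define \<delta> where "\<delta> = Min {d1, d2, d3}"
  \<comment> \<open>The summand 1 keeps the denominator positive when both vectors are 0; the factor
    2 puts the parallelogram strictly inside the ball of radius \<delta>.\<close>
  define h where "h = \<delta> / (2 * (norm u + norm v + 1))"
  have pos: "norm u + norm v + 1 > 0" by (smt (verit) norm_ge_zero)
  have \<delta>: "\<delta> > 0" "\<delta> \<le> d1" "\<delta> \<le> d2" "\<delta> \<le> d3" using d d3 by (auto simp: \<delta>_def)
  have h: "h > 0" using \<delta> pos by (simp add: h_def)
  have near: "dist (x + s *\<^sub>R u + t *\<^sub>R v) x < \<delta>" if "0 \<le> s" "s \<le> h" "0 \<le> t" "t \<le> h" for s t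
  proof -
    have "dist (x + s *\<^sub>R u + t *\<^sub>R v) x = norm (s *\<^sub>R u + t *\<^sub>R v)"
      by (simp add: dist_norm)
    also have "\<dots> \<le> s * norm u + t * norm v"
      using norm_triangle_ineq[of "s *\<^sub>R u" "t *\<^sub>R v"] that by simp
    also have "\<dots> \<le> h * norm u + h * norm v"
      using that by (intro add_mono mult_right_mono) auto
    also have "\<dots> \<le> h * (norm u + norm v + 1)"
      using h by (simp add: algebra_simps)
    also have "\<dots> = \<delta> / 2" using pos unfolding h_def by (simp add: field_split_simps)
    also have "\<dots> < \<delta>" using \<delta> by simp
    finally show ?thesis .
  qed
  have inS: "x + s *\<^sub>R u + t *\<^sub>R v \<in> S" if "0 \<le> s" "s \<le> h" "0 \<le> t" "t \<le> h" for s t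
    using near[OF that] \<delta> d3 by (auto simp: dist_commute subset_iff)
  have inS': "x + s *\<^sub>R v + t *\<^sub>R u \<in> S" if "0 \<le> s" "s \<le> h" "0 \<le> t" "t \<le> h" for s t
    using inS[of t s] that by (simp add: algebra_simps)
  obtain s t where st: "0 < s" "s < h" "0 < t" "t < h"
    "f (x + h *\<^sub>R u + h *\<^sub>R v) - f (x + h *\<^sub>R u) - f (x + h *\<^sub>R v) + f x
       = h * h * q (x + s *\<^sub>R u + t *\<^sub>R v)"
    using second_difference_mvt[OF inS assms(3) h] unfolding q_def by blast
  obtain s' t' where st': "0 < s'" "s' < h" "0 < t'" "t' < h"
    "f (x + h *\<^sub>R v + h *\<^sub>R u) - f (x + h *\<^sub>R v) - f (x + h *\<^sub>R u) + f x
       = h * h * p (x + s' *\<^sub>R v + t' *\<^sub>R u)"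
    using second_difference_mvt[OF inS' assms(3) h] unfolding p_def by blast
  have "h * h * q (x + s *\<^sub>R u + t *\<^sub>R v) = h * h * p (x + t' *\<^sub>R u + s' *\<^sub>R v)"
    using st(5) st'(5) by (simp add: algebra_simps)
  then have eq: "q (x + s *\<^sub>R u + t *\<^sub>R v) = p (x + t' *\<^sub>R u + s' *\<^sub>R v)" using h by simp
  have "dist (q (x + s *\<^sub>R u + t *\<^sub>R v)) (q x) < e" "dist (p (x + t' *\<^sub>R u + s' *\<^sub>R v)) (p x) < e"
    using d near[of s t] near[of t' s'] st st' \<delta> by auto
  then show False using eq unfolding e_def dist_real_def by argo
qed

section \<open>Differential operators of a frame\<close>

lemma vf_apply_eq_dird: "vf_apply X f x = dird (X x) f x"
  by (simp add: vf_apply_def dird_def)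

lemma vf_bracket_eq_dird: "vf_bracket X Y x = dird (X x) Y x - dird (Y x) X x"
  by (simp add: vf_bracket_def dird_def)

lemma vf_apply_cong_open:
  "open S \<Longrightarrow> x \<in> S \<Longrightarrow> (\<And>y. y \<in> S \<Longrightarrow> f y = g y) \<Longrightarrow> vf_apply X f x = vf_apply X g x"
  unfolding vf_apply_eq_dird by (rule dird_cong_open)

lemma vf_apply_nth: "vf_apply X (\<lambda>x. x $ k) = (\<lambda>x. X x $ k)"
  by (rule ext, simp add: vf_apply_eq_dird dird_bounded_linear bounded_linear_vec_nth)

lemma frame_apply_Nil [simp]: "frame_apply Y [] f = f"
  by (simp add: frame_apply_def)

lemma frame_apply_Cons: "frame_apply Y (i # I) f = vf_apply (Y i) (frame_apply Y I f)"
  by (simp add: frame_apply_def)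

lemma frame_apply_append: "frame_apply Y (I @ J) f = frame_apply Y I (frame_apply Y J f)"
  by (simp add: frame_apply_def)

lemma index_weight_simps [simp]:
  "index_weight w [] = 0" "index_weight w (i # I) = w i + index_weight w I"
  "index_weight w (I @ J) = index_weight w I + index_weight w J"
  by (simp_all add: index_weight_def)

lemma frame_apply_cong_open:
  assumes "open S" "x \<in> S" "\<And>y. y \<in> S \<Longrightarrow> f y = g y"
  shows "frame_apply Y I f x = frame_apply Y I g x"
  using assms(2)
proof (induction I arbitrary: x)
  case (Cons i I)
  then show ?case unfolding frame_apply_Cons by (intro vf_apply_cong_open[OF assms(1)])
qed (simp add: assms)

text \<open>The vanishing half of \<open>has_order\<close>. It is the half that is stable under sums
  and products; the nonvanishing half is automatic for the coordinate functions of adapted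
  coordinates.\<close>

definition order_ge ::
  "('n::finite \<Rightarrow> nat) \<Rightarrow> ('n \<Rightarrow> 'n vfield) \<Rightarrow> (real ^ 'n \<Rightarrow> real) \<Rightarrow> real ^ 'n \<Rightarrow> nat \<Rightarrow> bool" where
  "order_ge w Y f a N \<longleftrightarrow> (\<forall>I. index_weight w I < N \<longrightarrow> frame_apply Y I f a = 0)"

lemma order_geD: "order_ge w Y f a N \<Longrightarrow> index_weight w I < N \<Longrightarrow> frame_apply Y I f a = 0"
  by (simp add: order_ge_def)

lemma order_ge_mono: "order_ge w Y f a N \<Longrightarrow> M \<le> N \<Longrightarrow> order_ge w Y f a M"
  by (simp add: order_ge_def)

text \<open>Words acting on \<open>vf_apply (Y i) f\<close> are words acting on \<open>f\<close>
  that end in \<open>i\<close>. Truncated subtraction is harmless because order at least 0 is no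
  condition.\<close>

lemma order_ge_vf_apply: "order_ge w Y f a N \<Longrightarrow> order_ge w Y (vf_apply (Y i) f) a (N - w i)"
  unfolding order_ge_def
proof (intro allI impI)
  fix I assume a: "\<forall>I. index_weight w I < N \<longrightarrow> frame_apply Y I f a = 0" "index_weight w I < N - w i"
  have "index_weight w (I @ [i]) < N" using a(2) by simp
  with a(1) have "frame_apply Y (I @ [i]) f a = 0" by blast
  then show "frame_apply Y I (vf_apply (Y i) f) a = 0"
    using frame_apply_append[of Y I "[i]" f] by (simp add: frame_apply_Cons)
qed

locale smooth_frame =
  fixes S :: "(real ^ 'n::finite) set" and Y :: "'n \<Rightarrow> 'n vfield"
  assumes open_S: "open S" and smooth_Y: "\<And>j. smooth_on S (Y j)"
begin

lemma smooth_vf_apply: "smooth_on S f \<Longrightarrow> smooth_on S (vf_apply (Y j) f)"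
  unfolding vf_apply_eq_dird[abs_def] by (rule smooth_on_dird_field[OF open_S _ smooth_Y])

lemma smooth_frame_apply: "smooth_on S f \<Longrightarrow> smooth_on S (frame_apply Y I f)"
  by (induction I) (simp_all add: frame_apply_Cons smooth_vf_apply)

lemma frame_apply_add:
  assumes "smooth_on S f" "smooth_on S g" "x \<in> S"
  shows "frame_apply Y I (\<lambda>x. f x + g x) x = frame_apply Y I f x + frame_apply Y I g x"
  using assms(3)
proof (induction I arbitrary: x)
  case (Cons i I)
  have "frame_apply Y (i # I) (\<lambda>x. f x + g x) x
      = vf_apply (Y i) (\<lambda>x. frame_apply Y I f x + frame_apply Y I g x) x"
    unfolding frame_apply_Cons by (rule vf_apply_cong_open[OF open_S Cons.prems Cons.IH])
  also have "\<dots> = vf_apply (Y i) (frame_apply Y I f) x + vf_apply (Y i) (frame_apply Y I g) x"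
    unfolding vf_apply_eq_dird
    by (intro dird_add smooth_on_differentiable[OF smooth_frame_apply] assms Cons.prems)
  finally show ?case by (simp add: frame_apply_Cons)
qed simp

lemma frame_apply_cmult:
  assumes "smooth_on S f" "x \<in> S"
  shows "frame_apply Y I (\<lambda>x. c * f x) x = c * frame_apply Y I f x"
  using assms(2)
proof (induction I arbitrary: x)
  case (Cons i I)
  have "frame_apply Y (i # I) (\<lambda>x. c * f x) x = vf_apply (Y i) (\<lambda>x. c * frame_apply Y I f x) x"
    unfolding frame_apply_Cons by (rule vf_apply_cong_open[OF open_S Cons.prems Cons.IH])
  also have "\<dots> = c * vf_apply (Y i) (frame_apply Y I f) x"
    unfolding vf_apply_eq_dird
    by (intro dird_cmult smooth_on_differentiable[OF smooth_frame_apply] assms Cons.prems)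
  finally show ?case by (simp add: frame_apply_Cons)
qed simp

lemma frame_apply_diff:
  assumes "smooth_on S f" "smooth_on S g" "x \<in> S"
  shows "frame_apply Y I (\<lambda>x. f x - g x) x = frame_apply Y I f x - frame_apply Y I g x"
proof -
  have "smooth_on S (\<lambda>x. - 1 * g x)"
    by (rule smooth_on_mult[OF open_S smooth_on_const assms(2)])
  from frame_apply_add[OF assms(1) this assms(3)] frame_apply_cmult[OF assms(2,3), of I "-1"]
  show ?thesis by simp
qed

lemma frame_apply_zero: "x \<in> S \<Longrightarrow> frame_apply Y I (\<lambda>x. 0) x = 0"
  using frame_apply_cmult[of "\<lambda>x. 0" x I 0] by simp

lemma frame_apply_sum:
  assumes "\<And>k. k \<in> K \<Longrightarrow> smooth_on S (f k)" "x \<in> S"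
  shows "frame_apply Y I (\<lambda>x. \<Sum>k\<in>K. f k x) x = (\<Sum>k\<in>K. frame_apply Y I (f k) x)"
  using assms(1)
proof (induction K rule: infinite_finite_induct)
  case (insert k K)
  have "smooth_on S (\<lambda>x. \<Sum>k\<in>K. f k x)" using insert by (intro smooth_on_sum open_S) auto
  then show ?case using insert assms(2) by (simp add: frame_apply_add)
qed (simp_all add: frame_apply_zero assms(2))

lemma vf_apply_mult:
  assumes "smooth_on S f" "smooth_on S g" "x \<in> S"
  shows "vf_apply (Y i) (\<lambda>x. f x * g x) x = vf_apply (Y i) f x * g x + f x * vf_apply (Y i) g x"
  unfolding vf_apply_eq_dird by (rule dird_mult[OF smooth_on_differentiable[OF assms(1,3)] smooth_on_differentiable[OF assms(2,3)]])

text \<open>Leibniz' rule is applied to the innermost field, so that an induction on the word from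
  its right end changes only the two factors.\<close>

lemma frame_apply_snoc_mult:
  assumes "smooth_on S f" "smooth_on S g" "x \<in> S"
  shows "frame_apply Y (I @ [i]) (\<lambda>x. f x * g x) x =
    frame_apply Y I (\<lambda>x. vf_apply (Y i) f x * g x) x + frame_apply Y I (\<lambda>x. f x * vf_apply (Y i) g x) x"
proof -
  have "frame_apply Y (I @ [i]) (\<lambda>x. f x * g x) x =
     frame_apply Y I (\<lambda>x. vf_apply (Y i) f x * g x + f x * vf_apply (Y i) g x) x"
    unfolding frame_apply_append frame_apply_Cons frame_apply_Nil
    by (rule frame_apply_cong_open[OF open_S assms(3)]) (rule vf_apply_mult[OF assms(1,2)])
  then show ?thesis
    by (simp add: frame_apply_add assms smooth_on_mult smooth_vf_apply open_S)
qed

text \<open>Each letter of the word falls on one factor and lowers its order by at most the weight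
  of the letter. A total weight below \<open>N + M\<close> cannot use up both orders, and at the end
  a factor of positive order vanishes at the point.\<close>

lemma order_ge_mult:
  assumes "smooth_on S f" "smooth_on S g" "x \<in> S" "order_ge w Y f x N" "order_ge w Y g x M"
  shows "order_ge w Y (\<lambda>x. f x * g x) x (N + M)"
proof -
  have "frame_apply Y I (\<lambda>x. f x * g x) x = 0" if "index_weight w I < N + M" for I
    using that assms(1,2,4,5)
  proof (induction I arbitrary: f g N M rule: rev_induct)
    case Nil
    then have "0 < N \<or> 0 < M" by auto
    then show ?case
      using Nil order_geD[of w Y f x N "[]"] order_geD[of w Y g x M "[]"] by auto
  next
    case (snoc i I)
    have "frame_apply Y I (\<lambda>x. vf_apply (Y i) f x * g x) x = 0"
      by (rule snoc.IH[where N = "N - w i" and M = M])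
        (use snoc.prems in \<open>auto intro: smooth_vf_apply order_ge_vf_apply\<close>)
    moreover have "frame_apply Y I (\<lambda>x. f x * vf_apply (Y i) g x) x = 0"
      by (rule snoc.IH[where N = N and M = "M - w i"])
        (use snoc.prems in \<open>auto intro: smooth_vf_apply order_ge_vf_apply\<close>)
    ultimately show ?case using frame_apply_snoc_mult[OF snoc.prems(2,3) assms(3)] by simp
  qed
  then show ?thesis by (simp add: order_ge_def)
qed

lemma order_ge_diff:
  "smooth_on S f \<Longrightarrow> smooth_on S g \<Longrightarrow> x \<in> S \<Longrightarrow> order_ge w Y f x N \<Longrightarrow> order_ge w Y g x N \<Longrightarrow>
    order_ge w Y (\<lambda>x. f x - g x) x N"
  by (simp add: order_ge_def frame_apply_diff)

lemma order_ge_cmult: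
  "smooth_on S f \<Longrightarrow> x \<in> S \<Longrightarrow> order_ge w Y f x N \<Longrightarrow> order_ge w Y (\<lambda>x. c * f x) x N"
  by (simp add: order_ge_def frame_apply_cmult)

lemma order_ge_sum:
  "(\<And>k. k \<in> K \<Longrightarrow> smooth_on S (f k)) \<Longrightarrow> x \<in> S \<Longrightarrow> (\<And>k. k \<in> K \<Longrightarrow> order_ge w Y (f k) x N) \<Longrightarrow>
    order_ge w Y (\<lambda>x. \<Sum>k\<in>K. f k x) x N"
  by (simp add: order_ge_def frame_apply_sum)

text \<open>Letters that fall on \<open>f\<close> are lost to \<open>g\<close>, so \<open>g\<close>
  only meets words that are no longer and no heavier than \<open>I\<close>. This is used with a
  structure function in the role of \<open>f\<close>.\<close>

lemma frame_apply_mult_eq_0: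
  assumes "smooth_on S f" "smooth_on S g" "x \<in> S" "length I \<le> n" "index_weight w I \<le> N"
    and "\<And>J. length J \<le> n \<Longrightarrow> index_weight w J \<le> N \<Longrightarrow> frame_apply Y J g x = 0"
  shows "frame_apply Y I (\<lambda>x. f x * g x) x = 0"
  using assms(1,2,4,5,6)
proof (induction I arbitrary: f g n N rule: rev_induct)
  case Nil
  then show ?case using Nil(5)[of "[]"] by simp
next
  case (snoc i I)
  have "frame_apply Y I (\<lambda>x. vf_apply (Y i) f x * g x) x = 0"
    by (rule snoc.IH[of _ _ n N]) (use snoc.prems in \<open>auto intro: smooth_vf_apply\<close>)
  moreover have "frame_apply Y I (\<lambda>x. f x * vf_apply (Y i) g x) x = 0"
  proof (rule snoc.IH[of _ _ "n - 1" "N - w i"])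
    fix J assume "length J \<le> n - 1" "index_weight w J \<le> N - w i"
    then have "frame_apply Y (J @ [i]) g x = 0" using snoc.prems by (intro snoc.prems(5)) auto
    then show "frame_apply Y J (vf_apply (Y i) g) x = 0"
      by (simp add: frame_apply_append frame_apply_Cons)
  qed (use snoc.prems in \<open>auto intro: smooth_vf_apply\<close>)
  ultimately show ?case using frame_apply_snoc_mult[OF snoc.prems(1,2) assms(3)] by simp
qed

lemma vf_apply_vf_apply:
  assumes "smooth_on S f" "x \<in> S"
  shows "vf_apply (Y i) (vf_apply (Y j) f) x =
     dird (dird (Y i x) (Y j) x) f x + (\<Sum>l\<in>UNIV. Y j x $ l * dird (Y i x) (dird (axis l 1) f) x)"
proof -
  have df: "f differentiable at y" if "y \<in> S" for y
    by (rule smooth_on_differentiable[OF assms(1) that])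
  have "vf_apply (Y i) (vf_apply (Y j) f) x
      = dird (Y i x) (\<lambda>x. \<Sum>l\<in>UNIV. (Y j x $ l) * dird (axis l 1) f x) x"
    unfolding vf_apply_eq_dird
    by (rule dird_cong_open[OF open_S assms(2)])
      (simp add: vf_apply_eq_dird dird_expand[OF df, of _ "Y j _"])
  also have "\<dots> = (\<Sum>l\<in>UNIV. dird (Y i x) (\<lambda>x. (Y j x $ l) * dird (axis l 1) f x) x)"
    by (rule dird_sum, rule smooth_on_differentiable)
      (auto intro!: smooth_on_mult smooth_on_nth smooth_on_dird assms smooth_Y open_S)
  also have "\<dots> = (\<Sum>l\<in>UNIV. dird (Y i x) (Y j) x $ l * dird (axis l 1) f x
        + Y j x $ l * dird (Y i x) (dird (axis l 1) f) x)"
  proof (rule sum.cong[OF refl])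
    fix l
    have "(\<lambda>x. Y j x $ l) differentiable at x" "dird (axis l 1) f differentiable at x"
      using smooth_on_differentiable[OF smooth_on_nth[OF open_S smooth_Y] assms(2)]
        smooth_on_differentiable[OF smooth_on_dird[OF assms(1)] assms(2)] by simp_all
    from dird_mult[OF this, of "Y i x"]
    show "dird (Y i x) (\<lambda>x. (Y j x $ l) * dird (axis l 1) f x) x = dird (Y i x) (Y j) x $ l * dird (axis l 1) f x
        + Y j x $ l * dird (Y i x) (dird (axis l 1) f) x"
      using dird_nth[OF smooth_on_differentiable[OF smooth_Y assms(2)]] by simp
  qed
  finally show ?thesis
    using dird_expand[OF df[OF assms(2)], of "dird (Y i x) (Y j) x"] by (simp add: sum.distrib)
qed

text \<open>The second-order parts of the two compositions agree by symmetry of second derivatives,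
  which leaves the first-order part.\<close>

lemma vf_apply_bracket:
  assumes "smooth_on S f" "x \<in> S"
  shows "vf_apply (Y i) (vf_apply (Y j) f) x - vf_apply (Y j) (vf_apply (Y i) f) x
    = dird (vf_bracket (Y i) (Y j) x) f x"
proof -
  note df = smooth_on_differentiable[OF assms]
  have e: "dird u (dird (axis l 1) f) x = (\<Sum>m\<in>UNIV. u $ m * dird (axis m 1) (dird (axis l 1) f) x)" for u l
    using dird_expand[OF smooth_on_differentiable[OF smooth_on_dird[OF assms(1)] assms(2)], of u] by simp
  have "(\<Sum>l\<in>UNIV. Y j x $ l * dird (Y i x) (dird (axis l 1) f) x)
      = (\<Sum>l\<in>UNIV. \<Sum>m\<in>UNIV. Y j x $ l * Y i x $ m * dird (axis m 1) (dird (axis l 1) f) x)"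
    by (simp add: e[of "Y i x"] sum_distrib_left mult.assoc)
  also have "\<dots> = (\<Sum>m\<in>UNIV. \<Sum>l\<in>UNIV. Y j x $ l * Y i x $ m * dird (axis l 1) (dird (axis m 1) f) x)"
    by (subst sum.swap) (simp add: dird_commute[OF open_S assms(2,1), of "axis _ 1" "axis _ 1"])
  also have "\<dots> = (\<Sum>l\<in>UNIV. Y i x $ l * dird (Y j x) (dird (axis l 1) f) x)"
    by (simp add: e[of "Y j x"] sum_distrib_left mult.assoc mult.left_commute)
  finally have "(\<Sum>l\<in>UNIV. Y j x $ l * dird (Y i x) (dird (axis l 1) f) x)
      = (\<Sum>l\<in>UNIV. Y i x $ l * dird (Y j x) (dird (axis l 1) f) x)" .
  then show ?thesis
    unfolding vf_apply_vf_apply[OF assms] vf_bracket_eq_dird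
    by (simp add: linear_diff[OF linear_dird[OF df]])
qed

text \<open>Reading a bracket off its action on coordinate functions makes it transportable by
  results about functions alone.\<close>

lemma vf_bracket_nth:
  assumes "x \<in> S"
  shows "vf_bracket (Y i) (Y j) x $ k =
    vf_apply (Y i) (vf_apply (Y j) (\<lambda>x. x $ k)) x - vf_apply (Y j) (vf_apply (Y i) (\<lambda>x. x $ k)) x"
  unfolding vf_apply_nth
  by (simp add: vf_apply_eq_dird vf_bracket_eq_dird dird_nth smooth_on_differentiable[OF smooth_Y assms])

end

text \<open>\<open>L_eq_0\<close> is the bracket condition of the filtration expressed in the frame:
  the bracket of two frame fields has no component of weight above the sum of their weights.\<close>

locale hframe = smooth_frame S Y
  for S :: "(real ^ 'n::finite) set" and Y :: "'n \<Rightarrow> 'n vfield" +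
  fixes w :: "'n \<Rightarrow> nat" and L :: "'n \<Rightarrow> 'n \<Rightarrow> 'n \<Rightarrow> real ^ 'n \<Rightarrow> real"
  assumes w_pos: "\<And>j. 0 < w j"
    and smooth_L: "\<And>i j k. smooth_on S (L i j k)"
    and L_eq_0: "\<And>i j k x. x \<in> S \<Longrightarrow> w i + w j < w k \<Longrightarrow> L i j k x = 0"
    and bracket: "\<And>i j x. x \<in> S \<Longrightarrow> vf_bracket (Y i) (Y j) x = (\<Sum>k\<in>UNIV. L i j k x *\<^sub>R Y k x)"
begin

lemma length_le_weight: "length I \<le> index_weight w I"
proof (induction I)
  case (Cons i I)
  then show ?case using w_pos[of i] by simp
qed simp

lemma commutator_eq:
  assumes "smooth_on S f" "x \<in> S"
  shows "vf_apply (Y i) (vf_apply (Y j) f) x - vf_apply (Y j) (vf_apply (Y i) f) x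
    = (\<Sum>k\<in>UNIV. L i j k x * vf_apply (Y k) f x)"
  unfolding vf_apply_bracket[OF assms] bracket[OF assms(2)]
  by (simp add: linear_sum[OF linear_dird[OF smooth_on_differentiable[OF assms]]]
      linear_scale[OF linear_dird[OF smooth_on_differentiable[OF assms]]] vf_apply_eq_dird)

text \<open>The commutator of two neighbours is a combination of single fields of weight at most
  \<open>w i + w j\<close>. One letter is gone and the weight has not grown, so \<open>low\<close>
  disposes of it; derivatives that fall on the coefficients \<open>L\<close> only shorten the words
  further.\<close>

lemma frame_apply_swap:
  assumes f: "smooth_on S f" and x: "x \<in> S"
    and low: "\<And>J. length J < length (I1 @ [i, j] @ I2) \<Longrightarrow> index_weight w J < N \<Longrightarrow> frame_apply Y J f x = 0"
    and N: "index_weight w (I1 @ [i, j] @ I2) < N"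
  shows "frame_apply Y (I1 @ [i, j] @ I2) f x = frame_apply Y (I1 @ [j, i] @ I2) f x"
proof -
  define g where "g = frame_apply Y I2 f"
  have g: "smooth_on S g" by (simp add: g_def smooth_frame_apply f)
  have sm: "smooth_on S (\<lambda>x. L i j k x * vf_apply (Y k) g x)" for k
    by (intro smooth_on_mult open_S smooth_L smooth_vf_apply g)
  have 0: "frame_apply Y I1 (\<lambda>x. L i j k x * vf_apply (Y k) g x) x = 0" for k
  proof (cases "w i + w j < w k")
    case True
    have "frame_apply Y I1 (\<lambda>x. L i j k x * vf_apply (Y k) g x) x = frame_apply Y I1 (\<lambda>x. 0) x"
      by (rule frame_apply_cong_open[OF open_S x]) (simp add: L_eq_0 True)
    then show ?thesis using x by (simp add: frame_apply_zero)
  next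
    case False
    show ?thesis
    proof (rule frame_apply_mult_eq_0[OF smooth_L smooth_vf_apply[OF g] x order_refl order_refl])
      fix J assume "length J \<le> length I1" "index_weight w J \<le> index_weight w I1"
      then have "frame_apply Y (J @ [k] @ I2) f x = 0"
        using False N by (intro low) auto
      then show "frame_apply Y J (vf_apply (Y k) g) x = 0"
        by (simp add: frame_apply_append frame_apply_Cons g_def)
    qed
  qed
  have "frame_apply Y I1 (vf_apply (Y i) (vf_apply (Y j) g)) x - frame_apply Y I1 (vf_apply (Y j) (vf_apply (Y i) g)) x
      = frame_apply Y I1 (\<lambda>x. vf_apply (Y i) (vf_apply (Y j) g) x - vf_apply (Y j) (vf_apply (Y i) g) x) x"
    by (intro frame_apply_diff[symmetric] smooth_vf_apply g x)
  also have "\<dots> = frame_apply Y I1 (\<lambda>x. \<Sum>k\<in>UNIV. L i j k x * vf_apply (Y k) g x) x"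
    by (rule frame_apply_cong_open[OF open_S x]) (rule commutator_eq[OF g])
  also have "\<dots> = 0" by (simp add: frame_apply_sum[OF sm x] 0)
  finally show ?thesis by (simp add: frame_apply_append frame_apply_Cons g_def)
qed

lemma frame_apply_to_front:
  assumes f: "smooth_on S f" and x: "x \<in> S"
    and low: "\<And>J. length J < length (I0 @ I1 @ [i] @ I2) \<Longrightarrow> index_weight w J < N \<Longrightarrow> frame_apply Y J f x = 0"
    and N: "index_weight w (I0 @ I1 @ [i] @ I2) < N"
  shows "frame_apply Y (I0 @ I1 @ [i] @ I2) f x = frame_apply Y (I0 @ [i] @ I1 @ I2) f x"
  using low N
proof (induction I1 arbitrary: I2 rule: rev_induct)
  case (snoc j I1)
  have "frame_apply Y (I0 @ (I1 @ [j]) @ [i] @ I2) f x = frame_apply Y ((I0 @ I1) @ [j, i] @ I2) f x"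
    by simp
  also have "\<dots> = frame_apply Y ((I0 @ I1) @ [i, j] @ I2) f x"
    using snoc.prems by (intro frame_apply_swap[OF f x, of "I0 @ I1" j i I2 N]) auto
  also have "\<dots> = frame_apply Y (I0 @ I1 @ [i] @ ([j] @ I2)) f x" by simp
  also have "\<dots> = frame_apply Y (I0 @ [i] @ I1 @ ([j] @ I2)) f x"
    by (rule snoc.IH) (use snoc.prems in auto)
  finally show ?case by simp
qed simp

text \<open>Reordering \<open>Y\<^sub>I\<close> only produces shorter operators of no larger weight.\<close>

lemma frame_apply_mset_cong:
  assumes f: "smooth_on S f" and x: "x \<in> S"
    and low: "\<And>J. length J < length I \<Longrightarrow> index_weight w J < N \<Longrightarrow> frame_apply Y J f x = 0"
    and N: "index_weight w I < N" and m: "mset I = mset I'"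
  shows "frame_apply Y I f x = frame_apply Y I' f x"
proof -
  \<comment> \<open>The prefix \<open>I0\<close> collects the letters already in place, so that the
    induction can continue behind them.\<close>
  have "frame_apply Y (I0 @ I) f x = frame_apply Y (I0 @ I') f x"
    if "\<And>J. length J < length (I0 @ I) \<Longrightarrow> index_weight w J < N \<Longrightarrow> frame_apply Y J f x = 0"
      "index_weight w (I0 @ I) < N" "mset I = mset I'" for I0
    using that
  proof (induction I arbitrary: I0 I')
    case (Cons i I)
    have "i \<in> set I'" using Cons.prems(3) by (metis list.set_intros(1) set_mset_mset)
    then obtain J1 J2 where I': "I' = J1 @ [i] @ J2"
      by (metis append_Cons append_Nil split_list)
    have len: "length I' = Suc (length I)" using Cons.prems(3) by (metis size_mset length_Cons)
    have iw: "index_weight w I' = index_weight w (i # I)"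
      unfolding index_weight_def using Cons.prems(3) by (metis mset_map sum_mset_sum_list)
    have "frame_apply Y (I0 @ i # I) f x = frame_apply Y ((I0 @ [i]) @ I) f x" by simp
    also have "\<dots> = frame_apply Y ((I0 @ [i]) @ (J1 @ J2)) f x"
      by (rule Cons.IH) (use Cons.prems I' in auto)
    also have "\<dots> = frame_apply Y (I0 @ [i] @ J1 @ J2) f x" by simp
    also have "\<dots> = frame_apply Y (I0 @ I') f x"
      unfolding I'
      by (rule frame_apply_to_front[OF f x, of I0 J1 i J2 N, symmetric])
        (use Cons.prems len iw I' in auto)
    finally show ?case .
  qed simp
  from this[of "[]"] assms show ?thesis by simp
qed

end

section \<open>Change of coordinates\<close>

locale coord_change = smooth_frame S Y
  for S :: "(real ^ 'n::finite) set" and Y :: "'n \<Rightarrow> 'n vfield" +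
  fixes T :: "(real ^ 'n) set" and \<phi> \<psi> :: "real ^ 'n \<Rightarrow> real ^ 'n"
  assumes image: "\<phi> ` S = T" and open_T: "open T"
    and smooth_\<phi>: "smooth_on S \<phi>" and smooth_\<psi>: "smooth_on T \<psi>"
    and inv: "\<And>x. x \<in> S \<Longrightarrow> \<psi> (\<phi> x) = x"
begin

definition Z :: "'n \<Rightarrow> 'n vfield" where
  "Z j y = dird (Y j (\<psi> y)) \<phi> (\<psi> y)"

lemma \<psi>_image: "\<psi> ` T \<subseteq> S" using image inv by auto

lemma \<phi>_\<psi>: "y \<in> T \<Longrightarrow> \<phi> (\<psi> y) = y" using image inv by auto

lemma smooth_Z: "smooth_on T (Z j)"
proof -
  have "smooth_on T (\<lambda>y. (\<lambda>x. dird (Y j x) \<phi> x) (\<psi> y))"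
    by (rule smooth_on_compose[OF open_T \<psi>_image smooth_on_dird_field[OF open_S smooth_\<phi> smooth_Y] smooth_\<psi>])
  then show ?thesis by (simp add: Z_def[abs_def])
qed

sublocale new: smooth_frame T Z
  by unfold_locales (rule open_T smooth_Z)+

lemma vf_apply_comp:
  assumes "smooth_on T f" "x \<in> S"
  shows "vf_apply (Z j) f (\<phi> x) = vf_apply (Y j) (\<lambda>x. f (\<phi> x)) x"
proof -
  have "\<phi> x \<in> T" using image assms by auto
  then show ?thesis
    unfolding vf_apply_eq_dird Z_def using assms
    by (simp add: inv dird_compose smooth_on_differentiable[OF smooth_\<phi>] smooth_on_differentiable[of T f])
qed

lemma frame_apply_comp:
  assumes "smooth_on T f" "x \<in> S"
  shows "frame_apply Z I f (\<phi> x) = frame_apply Y I (\<lambda>x. f (\<phi> x)) x"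
  using assms(2)
proof (induction I arbitrary: x)
  case (Cons i I)
  have "frame_apply Z (i # I) f (\<phi> x) = vf_apply (Y i) (\<lambda>x. frame_apply Z I f (\<phi> x)) x"
    unfolding frame_apply_Cons by (intro vf_apply_comp new.smooth_frame_apply assms Cons.prems)
  also have "\<dots> = vf_apply (Y i) (frame_apply Y I (\<lambda>x. f (\<phi> x))) x"
    by (rule vf_apply_cong_open[OF open_S Cons.prems Cons.IH])
  finally show ?case by (simp add: frame_apply_Cons)
qed simp

end

locale hcoord_change = coord_change S Y T \<phi> \<psi> + hframe S Y w L
  for S :: "(real ^ 'n::finite) set" and Y T \<phi> \<psi> w L
begin

text \<open>Components of a bracket are commutators applied to coordinate functions, and words of
  the frame transform by composition with \<phi>. So the new frame satisfies the same relations with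
  the coefficients moved along \<psi>.\<close>

sublocale hnew: hframe T Z w "\<lambda>i j k y. L i j k (\<psi> y)"
proof unfold_locales
  show "smooth_on T (\<lambda>y. L i j k (\<psi> y))" for i j k
    by (rule smooth_on_compose[OF open_T \<psi>_image smooth_L smooth_\<psi>])
  fix i j y assume y: "y \<in> T"
  define x where "x = \<psi> y"
  have x: "x \<in> S" "y = \<phi> x" using y \<psi>_image \<phi>_\<psi> by (auto simp: x_def)
  show "vf_bracket (Z i) (Z j) y = (\<Sum>k\<in>UNIV. L i j k (\<psi> y) *\<^sub>R Z k y)"
  proof (subst vec_eq_iff, rule allI)
    fix l
    have sl: "smooth_on T (\<lambda>x. x $ l)" "smooth_on S (\<lambda>x. \<phi> x $ l)"
      by (intro smooth_on_nth open_T open_S smooth_\<phi> smooth_on_id)+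
    have "vf_bracket (Z i) (Z j) y $ l = frame_apply Z [i, j] (\<lambda>x. x $ l) y - frame_apply Z [j, i] (\<lambda>x. x $ l) y"
      unfolding new.vf_bracket_nth[OF y] by (simp add: frame_apply_Cons)
    also have "\<dots> = (\<Sum>k\<in>UNIV. L i j k x * vf_apply (Y k) (\<lambda>x. \<phi> x $ l) x)"
      unfolding x(2) frame_apply_comp[OF sl(1) x(1)]
      using commutator_eq[OF sl(2) x(1), of i j] by (simp add: frame_apply_Cons)
    also have "\<dots> = (\<Sum>k\<in>UNIV. L i j k x * Z k y $ l)"
      using vf_apply_comp[OF sl(1) x(1)] by (simp add: vf_apply_nth x(2))
    finally show "vf_bracket (Z i) (Z j) y $ l = (\<Sum>k\<in>UNIV. L i j k (\<psi> y) *\<^sub>R Z k y) $ l"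
      by (simp add: x_def)
  qed
qed (use w_pos L_eq_0 \<psi>_image in auto)

end

section \<open>Partial derivatives and monomials\<close>

text \<open>Treating partial derivatives as words of a constant frame makes everything proved for
  \<open>frame_apply\<close> and \<open>order_ge\<close> available for Taylor expansions.\<close>

abbreviation coord_frame :: "'n::finite \<Rightarrow> 'n vfield" where
  "coord_frame \<equiv> (\<lambda>l x. axis l 1)"

abbreviation pd :: "'n::finite list \<Rightarrow> (real ^ 'n \<Rightarrow> real) \<Rightarrow> real ^ 'n \<Rightarrow> real" where
  "pd \<equiv> frame_apply coord_frame"

lemma vf_apply_coord: "vf_apply (coord_frame l) f = dird (axis l 1) f"
  by (rule ext) (simp add: vf_apply_eq_dird)

lemma pd_Cons: "pd (l # J) f = dird (axis l 1) (pd J f)"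
  by (simp only: frame_apply_Cons vf_apply_coord)

lemma pd_snoc: "pd (J @ [l]) f = pd J (dird (axis l 1) f)"
  by (simp only: frame_apply_append frame_apply_Cons frame_apply_Nil vf_apply_coord)

lemma smooth_frame_coord: "open S \<Longrightarrow> smooth_frame S coord_frame"
  by unfold_locales auto

lemma pd_to_front:
  assumes "open S" "smooth_on S f" "x \<in> S"
  shows "pd (I1 @ i # I2) f x = pd (i # I1 @ I2) f x"
  using assms(3)
proof (induction I1 arbitrary: x)
  case (Cons j I1)
  interpret smooth_frame S coord_frame by (rule smooth_frame_coord[OF assms(1)])
  have "pd ((j # I1) @ i # I2) f x = dird (axis j 1) (pd (i # I1 @ I2) f) x"
    unfolding append_Cons pd_Cons[of j] by (rule dird_cong_open[OF assms(1) Cons.prems Cons.IH])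
  also have "\<dots> = dird (axis i 1) (dird (axis j 1) (pd (I1 @ I2) f)) x"
    unfolding pd_Cons by (rule dird_commute[OF assms(1) Cons.prems smooth_frame_apply[OF assms(2)]])
  finally show ?case by (simp add: pd_Cons)
qed simp

lemma pd_mset_cong:
  assumes "open S" "smooth_on S f" "x \<in> S" "mset I = mset I'"
  shows "pd I f x = pd I' f x"
  using assms(3,4)
proof (induction I arbitrary: I' x)
  case (Cons i I)
  have "i \<in> set I'" using Cons.prems(2) by (metis list.set_intros(1) set_mset_mset)
  then obtain J1 J2 where I': "I' = J1 @ i # J2" by (metis split_list)
  have "pd (i # I) f x = pd (i # J1 @ J2) f x"
    unfolding pd_Cons
    by (rule dird_cong_open[OF assms(1) Cons.prems(1) Cons.IH]) (use Cons.prems I' in auto)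
  then show ?case using pd_to_front[OF assms(1,2) Cons.prems(1)] I' by simp
qed simp

lemma monomial_0_exp [simp]: "monomial (\<lambda>_. 0) x = 1"
  by (simp add: monomial_def)

lemma monomial_add: "monomial (\<lambda>j. \<alpha> j + \<beta> j) x = monomial \<alpha> x * monomial \<beta> x"
  by (simp add: monomial_def power_add prod.distrib)

lemma monomial_at_0: "monomial \<alpha> 0 = (if \<forall>l. \<alpha> l = 0 then 1 else 0)"
proof (cases "\<forall>l. \<alpha> l = 0")
  case False
  then obtain l where "\<alpha> l \<noteq> 0" by blast
  then show ?thesis unfolding monomial_def
    by (intro trans[OF prod_zero[of UNIV]]) (auto intro!: bexI[of _ l] simp: power_0_left)
qed (simp add: monomial_def)

definition single :: "'n \<Rightarrow> 'n \<Rightarrow> nat" where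
  "single l = (\<lambda>j. if j = l then 1 else 0)"

lemma monomial_single: "monomial (single l) x = x $ l"
proof -
  have "monomial (single l) x = (\<Prod>j\<in>UNIV. if j = l then x $ j else 1)"
    unfolding monomial_def single_def by (rule prod.cong) auto
  then show ?thesis by simp
qed

lemma monomial_dilation: "monomial \<alpha> (dilation w t x) = t ^ multi_weight w \<alpha> * monomial \<alpha> x"
  by (simp add: monomial_def dilation_def multi_weight_def power_mult_distrib prod.distrib
      power_sum power_mult)

lemma smooth_monomial: "open S \<Longrightarrow> smooth_on S (monomial \<alpha>)"
  unfolding monomial_def[abs_def] by (intro smooth_on_prod smooth_on_power smooth_on_nth smooth_on_id)

lemma dird_coord_power: "dird v (\<lambda>x :: real ^ 'n. x $ l ^ n) x = n * x $ l ^ (n - 1) * v $ l"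
proof -
  have "((\<lambda>x. x $ l) has_derivative (\<lambda>v. v $ l)) (at x)"
    by (rule bounded_linear_imp_has_derivative[OF bounded_linear_vec_nth])
  from has_derivative_power[OF this, of n] show ?thesis
    by (intro dird_eqI[THEN trans]) (auto simp: mult_ac)
qed

lemma axis_nth_neq: "j \<noteq> l \<Longrightarrow> axis l x $ j = 0"
  by (simp add: axis_def)

lemma dird_prod_coord_powers:
  "finite K \<Longrightarrow> l \<notin> K \<Longrightarrow> dird (axis l 1) (\<lambda>x :: real ^ 'n. \<Prod>j\<in>K. x $ j ^ \<alpha> j) x = 0"
proof (induction K rule: finite_induct)
  case (insert j K)
  have "(\<lambda>x :: real ^ 'n. x $ j ^ \<alpha> j) differentiable at x"
    by (rule smooth_on_differentiable[of UNIV]) (intro smooth_on_power smooth_on_nth smooth_on_id open_UNIV UNIV_I)+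
  moreover have "(\<lambda>x :: real ^ 'n. \<Prod>j\<in>K. x $ j ^ \<alpha> j) differentiable at x"
    by (rule smooth_on_differentiable[of UNIV]) (intro smooth_on_prod smooth_on_power smooth_on_nth smooth_on_id open_UNIV UNIV_I)+
  ultimately show ?case
    using insert by (auto simp: dird_mult dird_coord_power axis_nth_neq)
qed simp

text \<open>The truncated exponent is harmless: for \<open>\<alpha> l = 0\<close> the factor in
  front is 0.\<close>

lemma dird_monomial:
  "dird (axis l 1) (monomial \<alpha>) x = \<alpha> l * monomial (\<alpha>(l := \<alpha> l - 1)) x"
proof -
  let ?B = "\<lambda>x. \<Prod>j\<in>UNIV - {l}. x $ j ^ \<alpha> j"
  have split: "monomial \<beta> x = x $ l ^ \<beta> l * (\<Prod>j\<in>UNIV - {l}. x $ j ^ \<beta> j)" for \<beta> x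
    unfolding monomial_def by (rule prod.remove) auto
  have "(\<lambda>x. x $ l ^ \<alpha> l) differentiable at x"
    by (rule smooth_on_differentiable[of UNIV]) (intro smooth_on_power smooth_on_nth smooth_on_id open_UNIV UNIV_I)+
  moreover have "?B differentiable at x"
    by (rule smooth_on_differentiable[of UNIV]) (intro smooth_on_prod smooth_on_power smooth_on_nth smooth_on_id open_UNIV UNIV_I)+
  ultimately have "dird (axis l 1) (\<lambda>x. x $ l ^ \<alpha> l * ?B x) x = \<alpha> l * x $ l ^ (\<alpha> l - 1) * ?B x"
    by (simp add: dird_mult dird_coord_power dird_prod_coord_powers)
  moreover have "(\<Prod>j\<in>UNIV - {l}. x $ j ^ (\<alpha>(l := \<alpha> l - 1)) j) = ?B x"
    by (rule prod.cong) auto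
  ultimately show ?thesis unfolding split[of "\<alpha>(l := \<alpha> l - 1)"] split[of \<alpha>, abs_def] by simp
qed

definition multi_fact :: "('n::finite \<Rightarrow> nat) \<Rightarrow> real" where
  "multi_fact \<alpha> = (\<Prod>j\<in>UNIV. fact (\<alpha> j))"

lemma multi_fact_nonzero [simp]: "multi_fact \<alpha> \<noteq> 0"
  by (simp add: multi_fact_def)

lemma multi_fact_dec:
  assumes "\<alpha> l \<noteq> 0"
  shows "multi_fact \<alpha> = \<alpha> l * multi_fact (\<alpha>(l := \<alpha> l - 1))"
proof -
  have split: "multi_fact \<beta> = fact (\<beta> l) * (\<Prod>j\<in>UNIV - {l}. fact (\<beta> j))" for \<beta>
    unfolding multi_fact_def by (rule prod.remove) auto
  have "(\<Prod>j\<in>UNIV - {l}. fact ((\<alpha>(l := \<alpha> l - 1)) j)) = (\<Prod>j\<in>UNIV - {l}. fact (\<alpha> j) :: real)"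
    by (rule prod.cong) auto
  moreover have "(fact (\<alpha> l) :: real) = \<alpha> l * fact (\<alpha> l - 1)" using assms by (simp add: fact_reduce)
  ultimately show ?thesis unfolding split[of \<alpha>] split[of "\<alpha>(l := \<alpha> l - 1)"] by simp
qed

lemma pd_monomial_at_0:
  "pd J (monomial \<alpha>) 0 = (if \<forall>l. count (mset J) l = \<alpha> l then multi_fact \<alpha> else 0)"
proof (induction J arbitrary: \<alpha> rule: rev_induct)
  case Nil
  then show ?case by (auto simp: monomial_at_0 multi_fact_def)
next
  case (snoc l J)
  interpret smooth_frame UNIV coord_frame by (rule smooth_frame_coord) simp
  have "pd (J @ [l]) (monomial \<alpha>) 0 = pd J (\<lambda>x. \<alpha> l * monomial (\<alpha>(l := \<alpha> l - 1)) x) 0"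
    unfolding pd_snoc dird_monomial[abs_def] ..
  also have "\<dots> = \<alpha> l * pd J (monomial (\<alpha>(l := \<alpha> l - 1))) 0"
    by (rule frame_apply_cmult) (auto intro: smooth_monomial)
  also have "\<dots> = (if \<forall>j. count (mset (J @ [l])) j = \<alpha> j then multi_fact \<alpha> else 0)"
  proof (cases "\<alpha> l = 0")
    case True
    then show ?thesis by (auto intro!: exI[of _ l])
  next
    case False
    have "(\<forall>j. count (mset J) j = (\<alpha>(l := \<alpha> l - 1)) j) \<longleftrightarrow> (\<forall>j. count (mset (J @ [l])) j = \<alpha> j)"
      using False by (auto simp: fun_eq_iff split: if_splits)
    then show ?thesis unfolding snoc.IH using multi_fact_dec[of \<alpha> l] False by simp
  qed
  finally show ?case .
qed

text \<open>Any word with the letter counts \<alpha> serves: partial derivatives commute, and words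
  of an \<open>H\<close>-frame are reordered by \<open>frame_apply_mset_cong\<close> where this
  matters.\<close>

definition mlist :: "('n::finite \<Rightarrow> nat) \<Rightarrow> 'n list" where
  "mlist \<alpha> = (SOME J. \<forall>l. count (mset J) l = \<alpha> l)"

lemma count_mlist [simp]: "count (mset (mlist \<alpha>)) l = \<alpha> l"
proof -
  obtain J where "mset J = (\<Sum>l\<in>UNIV. replicate_mset (\<alpha> l) l)" using ex_mset by blast
  then have "\<forall>l. count (mset J) l = \<alpha> l" by (simp add: count_sum)
  then show ?thesis unfolding mlist_def by (rule someI2) simp
qed

lemma sum_count: "(\<Sum>l\<in>UNIV. f l * count (mset J) l) = (\<Sum>l\<leftarrow>J. f l)"
  for f :: "'n::finite \<Rightarrow> nat"
proof (induction J)
  case (Cons i J)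
  have "(\<Sum>l\<in>UNIV. f l * count (mset (i # J)) l) = (\<Sum>l\<in>UNIV. f l * count (mset J) l + (if l = i then f l else 0))"
    by (rule sum.cong) auto
  then show ?case using Cons by (simp add: sum.distrib)
qed simp

lemma index_weight_eq_multi: "index_weight w J = multi_weight w (count (mset J))"
  by (simp add: index_weight_def multi_weight_def sum_count)

lemma length_eq_multi: "length J = multi_degree (count (mset J))"
  using sum_count[of "\<lambda>_. 1" J] by (simp add: multi_degree_def sum_list_triv)

lemma count_mlist': "count (mset (mlist \<alpha>)) = \<alpha>" by auto

lemma index_weight_mlist [simp]: "index_weight w (mlist \<alpha>) = multi_weight w \<alpha>"
  by (simp only: index_weight_eq_multi count_mlist')

lemma length_mlist [simp]: "length (mlist \<alpha>) = multi_degree \<alpha>"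
  by (simp only: length_eq_multi count_mlist')

lemma pd_mlist_count:
  "open S \<Longrightarrow> smooth_on S f \<Longrightarrow> x \<in> S \<Longrightarrow> pd (mlist (count (mset J))) f x = pd J f x"
  by (rule pd_mset_cong) (auto simp: multiset_eq_iff)

lemma multi_degree_add: "multi_degree (\<lambda>j. \<alpha> j + \<beta> j) = multi_degree \<alpha> + multi_degree \<beta>"
  by (simp add: multi_degree_def sum.distrib)

lemma multi_weight_add: "multi_weight w (\<lambda>j. \<alpha> j + \<beta> j) = multi_weight w \<alpha> + multi_weight w \<beta>"
  by (simp add: multi_weight_def sum.distrib algebra_simps)

lemma multi_degree_0 [simp]: "multi_degree (\<lambda>_. 0) = 0" "multi_weight w (\<lambda>_. 0) = 0"
  by (simp_all add: multi_degree_def multi_weight_def)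

lemma multi_degree_single [simp]: "multi_degree (single l) = 1" "multi_weight w (single l) = w l"
  by (simp_all add: multi_degree_def multi_weight_def single_def if_distrib cong: if_cong)

lemma multi_degree_eq_0_iff: "multi_degree \<alpha> = 0 \<longleftrightarrow> \<alpha> = (\<lambda>_. 0)"
  by (auto simp: multi_degree_def fun_eq_iff)

lemma multi_degree_le_weight: "(\<And>j. 0 < w j) \<Longrightarrow> multi_degree \<alpha> \<le> multi_weight w \<alpha>"
  unfolding multi_degree_def multi_weight_def by (rule sum_mono) (metis Suc_leI mult_le_mono1 nat_mult_1 One_nat_def)

lemma finite_multi_degree_le: "finite {\<alpha> :: 'n::finite \<Rightarrow> nat. multi_degree \<alpha> \<le> N}"
proof (rule finite_subset)
  have "\<alpha> j \<le> multi_degree \<alpha>" for \<alpha> :: "'n \<Rightarrow> nat" and j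
    unfolding multi_degree_def by (rule member_le_sum) auto
  then show "{\<alpha> :: 'n \<Rightarrow> nat. multi_degree \<alpha> \<le> N} \<subseteq> PiE UNIV (\<lambda>_. {..N})"
    using le_trans by fastforce
qed (rule finite_PiE, auto)

lemma finite_multi_weight_le: "(\<And>j. 0 < w j) \<Longrightarrow> finite {\<alpha> :: 'n::finite \<Rightarrow> nat. multi_weight w \<alpha> \<le> N}"
  by (rule finite_subset[OF _ finite_multi_degree_le[of N]]) (use multi_degree_le_weight le_trans in blast)

text \<open>After one factor \<open>x $ l\<close> is removed, a factor of positive weight remains.
  This is the source of triangularity for all polynomial coordinate changes below.\<close>

lemma coord_weight_less:
  assumes "\<And>j. 0 < w j" "\<alpha> l \<noteq> 0" "2 \<le> multi_degree \<alpha>"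
  shows "w l < multi_weight w \<alpha>"
proof -
  have "multi_degree (\<alpha>(l := \<alpha> l - 1)) + 1 = multi_degree \<alpha>" "multi_weight w (\<alpha>(l := \<alpha> l - 1)) + w l = multi_weight w \<alpha>"
  proof -
    have e: "\<alpha> = (\<lambda>j. (\<alpha>(l := \<alpha> l - 1)) j + single l j)" using assms(2) by (auto simp: single_def fun_eq_iff)
    show "multi_degree (\<alpha>(l := \<alpha> l - 1)) + 1 = multi_degree \<alpha>"
      by (subst (2) e) (simp only: multi_degree_add multi_degree_single)
    show "multi_weight w (\<alpha>(l := \<alpha> l - 1)) + w l = multi_weight w \<alpha>"
      by (subst (2) e) (simp only: multi_weight_add multi_degree_single)
  qed
  then show ?thesis using multi_degree_le_weight[of w "\<alpha>(l := \<alpha> l - 1)"] assms by simp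
qed

section \<open>Polynomials with prescribed exponents\<close>

definition polys :: "('n::finite \<Rightarrow> nat) set \<Rightarrow> (real ^ 'n \<Rightarrow> real) set" where
  "polys A = {f. \<exists>c. f = (\<lambda>x. \<Sum>\<alpha>\<in>A. c \<alpha> * monomial \<alpha> x)}"

lemma polysI: "f = (\<lambda>x. \<Sum>\<alpha>\<in>A. c \<alpha> * monomial \<alpha> x) \<Longrightarrow> f \<in> polys A"
  by (auto simp: polys_def)

lemma polysE:
  assumes "f \<in> polys A" obtains c where "f = (\<lambda>x. \<Sum>\<alpha>\<in>A. c \<alpha> * monomial \<alpha> x)"
  using assms by (auto simp: polys_def)

lemma polys_zero [simp]: "(\<lambda>x. 0) \<in> polys A"
  by (rule polysI[where c = "\<lambda>_. 0"]) simp

lemma polys_add: "f \<in> polys A \<Longrightarrow> g \<in> polys A \<Longrightarrow> (\<lambda>x. f x + g x) \<in> polys A"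
  by (elim polysE, rule polysI[where c = "\<lambda>\<alpha>. _ \<alpha> + _ \<alpha>"]) (simp add: sum.distrib distrib_right)

lemma polys_cmult: "f \<in> polys A \<Longrightarrow> (\<lambda>x. c * f x) \<in> polys A"
  by (elim polysE, rule polysI[where c = "\<lambda>\<alpha>. c * _ \<alpha>"]) (simp add: sum_distrib_left mult.assoc)

lemma polys_uminus: "f \<in> polys A \<Longrightarrow> (\<lambda>x. - f x) \<in> polys A"
  using polys_cmult[of f A "-1"] by simp

lemma polys_diff: "f \<in> polys A \<Longrightarrow> g \<in> polys A \<Longrightarrow> (\<lambda>x. f x - g x) \<in> polys A"
  using polys_add[OF _ polys_uminus, of f A g] by simp

lemma polys_sum: "(\<And>k. k \<in> K \<Longrightarrow> f k \<in> polys A) \<Longrightarrow> (\<lambda>x. \<Sum>k\<in>K. f k x) \<in> polys A"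
  by (induction K rule: infinite_finite_induct) (simp_all add: polys_add)

lemma monomial_in_polys:
  assumes "finite A" "\<alpha> \<in> A"
  shows "monomial \<alpha> \<in> polys A"
proof (rule polysI[where c = "\<lambda>\<beta>. if \<beta> = \<alpha> then 1 else 0"], rule ext)
  fix x
  have "(\<Sum>\<beta>\<in>A. (if \<beta> = \<alpha> then 1 else 0) * monomial \<beta> x) = (\<Sum>\<beta>\<in>A. if \<beta> = \<alpha> then monomial \<beta> x else 0)"
    by (rule sum.cong) auto
  then show "monomial \<alpha> x = (\<Sum>\<beta>\<in>A. (if \<beta> = \<alpha> then 1 else 0) * monomial \<beta> x)"
    using assms by simp
qed

lemma polys_mono: "finite B \<Longrightarrow> A \<subseteq> B \<Longrightarrow> f \<in> polys A \<Longrightarrow> f \<in> polys B"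
  by (elim polysE, hypsubst) (intro polys_sum polys_cmult monomial_in_polys; blast)

lemma polys_mult:
  assumes "f \<in> polys A" "g \<in> polys B" "finite C"
    and C: "\<And>\<alpha> \<beta>. \<alpha> \<in> A \<Longrightarrow> \<beta> \<in> B \<Longrightarrow> (\<lambda>j. \<alpha> j + \<beta> j) \<in> C"
  shows "(\<lambda>x. f x * g x) \<in> polys C"
proof -
  obtain c where c: "f = (\<lambda>x. \<Sum>\<alpha>\<in>A. c \<alpha> * monomial \<alpha> x)" using assms(1) by (rule polysE)
  obtain d where d: "g = (\<lambda>x. \<Sum>\<alpha>\<in>B. d \<alpha> * monomial \<alpha> x)" using assms(2) by (rule polysE)
  have "(\<lambda>x. f x * g x) = (\<lambda>x. \<Sum>\<alpha>\<in>A. \<Sum>\<beta>\<in>B. (c \<alpha> * d \<beta>) * monomial (\<lambda>j. \<alpha> j + \<beta> j) x)"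
    unfolding c d by (simp add: sum_product monomial_add mult_ac)
  also have "\<dots> \<in> polys C"
    by (intro polys_sum polys_cmult monomial_in_polys assms(3) C)
  finally show ?thesis .
qed

lemma smooth_on_polys: "f \<in> polys A \<Longrightarrow> open S \<Longrightarrow> smooth_on S f"
  by (elim polysE, hypsubst) (intro smooth_on_sum smooth_on_mult smooth_on_const smooth_monomial)

text \<open>Triangular polynomial maps occur with monomials of weight at most that of the component
  (the admissible coordinate changes) and of exactly that weight (the homogeneous maps).
  \<open>A N m\<close> stands for either choice of exponents of degree at least \<open>m\<close>,
  and the locale is instantiated with both.\<close>

locale weight_grading =
  fixes w :: "'n::finite \<Rightarrow> nat" and A :: "nat \<Rightarrow> nat \<Rightarrow> ('n \<Rightarrow> nat) set"
  assumes w_pos: "\<And>j. 0 < w j"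
    and A_le: "\<And>\<alpha> N m. \<alpha> \<in> A N m \<Longrightarrow> multi_weight w \<alpha> \<le> N \<and> m \<le> multi_degree \<alpha>"
    and A_add: "\<And>\<alpha> \<beta> N M m k. \<alpha> \<in> A N m \<Longrightarrow> \<beta> \<in> A M k \<Longrightarrow> (\<lambda>j. \<alpha> j + \<beta> j) \<in> A (N + M) (m + k)"
    and A_0: "(\<lambda>_. 0) \<in> A 0 0"
    and A_single: "\<And>l. single l \<in> A (w l) 1"
    and A_mono: "\<And>N m k. m \<le> k \<Longrightarrow> A N k \<subseteq> A N m"
    and A_sub: "\<And>\<alpha> N m. \<alpha> \<in> A N m \<Longrightarrow> A (multi_weight w \<alpha>) (multi_degree \<alpha>) \<subseteq> A N m"
begin

lemma finite_A: "finite (A N m)"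
  by (rule finite_subset[OF _ finite_multi_weight_le[of w N]]) (use A_le w_pos in auto)

lemma polys_A_mult:
  "f \<in> polys (A N m) \<Longrightarrow> g \<in> polys (A M k) \<Longrightarrow> (\<lambda>x. f x * g x) \<in> polys (A (N + M) (m + k))"
  by (rule polys_mult) (auto intro: A_add finite_A)

lemma polys_A_one: "(\<lambda>x. 1) \<in> polys (A 0 0)"
proof -
  have "monomial (\<lambda>_. 0) = (\<lambda>x :: real ^ 'n. 1)" by (rule ext) simp
  then show ?thesis using monomial_in_polys[OF finite_A A_0] by metis
qed

lemma polys_A_power:
  "f \<in> polys (A N m) \<Longrightarrow> (\<lambda>x. f x ^ n) \<in> polys (A (N * n) (m * n))"
proof (induction n)
  case (Suc n)
  then show ?case using polys_A_mult[of f N m "\<lambda>x. f x ^ n"] by simp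
qed (simp add: polys_A_one)

lemma polys_A_prod:
  "finite K \<Longrightarrow> (\<And>k. k \<in> K \<Longrightarrow> f k \<in> polys (A (N k) (m k))) \<Longrightarrow>
    (\<lambda>x. \<Prod>k\<in>K. f k x) \<in> polys (A (\<Sum>k\<in>K. N k) (\<Sum>k\<in>K. m k))"
  by (induction K rule: finite_induct) (simp_all add: polys_A_one polys_A_mult)

lemma monomial_compose:
  assumes "\<And>l. (\<lambda>x. q x $ l) \<in> polys (A (w l) 1)"
  shows "(\<lambda>x. monomial \<alpha> (q x)) \<in> polys (A (multi_weight w \<alpha>) (multi_degree \<alpha>))"
proof -
  have "(\<lambda>x. q x $ l ^ \<alpha> l) \<in> polys (A (w l * \<alpha> l) (1 * \<alpha> l))" for l
    by (rule polys_A_power) (rule assms)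
  from polys_A_prod[of UNIV "\<lambda>l x. q x $ l ^ \<alpha> l", OF _ this] show ?thesis
    by (simp add: monomial_def multi_weight_def multi_degree_def)
qed

lemma polys_compose:
  assumes "f \<in> polys (A N m)" "\<And>l. (\<lambda>x. q x $ l) \<in> polys (A (w l) 1)"
  shows "(\<lambda>x. f (q x)) \<in> polys (A N m)"
proof -
  obtain c where c: "f = (\<lambda>x. \<Sum>\<alpha>\<in>A N m. c \<alpha> * monomial \<alpha> x)" using assms(1) by (rule polysE)
  show ?thesis unfolding c
    by (intro polys_sum polys_cmult polys_mono[OF finite_A A_sub monomial_compose] assms(2))
qed

text \<open>For weights at most \<open>w k\<close> this is \<open>at_most_weight_form\<close>; for
  weights equal to \<open>w k\<close> such maps commute with the dilations.\<close>

definition form :: "(real ^ 'n \<Rightarrow> real ^ 'n) \<Rightarrow> bool" where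
  "form p \<longleftrightarrow> (\<forall>k. (\<lambda>x. p x $ k - x $ k) \<in> polys (A (w k) 2))"

lemma coord_in_polys: "(\<lambda>x. x $ l) \<in> polys (A (w l) 1)"
  using monomial_in_polys[OF finite_A A_single] by (simp add: monomial_single[abs_def])

lemma formD: "form p \<Longrightarrow> (\<lambda>x. p x $ k) \<in> polys (A (w k) 1)"
  unfolding form_def
  using polys_add[OF coord_in_polys polys_mono[OF finite_A A_mono[of 1 2]], of "\<lambda>x. p x $ k - x $ k" k] by simp

lemma form_id: "form (\<lambda>x. x)" by (simp add: form_def)

lemma form_compose: "form p \<Longrightarrow> form q \<Longrightarrow> form (\<lambda>x. p (q x))"
  unfolding form_def[of "\<lambda>x. p (q x)"]
proof
  fix k assume p: "form p" and q: "form q"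
  have "(\<lambda>x. p (q x) $ k - q x $ k) \<in> polys (A (w k) 2)"
    using polys_compose[of "\<lambda>x. p x $ k - x $ k" "w k" 2 q] p formD[OF q] by (simp add: form_def)
  from polys_add[OF this, of "\<lambda>x. q x $ k - x $ k"] q
  show "(\<lambda>x. p (q x) $ k - x $ k) \<in> polys (A (w k) 2)" by (simp add: form_def)
qed

lemma monomial_cong_lower:
  assumes "\<And>l. \<alpha> l \<noteq> 0 \<Longrightarrow> x $ l = y $ l"
  shows "monomial \<alpha> x = monomial \<alpha> y"
  unfolding monomial_def by (rule prod.cong) (metis assms power_0 refl)+

lemma polys_cong_lower:
  assumes "f \<in> polys (A (w k) 2)" "\<And>l. w l < w k \<Longrightarrow> x $ l = y $ l"
  shows "f x = f y"
proof -
  obtain c where c: "f = (\<lambda>x. \<Sum>\<alpha>\<in>A (w k) 2. c \<alpha> * monomial \<alpha> x)" using assms(1) by (rule polysE)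
  have "monomial \<alpha> x = monomial \<alpha> y" if "\<alpha> \<in> A (w k) 2" for \<alpha>
    using coord_weight_less[of w \<alpha>, OF w_pos] A_le[OF that]
    by (intro monomial_cong_lower assms(2)) (meson le_trans not_le)
  then show ?thesis unfolding c by (intro sum.cong) auto
qed

text \<open>Fixed-point iteration y := x - N y for the equation p y = x, with N = p - id. Component
  \<open>k\<close> of N depends on coordinates of smaller weight only, so component \<open>k\<close>
  is settled after \<open>w k\<close> rounds and the iteration becomes stationary.\<close>

fun inv_iter :: "(real ^ 'n \<Rightarrow> real ^ 'n) \<Rightarrow> nat \<Rightarrow> real ^ 'n \<Rightarrow> real ^ 'n" where
  "inv_iter p 0 x = x"
| "inv_iter p (Suc n) x = (\<chi> k. x $ k - (p (inv_iter p n x) $ k - inv_iter p n x $ k))"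

lemma form_inv_iter: "form p \<Longrightarrow> form (inv_iter p n)"
proof (induction n)
  case (Suc n)
  have "(\<lambda>x. p (inv_iter p n x) $ k - inv_iter p n x $ k) \<in> polys (A (w k) 2)" for k
    using polys_compose[of "\<lambda>x. p x $ k - x $ k" "w k" 2 "inv_iter p n"] Suc formD[OF Suc.IH[OF Suc.prems]]
    by (simp add: form_def)
  then show ?case unfolding form_def using polys_uminus by fastforce
next
  case 0
  have "inv_iter p 0 = (\<lambda>x. x)" by (rule ext) simp
  then show ?case by (simp add: form_id)
qed

lemma inv_iter_stable: "form p \<Longrightarrow> w k \<le> n \<Longrightarrow> inv_iter p (Suc n) x $ k = inv_iter p n x $ k"
proof (induction n arbitrary: k)
  case 0
  then show ?case using w_pos[of k] by simp
next
  case (Suc n)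
  have "p (inv_iter p (Suc n) x) $ k - inv_iter p (Suc n) x $ k = p (inv_iter p n x) $ k - inv_iter p n x $ k"
    using polys_cong_lower[of "\<lambda>x. p x $ k - x $ k" k "inv_iter p (Suc n) x" "inv_iter p n x"] Suc
    by (simp add: form_def del: inv_iter.simps)
  then show ?case by (simp only: inv_iter.simps vec_lambda_beta)
qed

lemma form_right_inverse:
  assumes "form p" shows "\<exists>q. form q \<and> (\<forall>x. p (q x) = x)"
proof (intro exI conjI allI)
  define n where "n = Max (range w)"
  show "form (inv_iter p n)" by (rule form_inv_iter[OF assms])
  fix x
  have "inv_iter p (Suc n) x = inv_iter p n x"
    unfolding vec_eq_iff by (intro allI inv_iter_stable assms) (simp add: n_def)
  then have "x $ k - (p (inv_iter p n x) $ k - inv_iter p n x $ k) = inv_iter p n x $ k" for k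
    by (simp add: vec_eq_iff)
  then show "p (inv_iter p n x) = x" unfolding vec_eq_iff by (auto simp: algebra_simps)
qed

lemma form_inverse:
  assumes "form p" obtains q where "form q" "\<And>x. p (q x) = x" "\<And>x. q (p x) = x"
proof -
  obtain q where q: "form q" "\<And>x. p (q x) = x" using form_right_inverse[OF assms] by blast
  \<comment> \<open>The right inverse \<open>q\<close> has a right inverse of its own, which must
    then be \<open>p\<close>; hence \<open>q\<close> is two-sided.\<close>
  obtain p' where p': "\<And>x. q (p' x) = x" using form_right_inverse[OF q(1)] by blast
  have "q (p x) = x" for x using q(2) p' by metis
  with q show thesis using that by blast
qed

lemma form_bij: "form p \<Longrightarrow> bij p"
  by (metis form_inverse bijI' )

lemma form_inv: "form p \<Longrightarrow> form (inv p)"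
  by (metis form_inverse form_bij bij_inv_eq_iff ext)

lemma smooth_form: "form p \<Longrightarrow> open S \<Longrightarrow> smooth_on S p"
  by (rule smooth_on_vec) (auto intro: smooth_on_polys formD)

lemma form_0: "form p \<Longrightarrow> p 0 = 0"
proof -
  assume p: "form p"
  have "p 0 $ k = 0" for k
  proof -
    obtain c where c: "(\<lambda>x. p x $ k) = (\<lambda>x. \<Sum>\<alpha>\<in>A (w k) 1. c \<alpha> * monomial \<alpha> x)" using formD[OF p] by (rule polysE)
    have "monomial \<alpha> 0 = 0" if "\<alpha> \<in> A (w k) 1" for \<alpha>
      using A_le[OF that] multi_degree_eq_0_iff[of \<alpha>] by (auto simp: monomial_at_0 fun_eq_iff)
    then show ?thesis using fun_cong[OF c, of 0] by simp
  qed
  then show ?thesis by (simp add: vec_eq_iff)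
qed

lemma dird_form_0:
  assumes p: "form p" shows "dird v p 0 = v"
proof -
  have "dird v p 0 $ k = v $ k" for k
  proof -
    have "(\<lambda>x. p x $ k - x $ k) \<in> polys (A (w k) 2)" using p by (simp add: form_def)
    then obtain c where c: "(\<lambda>x. p x $ k - x $ k) = (\<lambda>x. \<Sum>\<alpha>\<in>A (w k) 2. c \<alpha> * monomial \<alpha> x)"
      by (rule polysE)
    have m: "dird v (monomial \<alpha>) 0 = 0" if "\<alpha> \<in> A (w k) 2" for \<alpha>
    proof -
      have "dird (axis l 1) (monomial \<alpha>) 0 = 0" for l
      proof -
        have "\<not> (\<forall>j. count (mset [l]) j = \<alpha> j)"
        proof
          assume "\<forall>j. count (mset [l]) j = \<alpha> j"
          then have "count (mset [l]) = \<alpha>" by (intro ext) simp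
          then have "multi_degree \<alpha> = 1" using length_eq_multi[of "[l]"] by simp
          then show False using A_le[OF that] by simp
        qed
        then show ?thesis using pd_monomial_at_0[of "[l]" \<alpha>] by (simp only: pd_Cons frame_apply_Nil if_False)
      qed
      then show ?thesis
        using dird_expand[OF smooth_on_differentiable[OF smooth_monomial[of UNIV \<alpha>]], of 0 v] by simp
    qed
    have "dird v (\<lambda>x. p x $ k - x $ k) 0 = (\<Sum>\<alpha>\<in>A (w k) 2. dird v (\<lambda>x. c \<alpha> * monomial \<alpha> x) 0)"
      unfolding c
      by (intro dird_sum smooth_on_differentiable[of UNIV] smooth_on_mult smooth_on_const smooth_monomial) auto
    also have "\<dots> = 0"
      by (intro sum.neutral ballI) (simp add: m dird_cmult smooth_on_differentiable[OF smooth_monomial[of UNIV]])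
    finally have z: "dird v (\<lambda>x. p x $ k - x $ k) 0 = 0" .
    have dp: "p differentiable at 0" using smooth_on_differentiable[OF smooth_form[OF p, of UNIV]] by simp
    have "dird v (\<lambda>x. (p x $ k - x $ k) + x $ k) 0 = dird v (\<lambda>x. p x $ k - x $ k) 0 + dird v (\<lambda>x. x $ k) 0"
      by (intro dird_add smooth_on_differentiable[of UNIV] smooth_on_diff open_UNIV UNIV_I
          smooth_on_nth[OF open_UNIV smooth_form[OF p open_UNIV]] smooth_on_nth[OF open_UNIV smooth_on_id])
    then show ?thesis using z dird_nth[OF dp, of v k]
      by (simp add: dird_bounded_linear[OF bounded_linear_vec_nth])
  qed
  then show ?thesis by (simp add: vec_eq_iff)
qed

lemma polynomial_function_form:
  assumes "form p" shows "polynomial_function p"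
proof -
  have nth: "real_polynomial_function (\<lambda>x :: real ^ 'n. x $ j)" for j
    by (rule real_polynomial_function.intros(1)[OF bounded_linear_vec_nth])
  have mono: "real_polynomial_function (monomial \<alpha>)" for \<alpha> :: "'n \<Rightarrow> nat"
    unfolding monomial_def[abs_def] by (intro real_polynomial_function_prod real_polynomial_function_power nth) auto
  have "real_polynomial_function (\<lambda>x. p x $ k)" for k
  proof -
    obtain c where c: "(\<lambda>x. p x $ k) = (\<lambda>x. \<Sum>\<alpha>\<in>A (w k) 1. c \<alpha> * monomial \<alpha> x)" using formD[OF assms] by (rule polysE)
    show ?thesis unfolding c
      by (intro real_polynomial_function_sum real_polynomial_function.intros(4) real_polynomial_function.intros(2) mono finite_A)
  qed
  then show ?thesis
    unfolding polynomial_function_iff_Basis_inner Basis_vec_def by (auto simp: inner_axis)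
qed

lemma polynomial_diffeomorphism_form: "form p \<Longrightarrow> polynomial_diffeomorphism p"
  unfolding polynomial_diffeomorphism_def
  by (simp add: polynomial_function_form form_bij smooth_form form_inv)

end

definition le_exps :: "('n::finite \<Rightarrow> nat) \<Rightarrow> nat \<Rightarrow> nat \<Rightarrow> ('n \<Rightarrow> nat) set" where
  "le_exps w N m = {\<alpha>. multi_weight w \<alpha> \<le> N \<and> m \<le> multi_degree \<alpha>}"

definition eq_exps :: "('n::finite \<Rightarrow> nat) \<Rightarrow> nat \<Rightarrow> nat \<Rightarrow> ('n \<Rightarrow> nat) set" where
  "eq_exps w N m = {\<alpha>. multi_weight w \<alpha> = N \<and> m \<le> multi_degree \<alpha>}"

lemma weight_grading_le: "(\<And>j. 0 < w j) \<Longrightarrow> weight_grading w (le_exps w)"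
  by unfold_locales (auto simp: le_exps_def multi_degree_add multi_weight_add intro: add_mono)

lemma weight_grading_eq: "(\<And>j. 0 < w j) \<Longrightarrow> weight_grading w (eq_exps w)"
  by unfold_locales (auto simp: eq_exps_def multi_degree_add multi_weight_add intro: add_mono)

lemma at_most_weight_form_iff:
  "at_most_weight_form w p \<longleftrightarrow> (\<forall>k. (\<lambda>x. p x $ k - x $ k) \<in> polys (le_exps w (w k) 2))"
proof -
  have "at_most_weight_form w p \<longleftrightarrow>
    (\<exists>c. \<forall>k. (\<lambda>x. p x $ k - x $ k) = (\<lambda>x. \<Sum>\<alpha>\<in>le_exps w (w k) 2. c k \<alpha> * monomial \<alpha> x))"
    unfolding at_most_weight_form_def le_exps_def fun_eq_iff by (auto simp: algebra_simps)
  then show ?thesis unfolding polys_def mem_Collect_eq choice_iff .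
qed

lemma lower_weight_form_iff:
  "lower_weight_form w p \<longleftrightarrow>
    (\<forall>k. (\<lambda>x. p x $ k - x $ k) \<in> polys {\<alpha>. multi_weight w \<alpha> < w k \<and> 2 \<le> multi_degree \<alpha>})"
proof -
  have "lower_weight_form w p \<longleftrightarrow>
    (\<exists>c. \<forall>k. (\<lambda>x. p x $ k - x $ k)
       = (\<lambda>x. \<Sum>\<alpha>\<in>{\<alpha>. multi_weight w \<alpha> < w k \<and> 2 \<le> multi_degree \<alpha>}. c k \<alpha> * monomial \<alpha> x))"
    unfolding lower_weight_form_def fun_eq_iff by (auto simp: algebra_simps)
  then show ?thesis unfolding polys_def mem_Collect_eq choice_iff .
qed

lemma lower_imp_at_most_weight_form:
  assumes "\<And>j. 0 < w j" "lower_weight_form w p"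
  shows "at_most_weight_form w p"
  unfolding at_most_weight_form_iff
proof
  fix k
  interpret weight_grading w "le_exps w" by (rule weight_grading_le[OF assms(1)])
  show "(\<lambda>x. p x $ k - x $ k) \<in> polys (le_exps w (w k) 2)"
    using assms(2) unfolding lower_weight_form_iff
    by (intro polys_mono[OF finite_A, of "{\<alpha>. multi_weight w \<alpha> < w k \<and> 2 \<le> multi_degree \<alpha>}"])
      (auto simp: le_exps_def)
qed

section \<open>Jets in adapted coordinates\<close>

definition flat :: "nat \<Rightarrow> (real ^ 'n::finite \<Rightarrow> real) \<Rightarrow> bool" where
  "flat m f \<longleftrightarrow> (\<forall>K. length K < m \<longrightarrow> pd K f 0 = 0)"

text \<open>Ordinary vanishing of partial derivatives is order for the coordinate frame with all
  weights 1, so the rules for orders, in particular the one for products, apply to it.\<close>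

lemma flat_iff_order_ge: "flat m f \<longleftrightarrow> order_ge (\<lambda>_. 1) coord_frame f 0 m"
  by (simp add: flat_def order_ge_def index_weight_def sum_list_triv)

lemma flat_dird: "flat m f \<Longrightarrow> flat (m - 1) (dird (axis l 1) f)"
  unfolding flat_iff_order_ge using order_ge_vf_apply[of "\<lambda>_. 1" coord_frame f 0 m l]
  by (simp only: vf_apply_coord)

lemma flat_0: "flat m f \<Longrightarrow> 0 < m \<Longrightarrow> f 0 = 0"
  unfolding flat_def by (metis list.size(3) frame_apply_Nil)

lemma pd_poly_at_0:
  assumes "finite A"
  shows "pd K (\<lambda>x. \<Sum>\<alpha>\<in>A. c \<alpha> * monomial \<alpha> x) 0
    = (if count (mset K) \<in> A then c (count (mset K)) * multi_fact (count (mset K)) else 0)"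
proof -
  interpret smooth_frame UNIV coord_frame by (rule smooth_frame_coord) simp
  have "pd K (\<lambda>x. \<Sum>\<alpha>\<in>A. c \<alpha> * monomial \<alpha> x) 0 = (\<Sum>\<alpha>\<in>A. c \<alpha> * pd K (monomial \<alpha>) 0)"
    by (simp add: frame_apply_sum frame_apply_cmult smooth_on_mult smooth_monomial)
  also have "\<dots> = (\<Sum>\<alpha>\<in>A. if \<alpha> = count (mset K) then c \<alpha> * multi_fact \<alpha> else 0)"
    by (rule sum.cong) (auto simp: pd_monomial_at_0 fun_eq_iff)
  finally show ?thesis using assms by simp
qed

lemma smooth_poly: "open S \<Longrightarrow> smooth_on S (\<lambda>x. \<Sum>\<alpha>\<in>A. c \<alpha> * monomial \<alpha> x)"
  by (intro smooth_on_sum smooth_on_mult smooth_on_const smooth_monomial)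

locale adapted_frame = smooth_frame S Z
  for S :: "(real ^ 'n::finite) set" and Z :: "'n \<Rightarrow> 'n vfield" +
  assumes zero_S: "0 \<in> S" and Z_0: "\<And>j. Z j 0 = axis j 1"
begin

sublocale coord: smooth_frame S coord_frame
  by (rule smooth_frame_coord[OF open_S])

text \<open>The coefficients of \<open>Z i\<close> minus those of the coordinate field vanish at 0,
  which makes up for the order lost by differentiating \<open>f\<close> once.\<close>

lemma flat_vf_apply_diff:
  assumes f: "smooth_on S f" and "flat m f"
  shows "flat m (\<lambda>x. vf_apply (Z i) f x - dird (axis i 1) f x)"
proof -
  have sd: "smooth_on S (\<lambda>x. Z i x $ l - axis i 1 $ l)" for l
    by (intro smooth_on_diff smooth_on_nth smooth_Y smooth_on_const open_S)
  have "order_ge (\<lambda>_. 1) coord_frame (\<lambda>x. (Z i x $ l - axis i 1 $ l) * dird (axis l 1) f x) 0 (1 + (m - 1))" for l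
  proof (rule coord.order_ge_mult[OF sd smooth_on_dird[OF f] zero_S])
    show "order_ge (\<lambda>_. 1) coord_frame (\<lambda>x. Z i x $ l - axis i 1 $ l) 0 1"
      unfolding flat_iff_order_ge[symmetric] by (simp add: flat_def Z_0)
    show "order_ge (\<lambda>_. 1) coord_frame (dird (axis l 1) f) 0 (m - 1)"
      unfolding flat_iff_order_ge[symmetric] by (rule flat_dird[OF assms(2)])
  qed
  then have "order_ge (\<lambda>_. 1) coord_frame (\<lambda>x. (Z i x $ l - axis i 1 $ l) * dird (axis l 1) f x) 0 m" for l
    by (rule order_ge_mono) simp
  then have *: "flat m (\<lambda>x. \<Sum>l\<in>UNIV. (Z i x $ l - axis i 1 $ l) * dird (axis l 1) f x)"
    unfolding flat_iff_order_ge
    by (intro coord.order_ge_sum smooth_on_mult sd smooth_on_dird f open_S zero_S)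
  have eq: "vf_apply (Z i) f x - dird (axis i 1) f x
      = (\<Sum>l\<in>UNIV. (Z i x $ l - axis i 1 $ l) * dird (axis l 1) f x)" if "x \<in> S" for x
    using dird_expand[OF smooth_on_differentiable[OF f that], of "Z i x"]
      dird_expand[OF smooth_on_differentiable[OF f that], of "axis i 1"]
    by (simp add: vf_apply_eq_dird left_diff_distrib sum_subtractf)
  show ?thesis
    unfolding flat_def
  proof (intro allI impI)
    fix K :: "'n list" assume "length K < m"
    then show "pd K (\<lambda>x. vf_apply (Z i) f x - dird (axis i 1) f x) 0 = 0"
      using * frame_apply_cong_open[OF open_S zero_S eq, where Y = coord_frame and I = K] by (simp add: flat_def)
  qed
qed

text \<open>Replacing the innermost \<open>Z i\<close> by a partial derivative costs a function that
  is again flat of order \<open>m\<close>, while fewer than \<open>m\<close> letters remain to act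
  on it.\<close>

lemma frame_apply_flat_pd:
  assumes "smooth_on S f" "flat m f" "length I \<le> m"
  shows "frame_apply Z I f 0 = pd I f 0"
  using assms
proof (induction I arbitrary: f m rule: rev_induct)
  case (snoc i I)
  define g where "g = (\<lambda>x. vf_apply (Z i) f x - dird (axis i 1) f x)"
  have g: "smooth_on S g"
    unfolding g_def by (intro smooth_on_diff smooth_vf_apply smooth_on_dird snoc.prems open_S)
  have gf: "flat m g" unfolding g_def by (rule flat_vf_apply_diff[OF snoc.prems(1,2)])
  have "frame_apply Z (I @ [i]) f 0 = frame_apply Z I g 0 + frame_apply Z I (dird (axis i 1) f) 0"
    using frame_apply_add[OF g smooth_on_dird[OF snoc.prems(1)] zero_S, of I "axis i 1"]
    by (simp add: g_def frame_apply_append frame_apply_Cons)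
  also have "frame_apply Z I g 0 = pd I g 0"
    by (rule snoc.IH[OF g gf]) (use snoc.prems in simp)
  also have "pd I g 0 = 0" using gf snoc.prems by (simp add: flat_def)
  also have "frame_apply Z I (dird (axis i 1) f) 0 = pd I (dird (axis i 1) f) 0"
    by (rule snoc.IH[of _ "m - 1"]) (use snoc.prems flat_dird[of m f i] in \<open>auto intro: smooth_on_dird\<close>)
  finally show ?case by (simp add: pd_snoc)
qed simp

lemma frame_apply_flat:
  assumes "smooth_on S f" "flat m f"
  shows "length I < m \<Longrightarrow> frame_apply Z I f 0 = 0"
    and "length I = m \<Longrightarrow> frame_apply Z I f 0 = pd I f 0"
  using frame_apply_flat_pd[OF assms, of I] assms(2) by (simp_all add: flat_def)

text \<open>Once the coefficients of smaller degree are known to vanish, the word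
  \<open>mlist \<alpha>\<close> reads off the coefficient of \<alpha> just as a partial derivative
  does; its weight is below \<open>N\<close>, so the value is 0.\<close>

lemma poly_coeffs_eq_0:
  assumes A: "finite A" "\<And>\<alpha>. \<alpha> \<in> A \<Longrightarrow> multi_weight w \<alpha> < N"
    and o: "order_ge w Z (\<lambda>x. \<Sum>\<alpha>\<in>A. c \<alpha> * monomial \<alpha> x) 0 N"
  shows "\<alpha> \<in> A \<Longrightarrow> c \<alpha> = 0"
proof (induction "multi_degree \<alpha>" arbitrary: \<alpha> rule: less_induct)
  case less
  let ?f = "\<lambda>x. \<Sum>\<alpha>\<in>A. c \<alpha> * monomial \<alpha> x"
  have "flat (multi_degree \<alpha>) ?f"
    unfolding flat_def pd_poly_at_0[OF A(1)] by (simp add: less.hyps length_eq_multi)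
  from frame_apply_flat(2)[OF smooth_poly[OF open_S] this, of "mlist \<alpha>"]
  have "frame_apply Z (mlist \<alpha>) ?f 0 = c \<alpha> * multi_fact \<alpha>"
    unfolding pd_poly_at_0[OF A(1)] count_mlist' using less.prems by simp
  moreover have "frame_apply Z (mlist \<alpha>) ?f 0 = 0"
    using order_geD[OF o, of "mlist \<alpha>"] A(2)[OF less.prems] by simp
  ultimately show ?case by simp
qed

lemma polys_eq_0:
  assumes "f \<in> polys A" "finite A" "\<And>\<alpha>. \<alpha> \<in> A \<Longrightarrow> multi_weight w \<alpha> < N" "order_ge w Z f 0 N"
  shows "f x = 0"
proof -
  obtain c where c: "f = (\<lambda>x. \<Sum>\<alpha>\<in>A. c \<alpha> * monomial \<alpha> x)" using assms(1) by (rule polysE)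
  have "\<alpha> \<in> A \<Longrightarrow> c \<alpha> = 0" for \<alpha>
    by (rule poly_coeffs_eq_0[of A w N c]) (use assms c in auto)
  then show ?thesis unfolding c by simp
qed

end

locale adapted_hframe = adapted_frame S Z + hframe S Z w L
  for S :: "(real ^ 'n::finite) set" and Z :: "'n \<Rightarrow> 'n vfield" and w L
begin

text \<open>Correction by terms of growing degree. Terms of one degree are not seen by shorter
  words, so nothing already achieved is lost; words of that length with the same letters agree on
  the current function, so one coefficient per multi-index is enough.\<close>

lemma raise_order:
  assumes f: "smooth_on S f"
    and low: "\<And>I. length I \<le> 1 \<Longrightarrow> index_weight w I < N \<Longrightarrow> frame_apply Z I f 0 = 0"
  shows "\<exists>q \<in> polys {\<alpha>. multi_weight w \<alpha> < N \<and> 2 \<le> multi_degree \<alpha>}. order_ge w Z (\<lambda>x. f x + q x) 0 N"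
proof -
  let ?A = "{\<alpha>. multi_weight w \<alpha> < N \<and> 2 \<le> multi_degree \<alpha>}"
  have finA: "finite ?A"
    by (rule finite_subset[OF _ finite_multi_weight_le[of w N, OF w_pos]]) auto
  have "\<exists>q \<in> polys ?A. \<forall>I. length I \<le> Suc m \<longrightarrow> index_weight w I < N \<longrightarrow>
     frame_apply Z I (\<lambda>x. f x + q x) 0 = 0" for m
  proof (induction m)
    case 0
    show ?case using low by (intro bexI[of _ "\<lambda>x. 0"]) auto
  next
    case (Suc m)
    then obtain q where q: "q \<in> polys ?A"
      "\<And>I. length I \<le> Suc m \<Longrightarrow> index_weight w I < N \<Longrightarrow> frame_apply Z I (\<lambda>x. f x + q x) 0 = 0"
      by blast
    define g where "g = (\<lambda>x. f x + q x)"
    have g: "smooth_on S g" unfolding g_def by (intro smooth_on_add f smooth_on_polys[OF q(1)] open_S)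
    define B where "B = {\<alpha> \<in> ?A. multi_degree \<alpha> = Suc (Suc m)}"
    \<comment> \<open>The word \<open>mlist \<alpha>\<close> gives
      \<open>multi_fact \<alpha>\<close> on its own monomial and 0 on the other monomials of the
      same degree.\<close>
    define c where "c = (\<lambda>\<alpha>. - frame_apply Z (mlist \<alpha>) g 0 / multi_fact \<alpha>)"
    define p where "p = (\<lambda>x. \<Sum>\<alpha>\<in>B. c \<alpha> * monomial \<alpha> x)"
    have BA: "B \<subseteq> ?A" by (auto simp: B_def)
    have finB: "finite B" by (rule finite_subset[OF BA finA])
    have p: "p \<in> polys ?A"
      by (rule polys_mono[OF finA BA]) (rule polysI, rule p_def)
    have ps: "smooth_on S p" by (rule smooth_on_polys[OF p open_S])
    have fl: "flat (Suc (Suc m)) p"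
      unfolding flat_def p_def pd_poly_at_0[OF finB] by (auto simp: B_def length_eq_multi)
    have "frame_apply Z I (\<lambda>x. g x + p x) 0 = 0" if I: "length I \<le> Suc (Suc m)" "index_weight w I < N" for I
    proof (cases "length I = Suc (Suc m)")
      case True
      have "count (mset I) \<in> B"
        using True I by (simp add: B_def length_eq_multi index_weight_eq_multi)
      then have "frame_apply Z I p 0 = c (count (mset I)) * multi_fact (count (mset I))"
        using frame_apply_flat(2)[OF ps fl True] by (simp add: p_def pd_poly_at_0[OF finB])
      also have "\<dots> = - frame_apply Z (mlist (count (mset I))) g 0" by (simp add: c_def)
      also have "\<dots> = - frame_apply Z I g 0"
        using frame_apply_mset_cong[OF g zero_S, of I N "mlist (count (mset I))"] q(2) I True
        by (simp add: g_def multiset_eq_iff)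
      finally show ?thesis using frame_apply_add[OF g ps zero_S] by simp
    next
      case False
      then have "length I < Suc (Suc m)" using I by simp
      then show ?thesis
        using frame_apply_add[OF g ps zero_S, of I] frame_apply_flat(1)[OF ps fl, of I] q(2)[of I] I
        by (simp add: g_def)
    qed
    then show ?case
      by (intro bexI[of _ "\<lambda>x. q x + p x"] polys_add q p) (simp_all add: g_def add.assoc)
  qed
  \<comment> \<open>Weights are positive, so a word of weight below \<open>N\<close> has fewer than
    \<open>N\<close> letters and \<open>N\<close> rounds reach all of them.\<close>
  from this[of N] obtain q where q: "q \<in> polys ?A"
    "\<And>I. length I \<le> Suc N \<Longrightarrow> index_weight w I < N \<Longrightarrow> frame_apply Z I (\<lambda>x. f x + q x) 0 = 0"
    by metis
  have "order_ge w Z (\<lambda>x. f x + q x) 0 N"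
    unfolding order_ge_def
  proof (intro allI impI)
    fix I assume "index_weight w I < N"
    then show "frame_apply Z I (\<lambda>x. f x + q x) 0 = 0"
      using q(2)[of I] length_le_weight[of I] by simp
  qed
  with q(1) show ?thesis by blast
qed

end

section \<open>Privileged coordinates and their model fields\<close>

definition tcoeff :: "(real ^ 'n::finite \<Rightarrow> real) \<Rightarrow> ('n \<Rightarrow> nat) \<Rightarrow> real" where
  "tcoeff f \<alpha> = pd (mlist \<alpha>) f 0 / multi_fact \<alpha>"

definition taylor :: "nat \<Rightarrow> (real ^ 'n::finite \<Rightarrow> real) \<Rightarrow> real ^ 'n \<Rightarrow> real" where
  "taylor m f = (\<lambda>x. \<Sum>\<alpha> | multi_degree \<alpha> \<le> m. tcoeff f \<alpha> * monomial \<alpha> x)"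

lemma smooth_taylor: "open S \<Longrightarrow> smooth_on S (taylor m f)"
  unfolding taylor_def by (rule smooth_poly)

lemma flat_taylor_remainder:
  fixes f :: "real ^ 'n::finite \<Rightarrow> real"
  assumes "open S" "0 \<in> S" "smooth_on S f"
  shows "flat (Suc m) (\<lambda>x. f x - taylor m f x)"
  unfolding flat_def
proof (intro allI impI)
  fix K :: "'n list" assume "length K < Suc m"
  then have "pd K (taylor m f) 0 = pd K f 0"
    unfolding taylor_def pd_poly_at_0[OF finite_multi_degree_le]
    using pd_mlist_count[OF assms(1,3,2), of K] by (simp add: length_eq_multi tcoeff_def)
  interpret smooth_frame S coord_frame by (rule smooth_frame_coord[OF assms(1)])
  show "pd K (\<lambda>x. f x - taylor m f x) 0 = 0"
    using \<open>pd K (taylor m f) 0 = pd K f 0\<close>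
      frame_apply_diff[OF assms(3) smooth_taylor[OF assms(1)] assms(2)] by simp
qed

text \<open>Induction on the order: the mean value theorem on the segment from 0 gains one factor
  \<open>norm y\<close> over the bound for the partial derivatives.\<close>

lemma flat_bound:
  fixes g :: "real ^ 'n::finite \<Rightarrow> real"
  assumes "open S" "cball 0 \<rho> \<subseteq> S" "smooth_on S g" "flat m g"
  shows "\<exists>C. \<forall>y\<in>cball 0 \<rho>. \<bar>g y\<bar> \<le> C * norm y ^ m"
  using assms(3,4)
proof (induction m arbitrary: g)
  case 0
  have "compact (g ` cball 0 \<rho>)"
    by (rule compact_continuous_image[OF continuous_on_subset[OF smooth_on_continuous[OF 0(1)] assms(2)]]) simp
  then obtain C where "\<forall>z\<in>g ` cball 0 \<rho>. norm z \<le> C" using compact_imp_bounded bounded_iff by metis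
  then show ?case by (intro exI[of _ C]) auto
next
  case (Suc m)
  have "\<exists>C. \<forall>y\<in>cball 0 \<rho>. \<bar>dird (axis l 1) g y\<bar> \<le> C * norm y ^ m" for l
    using flat_dird[OF Suc.prems(2), of l]
    by (intro Suc.IH smooth_on_dird Suc.prems) simp
  then obtain C where C: "\<And>l y. y \<in> cball 0 \<rho> \<Longrightarrow> \<bar>dird (axis l 1) g y\<bar> \<le> C l * norm y ^ m" by metis
  have "\<bar>g y\<bar> \<le> (\<Sum>l\<in>UNIV. \<bar>C l\<bar>) * norm y ^ Suc m" if y: "y \<in> cball 0 \<rho>" for y
  proof -
    have seg: "s *\<^sub>R y \<in> cball 0 \<rho>" if "0 \<le> s" "s \<le> 1" for s
      using y that mult_left_le_one_le[of "norm y" s] by auto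
    have "((\<lambda>s. g (0 + s *\<^sub>R y)) has_real_derivative dird y g (0 + s *\<^sub>R y)) (at s)"
      if "0 \<le> s" "s \<le> 1" for s
      unfolding has_real_derivative_iff_has_vector_derivative
      by (rule dird_along_line, rule smooth_on_differentiable[OF Suc.prems(1)]) (use seg[OF that] assms(2) in auto)
    from MVT2[OF zero_less_one this] obtain s where s: "0 < s" "s < 1"
      "g (0 + 1 *\<^sub>R y) - g (0 + 0 *\<^sub>R y) = (1 - 0) * dird y g (0 + s *\<^sub>R y)" by blast
    have g0: "g 0 = 0" by (rule flat_0[OF Suc.prems(2)]) simp
    have sS: "s *\<^sub>R y \<in> cball 0 \<rho>" using seg s by simp
    then have sS': "s *\<^sub>R y \<in> S" using assms(2) by blast
    have "g y = (\<Sum>l\<in>UNIV. y $ l * dird (axis l 1) g (s *\<^sub>R y))"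
      using s(3) g0 dird_expand[OF smooth_on_differentiable[OF Suc.prems(1) sS'], of y] by simp
    also have "\<bar>\<dots>\<bar> \<le> (\<Sum>l\<in>UNIV. \<bar>y $ l * dird (axis l 1) g (s *\<^sub>R y)\<bar>)" by (rule sum_abs)
    also have "\<dots> \<le> (\<Sum>l\<in>UNIV. norm y * (\<bar>C l\<bar> * norm y ^ m))"
    proof (rule sum_mono)
      fix l
      have "\<bar>dird (axis l 1) g (s *\<^sub>R y)\<bar> \<le> C l * norm (s *\<^sub>R y) ^ m" by (rule C[OF sS])
      also have "\<dots> \<le> \<bar>C l\<bar> * norm y ^ m"
        using s by (intro mult_mono power_mono) (auto intro: mult_left_le_one_le)
      finally show "\<bar>y $ l * dird (axis l 1) g (s *\<^sub>R y)\<bar> \<le> norm y * (\<bar>C l\<bar> * norm y ^ m)"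
        unfolding abs_mult by (intro mult_mono component_le_norm_cart) auto
    qed
    finally show ?thesis by (simp add: sum_distrib_right sum_distrib_left mult_ac)
  qed
  then show ?case by blast
qed

text \<open>The part of the Taylor series that survives in the limit of t^a f(t . x) / t^b. With the
  weight of a field as \<open>a\<close> and that of a component as \<open>b\<close>, it gives a
  component of the model field. Writing the condition as a sum avoids truncated subtraction.\<close>

definition homog :: "('n::finite \<Rightarrow> nat) \<Rightarrow> nat \<Rightarrow> nat \<Rightarrow> (real ^ 'n \<Rightarrow> real) \<Rightarrow> real ^ 'n \<Rightarrow> real" where
  "homog w a b f = (\<lambda>x. \<Sum>\<alpha> | multi_weight w \<alpha> + a = b. tcoeff f \<alpha> * monomial \<alpha> x)"

section \<open>Limits under the dilations\<close>

lemma uniform_limit_scale: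
  fixes h :: "real \<Rightarrow> real" and g :: "'a \<Rightarrow> real"
  assumes "(h \<longlongrightarrow> h0) F" "bounded (g ` K)"
  shows "uniform_limit K (\<lambda>t x. h t * g x) (\<lambda>x. h0 * g x) F"
proof (rule uniform_limitI)
  fix e :: real assume e: "e > 0"
  obtain B where B: "B > 0" "\<And>x. x \<in> K \<Longrightarrow> \<bar>g x\<bar> \<le> B"
    using assms(2) unfolding bounded_pos by auto
  have "\<forall>\<^sub>F t in F. dist (h t) h0 < e / B" using assms(1) e B by (intro tendstoD) auto
  then show "\<forall>\<^sub>F t in F. \<forall>x\<in>K. dist (h t * g x) (h0 * g x) < e"
  proof (rule eventually_mono, intro ballI)
    fix t x assume "dist (h t) h0 < e / B" "x \<in> K"
    have "dist (h t * g x) (h0 * g x) = \<bar>h t - h0\<bar> * \<bar>g x\<bar>"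
      by (simp add: dist_real_def abs_mult flip: left_diff_distrib)
    also have "\<dots> \<le> \<bar>h t - h0\<bar> * B" using B \<open>x \<in> K\<close> by (intro mult_left_mono) auto
    also have "\<dots> < e" using \<open>dist (h t) h0 < e / B\<close> B(1) by (simp add: dist_real_def field_simps)
    finally show "dist (h t * g x) (h0 * g x) < e" .
  qed
qed

lemma uniform_limit_sum':
  fixes f :: "'k \<Rightarrow> 'b \<Rightarrow> 'a \<Rightarrow> 'c::real_normed_vector"
  assumes "\<And>k. k \<in> I \<Longrightarrow> uniform_limit K (f k) (l k) F"
  shows "uniform_limit K (\<lambda>t x. \<Sum>k\<in>I. f k t x) (\<lambda>x. \<Sum>k\<in>I. l k x) F"
  using assms
  by (induction I rule: infinite_finite_induct) (simp_all add: uniform_limit_const uniform_limit_add)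

lemma tendsto_power_quotient:
  assumes "b \<le> c" shows "((\<lambda>t::real. t ^ c / t ^ b) \<longlongrightarrow> (if c = b then 1 else 0)) (at 0)"
proof -
  have "((\<lambda>t::real. t ^ (c - b)) \<longlongrightarrow> 0 ^ (c - b)) (at 0)" by (intro tendsto_intros)
  moreover have "\<forall>\<^sub>F t::real in at 0. t ^ (c - b) = t ^ c / t ^ b"
    by (rule eventually_at_topological[THEN iffD2], rule exI[of _ UNIV]) (use assms in \<open>auto simp: power_diff\<close>)
  ultimately have "((\<lambda>t::real. t ^ c / t ^ b) \<longlongrightarrow> 0 ^ (c - b)) (at 0)"
    by (rule Lim_transform_eventually)
  then show ?thesis using assms by (simp add: power_0_left)
qed

lemma norm_dilation_le:
  assumes "\<And>j. 0 < w j" "\<bar>t\<bar> \<le> 1"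
  shows "norm (dilation w t x) \<le> \<bar>t\<bar> * norm x"
proof -
  have "norm (dilation w t x $ j) \<le> norm ((\<bar>t\<bar> *\<^sub>R x) $ j)" for j
  proof -
    have "\<bar>t\<bar> ^ w j \<le> \<bar>t\<bar> ^ 1" using assms(1)[of j] assms(2) by (intro power_decreasing) auto
    then show ?thesis by (auto simp: dilation_def abs_mult power_abs intro: mult_right_mono)
  qed
  then have "norm (dilation w t x) \<le> norm (\<bar>t\<bar> *\<^sub>R x)" by (rule norm_le_componentwise_cart)
  then show ?thesis by simp
qed

lemma eventually_dilation_in:
  fixes S :: "(real ^ 'n::finite) set"
  assumes w: "\<And>j. 0 < w j" and "open S" "0 \<in> S" "bounded K"
  shows "\<forall>\<^sub>F t in at 0. t \<noteq> 0 \<and> (\<forall>x\<in>K. dilation w t x \<in> S)"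
proof -
  obtain \<rho> where \<rho>: "\<rho> > 0" "ball 0 \<rho> \<subseteq> S" using assms openE by blast
  obtain B where B: "B > 0" "\<And>x. x \<in> K \<Longrightarrow> norm x \<le> B" using assms(4) bounded_pos by metis
  have "\<forall>\<^sub>F t::real in at 0. t \<noteq> 0 \<and> \<bar>t\<bar> < min 1 (\<rho> / B)"
    using \<rho> B unfolding eventually_at by (intro exI[of _ "min 1 (\<rho> / B)"]) (auto simp: dist_real_def)
  then show ?thesis
  proof (rule eventually_mono, intro conjI ballI)
    fix t x assume t: "t \<noteq> 0 \<and> \<bar>t\<bar> < min 1 (\<rho> / B)" and x: "x \<in> K"
    have "norm (dilation w t x) \<le> \<bar>t\<bar> * norm x" by (rule norm_dilation_le[OF w]) (use t in auto)
    also have "\<dots> \<le> \<bar>t\<bar> * B" using B(2)[OF x] by (intro mult_left_mono) auto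
    also have "\<dots> < \<rho>" using t B(1) by (simp add: field_simps)
    finally show "dilation w t x \<in> S" using \<rho> by auto
  qed auto
qed

text \<open>Taylor expansion to degree \<open>b\<close> suffices: a monomial of weight at most
  \<open>b\<close> has degree at most \<open>b\<close>, and for small t a dilation shrinks norms by
  the factor |t| at least, so the remainder is of size |t|^(b+1) and tends to 0 even after division
  by t^b.\<close>

lemma uniform_limit_homog:
  fixes f :: "real ^ 'n::finite \<Rightarrow> real"
  assumes w: "\<And>j. 0 < w j" and S: "open S" "0 \<in> S" and f: "smooth_on S f" and K: "bounded K"
    and van: "\<And>\<alpha>. multi_weight w \<alpha> + a < b \<Longrightarrow> tcoeff f \<alpha> = 0"
  shows "uniform_limit K (\<lambda>t x. t ^ a * (f (dilation w t x) / t ^ b)) (homog w a b f) (at 0)"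
proof -
  let ?A = "{\<alpha> :: 'n \<Rightarrow> nat. multi_degree \<alpha> \<le> b}"
  define R where "R = (\<lambda>x. f x - taylor b f x)"
  have Rs: "smooth_on S R" unfolding R_def by (intro smooth_on_diff f smooth_taylor S)
  have Rf: "flat (Suc b) R" unfolding R_def by (rule flat_taylor_remainder[OF S f])
  obtain \<rho> where \<rho>: "\<rho> > 0" "cball 0 \<rho> \<subseteq> S" using S open_contains_cball by blast
  obtain C where C: "\<And>y. y \<in> cball 0 \<rho> \<Longrightarrow> \<bar>R y\<bar> \<le> C * norm y ^ Suc b"
    using flat_bound[OF S(1) \<rho>(2) Rs Rf] by blast
  obtain B where B: "B > 0" "\<And>x. x \<in> K \<Longrightarrow> norm x \<le> B" using K bounded_pos by metis
  have bm: "bounded (monomial \<alpha> ` K)" for \<alpha>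
  proof -
    have "compact (monomial \<alpha> ` cball 0 B)"
      by (intro compact_continuous_image smooth_on_continuous[OF smooth_on_subset[OF smooth_monomial[OF open_UNIV]]]) auto
    then show ?thesis by (rule bounded_subset[OF compact_imp_bounded]) (use B in auto)
  qed
  have "uniform_limit K (\<lambda>t x. \<Sum>\<alpha>\<in>?A. (tcoeff f \<alpha> * (t ^ (multi_weight w \<alpha> + a) / t ^ b)) * monomial \<alpha> x)
     (\<lambda>x. \<Sum>\<alpha>\<in>?A. (tcoeff f \<alpha> * (if multi_weight w \<alpha> + a = b then 1 else 0)) * monomial \<alpha> x) (at 0)"
  proof (intro uniform_limit_sum' uniform_limit_scale bm)
    fix \<alpha>
    show "((\<lambda>t. tcoeff f \<alpha> * (t ^ (multi_weight w \<alpha> + a) / t ^ b)) \<longlongrightarrow>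
        tcoeff f \<alpha> * (if multi_weight w \<alpha> + a = b then 1 else 0)) (at 0)"
    proof (cases "multi_weight w \<alpha> + a < b")
      case False
      then show ?thesis by (intro tendsto_mult_left tendsto_power_quotient) simp
    qed (simp add: van)
  qed
  moreover have "uniform_limit K (\<lambda>t x. t ^ a * (R (dilation w t x) / t ^ b)) (\<lambda>x. 0) (at 0)"
  proof (rule uniform_limitI)
    fix e :: real assume e: "e > 0"
    define M where "M = \<bar>C\<bar> * B ^ Suc b + 1"
    have M: "M > 0" unfolding M_def using B by (simp add: add_nonneg_pos)
    have "\<forall>\<^sub>F t::real in at 0. t \<noteq> 0 \<and> \<bar>t\<bar> < min 1 (e / M)"
      using e M unfolding eventually_at by (intro exI[of _ "min 1 (e / M)"]) (auto simp: dist_real_def)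
    moreover have "\<forall>\<^sub>F t in at 0. t \<noteq> 0 \<and> (\<forall>x\<in>K. dilation w t x \<in> ball 0 \<rho>)"
      by (rule eventually_dilation_in[OF w _ _ K]) (use \<rho> in auto)
    ultimately show "\<forall>\<^sub>F t in at 0. \<forall>x\<in>K. dist (t ^ a * (R (dilation w t x) / t ^ b)) 0 < e"
    proof eventually_elim
      case (elim t)
      show ?case
      proof
        fix x assume x: "x \<in> K"
        have "\<bar>R (dilation w t x)\<bar> \<le> C * norm (dilation w t x) ^ Suc b" using elim x by (intro C) auto
        also have "\<dots> \<le> \<bar>C\<bar> * (\<bar>t\<bar> * B) ^ Suc b"
        proof (intro mult_mono power_mono)
          have "norm (dilation w t x) \<le> \<bar>t\<bar> * norm x" by (rule norm_dilation_le[OF w]) (use elim in auto)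
          also have "\<dots> \<le> \<bar>t\<bar> * B" using B(2)[OF x] by (intro mult_left_mono) auto
          finally show "norm (dilation w t x) \<le> \<bar>t\<bar> * B" .
        qed auto
        finally have R: "\<bar>R (dilation w t x)\<bar> \<le> \<bar>C\<bar> * (\<bar>t\<bar> * B) ^ Suc b" .
        have "\<bar>t ^ a * (R (dilation w t x) / t ^ b)\<bar> = \<bar>t\<bar> ^ a * (\<bar>R (dilation w t x)\<bar> / \<bar>t\<bar> ^ b)"
          by (simp add: abs_mult power_abs)
        also have "\<dots> \<le> 1 * (\<bar>C\<bar> * (\<bar>t\<bar> * B) ^ Suc b / \<bar>t\<bar> ^ b)"
          using elim by (intro mult_mono divide_right_mono R power_le_one) auto
        also have "\<dots> = \<bar>t\<bar> * (\<bar>C\<bar> * B ^ Suc b)"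
          using elim by (simp add: power_mult_distrib field_simps)
        also have "\<dots> \<le> \<bar>t\<bar> * M" unfolding M_def by (intro mult_left_mono) auto
        also have "\<dots> < e" using elim M by (simp add: field_simps)
        finally show "dist (t ^ a * (R (dilation w t x) / t ^ b)) 0 < e" by (simp add: dist_real_def)
      qed
    qed
  qed
  ultimately have "uniform_limit K (\<lambda>t x. (\<Sum>\<alpha>\<in>?A. (tcoeff f \<alpha> * (t ^ (multi_weight w \<alpha> + a) / t ^ b)) * monomial \<alpha> x)
      + t ^ a * (R (dilation w t x) / t ^ b))
     (\<lambda>x. (\<Sum>\<alpha>\<in>?A. (tcoeff f \<alpha> * (if multi_weight w \<alpha> + a = b then 1 else 0)) * monomial \<alpha> x) + 0) (at 0)"
    by (rule uniform_limit_add)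
  moreover have "(\<Sum>\<alpha>\<in>?A. (tcoeff f \<alpha> * (t ^ (multi_weight w \<alpha> + a) / t ^ b)) * monomial \<alpha> x)
      + t ^ a * (R (dilation w t x) / t ^ b) = t ^ a * (f (dilation w t x) / t ^ b)" for t x
  proof -
    have "(\<Sum>\<alpha>\<in>?A. (tcoeff f \<alpha> * (t ^ (multi_weight w \<alpha> + a) / t ^ b)) * monomial \<alpha> x)
       = t ^ a * (taylor b f (dilation w t x) / t ^ b)"
      unfolding taylor_def monomial_dilation sum_distrib_left sum_divide_distrib
      by (rule sum.cong) (simp_all add: power_add)
    then show ?thesis by (simp add: R_def diff_divide_distrib right_diff_distrib)
  qed
  moreover have "(\<lambda>x. (\<Sum>\<alpha>\<in>?A. (tcoeff f \<alpha> * (if multi_weight w \<alpha> + a = b then 1 else 0)) * monomial \<alpha> x) + 0)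
     = homog w a b f"
  proof
    fix x
    have "{\<alpha>. multi_weight w \<alpha> + a = b} \<subseteq> ?A"
    proof
      fix \<alpha> assume "\<alpha> \<in> {\<alpha>. multi_weight w \<alpha> + a = b}"
      then show "\<alpha> \<in> ?A" using multi_degree_le_weight[of w \<alpha>, OF w] by simp
    qed
    then have "(\<Sum>\<alpha>\<in>?A. (tcoeff f \<alpha> * (if multi_weight w \<alpha> + a = b then 1 else 0)) * monomial \<alpha> x)
      = (\<Sum>\<alpha> | multi_weight w \<alpha> + a = b. (tcoeff f \<alpha> * (if multi_weight w \<alpha> + a = b then 1 else 0)) * monomial \<alpha> x)"
      by (intro sum.mono_neutral_right finite_multi_degree_le) auto
    then show "(\<Sum>\<alpha>\<in>?A. (tcoeff f \<alpha> * (if multi_weight w \<alpha> + a = b then 1 else 0)) * monomial \<alpha> x) + 0 = homog w a b f x"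
      by (simp add: homog_def)
  qed
  ultimately show ?thesis by simp
qed

lemma iter_dir_deriv_add:
  fixes f g :: "'a::real_normed_vector \<Rightarrow> 'b::real_normed_vector"
  assumes "open S" "smooth_on S f" "smooth_on S g" "x \<in> S"
  shows "iter_dir_deriv vs (\<lambda>x. f x + g x) x = iter_dir_deriv vs f x + iter_dir_deriv vs g x"
  using assms(4)
proof (induction vs arbitrary: x)
  case (Cons v vs)
  have "dird v (iter_dir_deriv vs (\<lambda>x. f x + g x)) x
      = dird v (\<lambda>x. iter_dir_deriv vs f x + iter_dir_deriv vs g x) x"
    by (rule dird_cong_open[OF assms(1) Cons.prems Cons.IH])
  also have "\<dots> = dird v (iter_dir_deriv vs f) x + dird v (iter_dir_deriv vs g) x"
    by (rule dird_add[OF smooth_on_differentiable[OF smooth_on_iter[OF assms(2)] Cons.prems]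
          smooth_on_differentiable[OF smooth_on_iter[OF assms(3)] Cons.prems]])
  finally show ?case unfolding iter_dir_deriv_Cons .
qed simp

lemma iter_dir_deriv_zero: "iter_dir_deriv vs (\<lambda>x. 0) = (\<lambda>x. 0)"
  by (induction vs) (simp_all add: iter_dir_deriv_Cons)

lemma iter_dir_deriv_cmult:
  fixes f :: "'a::real_normed_vector \<Rightarrow> real"
  assumes "open S" "smooth_on S f" "x \<in> S"
  shows "iter_dir_deriv vs (\<lambda>x. c * f x) x = c * iter_dir_deriv vs f x"
  using assms(3)
proof (induction vs arbitrary: x)
  case (Cons v vs)
  have "dird v (iter_dir_deriv vs (\<lambda>x. c * f x)) x = dird v (\<lambda>x. c * iter_dir_deriv vs f x) x"
    by (rule dird_cong_open[OF assms(1) Cons.prems Cons.IH])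
  also have "\<dots> = c * dird v (iter_dir_deriv vs f) x"
    by (rule dird_cmult[OF smooth_on_differentiable[OF smooth_on_iter[OF assms(2)] Cons.prems]])
  finally show ?case unfolding iter_dir_deriv_Cons .
qed simp

lemma iter_dir_deriv_sum:
  fixes f :: "'k \<Rightarrow> 'a::real_normed_vector \<Rightarrow> 'b::real_normed_vector"
  assumes "open S" "\<And>k. k \<in> K \<Longrightarrow> smooth_on S (f k)" "x \<in> S"
  shows "iter_dir_deriv vs (\<lambda>x. \<Sum>k\<in>K. f k x) x = (\<Sum>k\<in>K. iter_dir_deriv vs (f k) x)"
  using assms(2)
proof (induction K rule: infinite_finite_induct)
  case (insert k K)
  have "smooth_on S (\<lambda>x. \<Sum>k\<in>K. f k x)" using insert by (intro smooth_on_sum assms(1)) auto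
  then show ?case
    using insert iter_dir_deriv_add[OF assms(1), of "f k" "\<lambda>x. \<Sum>k\<in>K. f k x"] assms(3) by simp
qed (simp_all add: iter_dir_deriv_zero)

lemma iter_dir_deriv_lincomb:
  fixes G :: "'k \<Rightarrow> 'a::real_normed_vector \<Rightarrow> real"
  assumes "open S" "\<And>k. k \<in> K \<Longrightarrow> smooth_on S (G k)" "x \<in> S"
  shows "iter_dir_deriv vs (\<lambda>x. \<Sum>k\<in>K. c k * G k x) x = (\<Sum>k\<in>K. c k * iter_dir_deriv vs (G k) x)"
proof -
  have "iter_dir_deriv vs (\<lambda>x. \<Sum>k\<in>K. c k * G k x) x = (\<Sum>k\<in>K. iter_dir_deriv vs (\<lambda>x. c k * G k x) x)"
    by (rule iter_dir_deriv_sum[OF assms(1) _ assms(3)]) (intro smooth_on_mult smooth_on_const assms)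
  then show ?thesis using iter_dir_deriv_cmult[OF assms(1) assms(2) assms(3)] by simp
qed

lemma bounded_linear_dilation: "bounded_linear (dilation w t)"
  by (rule linear_conv_bounded_linear[THEN iffD1], unfold_locales)
    (simp_all add: dilation_def vec_eq_iff algebra_simps)

lemma dilation_nth [simp]: "dilation w t x $ k = t ^ w k * x $ k"
  by (simp add: dilation_def)

lemma dilation_0 [simp]: "dilation w t 0 = 0"
  by (simp add: vec_eq_iff)

lemma open_dilation_vimage: "open S \<Longrightarrow> open (dilation w t -` S)"
  by (rule open_vimage) (auto intro: linear_continuous_on bounded_linear_dilation)

lemma smooth_on_dilation: "open S \<Longrightarrow> smooth_on S f \<Longrightarrow> smooth_on (dilation w t -` S) (\<lambda>x. f (dilation w t x))"
  by (rule smooth_on_compose[OF open_dilation_vimage _ _ smooth_on_bounded_linear[OF bounded_linear_dilation]]) auto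

lemma dird_dilation:
  assumes "f differentiable at (dilation w t x)"
  shows "dird v (\<lambda>x. f (dilation w t x)) x = dird (dilation w t v) f (dilation w t x)"
  by (subst dird_compose)
    (use assms in \<open>simp_all add: bounded_linear_imp_differentiable dird_bounded_linear bounded_linear_dilation\<close>)

lemma finite_weight_slice: "(\<And>j. 0 < w j) \<Longrightarrow> finite {\<alpha> :: 'n::finite \<Rightarrow> nat. multi_weight w \<alpha> + a = b}"
  by (rule finite_subset[OF _ finite_multi_weight_le[of w b]]) auto

lemma smooth_homog: "open S \<Longrightarrow> smooth_on S (homog w a b f)"
  unfolding homog_def by (rule smooth_poly)

lemma tcoeff_dird:
  assumes "open S" "0 \<in> S" "smooth_on S f"
  shows "tcoeff (dird (axis l 1) f) \<beta> = (\<beta> l + 1) * tcoeff f (\<beta>(l := \<beta> l + 1))"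
proof -
  let ?\<alpha> = "\<beta>(l := \<beta> l + 1)"
  have "pd (mlist \<beta>) (dird (axis l 1) f) 0 = pd (mlist \<beta> @ [l]) f 0" by (simp add: pd_snoc)
  also have "\<dots> = pd (mlist ?\<alpha>) f 0"
    by (rule pd_mset_cong[OF assms(1,3,2)]) (auto simp: multiset_eq_iff)
  finally have e: "pd (mlist \<beta>) (dird (axis l 1) f) 0 = pd (mlist ?\<alpha>) f 0" .
  have "?\<alpha>(l := ?\<alpha> l - 1) = \<beta>" by (simp add: fun_eq_iff)
  then have "multi_fact ?\<alpha> = (\<beta> l + 1) * multi_fact \<beta>" using multi_fact_dec[of ?\<alpha> l] by simp
  moreover have "real (\<beta> l + 1) \<noteq> 0" by simp
  ultimately show ?thesis unfolding tcoeff_def e by (simp add: divide_simps del: of_nat_add of_nat_Suc)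
qed

lemma multi_weight_inc: "multi_weight w (\<beta>(l := \<beta> l + 1)) = multi_weight w \<beta> + w l"
proof -
  have "\<beta>(l := \<beta> l + 1) = (\<lambda>j. \<beta> j + single l j)" by (auto simp: single_def)
  then show ?thesis by (simp only: multi_weight_add multi_degree_single)
qed

lemma dird_homog:
  assumes w: "\<And>j. 0 < w j" and S: "open S" "0 \<in> S" and f: "smooth_on S f"
  shows "dird v (homog w a b f) x = (\<Sum>l\<in>UNIV. v $ l * homog w (a + w l) b (dird (axis l 1) f) x)"
proof -
  have "dird (axis l 1) (homog w a b f) x = homog w (a + w l) b (dird (axis l 1) f) x" for l
  proof -
    let ?A = "{\<alpha>. multi_weight w \<alpha> + a = b}" and ?B = "{\<beta>. multi_weight w \<beta> + (a + w l) = b}"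
    have "dird (axis l 1) (homog w a b f) x = (\<Sum>\<alpha>\<in>?A. dird (axis l 1) (\<lambda>x. tcoeff f \<alpha> * monomial \<alpha> x) x)"
      unfolding homog_def
      by (rule dird_sum, rule smooth_on_differentiable[of UNIV])
        (auto intro!: smooth_on_mult smooth_monomial)
    also have "\<dots> = (\<Sum>\<alpha>\<in>?A. tcoeff f \<alpha> * (\<alpha> l * monomial (\<alpha>(l := \<alpha> l - 1)) x))"
      by (simp add: dird_cmult smooth_on_differentiable[OF smooth_monomial[of UNIV]] dird_monomial)
    also have "\<dots> = (\<Sum>\<alpha>\<in>{\<alpha>\<in>?A. \<alpha> l \<noteq> 0}. tcoeff f \<alpha> * (\<alpha> l * monomial (\<alpha>(l := \<alpha> l - 1)) x))"
      by (rule sum.mono_neutral_right) (auto intro: finite_weight_slice w)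
    also have "\<dots> = (\<Sum>\<beta>\<in>?B. tcoeff f (\<beta>(l := \<beta> l + 1)) * ((\<beta> l + 1) * monomial \<beta> x))"
    proof (rule sum.reindex_bij_witness[of _ "\<lambda>\<beta>. \<beta>(l := \<beta> l + 1)" "\<lambda>\<alpha>. \<alpha>(l := \<alpha> l - 1)"])
      fix \<alpha> assume \<alpha>: "\<alpha> \<in> {\<alpha>\<in>?A. \<alpha> l \<noteq> 0}"
      show inv: "(\<alpha>(l := \<alpha> l - 1))(l := (\<alpha>(l := \<alpha> l - 1)) l + 1) = \<alpha>" using \<alpha> by (auto simp: fun_eq_iff)
      show "\<alpha>(l := \<alpha> l - 1) \<in> ?B" using multi_weight_inc[of w "\<alpha>(l := \<alpha> l - 1)" l] inv \<alpha> by auto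
      show "tcoeff f ((\<alpha>(l := \<alpha> l - 1))(l := (\<alpha>(l := \<alpha> l - 1)) l + 1)) *
        (((\<alpha>(l := \<alpha> l - 1)) l + 1) * monomial (\<alpha>(l := \<alpha> l - 1)) x) =
        tcoeff f \<alpha> * (\<alpha> l * monomial (\<alpha>(l := \<alpha> l - 1)) x)"
        unfolding inv using \<alpha> by simp
    next
      fix \<beta> assume "\<beta> \<in> ?B"
      then show "\<beta>(l := \<beta> l + 1) \<in> {\<alpha>\<in>?A. \<alpha> l \<noteq> 0}" using multi_weight_inc[of w \<beta> l] by auto
    qed (auto simp: fun_eq_iff)
    also have "\<dots> = homog w (a + w l) b (dird (axis l 1) f) x"
      unfolding homog_def by (rule sum.cong) (simp_all add: tcoeff_dird[OF S f] mult_ac)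
    finally show ?thesis .
  qed
  moreover have "homog w a b f differentiable at x"
    by (rule smooth_on_differentiable[OF smooth_homog[OF open_UNIV] UNIV_I])
  ultimately show ?thesis by (simp add: dird_expand[of _ x v])
qed

text \<open>Differentiating the rescaled function along axis \<open>l\<close> gives the rescaled
  partial derivative with \<open>a\<close> raised by \<open>w l\<close>. The shape of the claim is
  thus preserved by differentiation, and the list of directions is consumed from the inside.\<close>

lemma uniform_limit_homog_derivs:
  fixes f :: "real ^ 'n::finite \<Rightarrow> real"
  assumes w: "\<And>j. 0 < w j" and S: "open S" "0 \<in> S" and f: "smooth_on S f" and K: "bounded K"
    and van: "\<And>\<alpha>. multi_weight w \<alpha> + a < b \<Longrightarrow> tcoeff f \<alpha> = 0"
  shows "uniform_limit K (\<lambda>t. iter_dir_deriv vs (\<lambda>x. t ^ a * (f (dilation w t x) / t ^ b)))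
    (iter_dir_deriv vs (homog w a b f)) (at 0)"
  using f van
proof (induction vs arbitrary: f a rule: rev_induct)
  case Nil
  then show ?case using uniform_limit_homog[where w = w, OF w S Nil.prems(1) K Nil.prems(2)] by simp
next
  case (snoc v vs)
  let ?F = "\<lambda>t a f x. t ^ a * (f (dilation w t x) / t ^ b)"
  let ?D = "\<lambda>l. dird (axis l 1) f"
  have Fs: "smooth_on (dilation w t -` S) (?F t a f)" if "smooth_on S f" for t a and f :: "real ^ 'n \<Rightarrow> real"
    using smooth_on_mult[OF open_dilation_vimage[OF S(1)] smooth_on_const smooth_on_dilation[OF S(1) that],
        of w t "t ^ a / t ^ b"] by simp
  have lim: "uniform_limit K (\<lambda>t x. \<Sum>l\<in>UNIV. v $ l * iter_dir_deriv vs (?F t (a + w l) (?D l)) x)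
      (\<lambda>x. \<Sum>l\<in>UNIV. v $ l * iter_dir_deriv vs (homog w (a + w l) b (?D l)) x) (at 0)"
  proof (rule uniform_limit_sum')
    fix l
    have "uniform_limit K (\<lambda>t. iter_dir_deriv vs (?F t (a + w l) (?D l)))
       (iter_dir_deriv vs (homog w (a + w l) b (?D l))) (at 0)"
    proof (rule snoc.IH)
      show "smooth_on S (?D l)" by (rule smooth_on_dird[OF snoc.prems(1)])
      fix \<beta> assume "multi_weight w \<beta> + (a + w l) < b"
      then have "tcoeff f (\<beta>(l := \<beta> l + 1)) = 0"
        by (intro snoc.prems(2)) (simp only: multi_weight_inc)
      then show "tcoeff (?D l) \<beta> = 0" by (simp add: tcoeff_dird[OF S snoc.prems(1)])
    qed
    then show "uniform_limit K (\<lambda>t x. v $ l * iter_dir_deriv vs (?F t (a + w l) (?D l)) x)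
       (\<lambda>x. v $ l * iter_dir_deriv vs (homog w (a + w l) b (?D l)) x) (at 0)"
      by (rule bounded_linear.uniform_limit[OF bounded_linear_mult_right])
  qed
  have rhs: "(\<Sum>l\<in>UNIV. v $ l * iter_dir_deriv vs (homog w (a + w l) b (?D l)) x)
      = iter_dir_deriv (vs @ [v]) (homog w a b f) x" for x
    unfolding iter_dir_deriv_snoc dird_homog[where w = w, OF w S snoc.prems(1), abs_def]
    by (rule iter_dir_deriv_lincomb[OF open_UNIV smooth_homog[OF open_UNIV] UNIV_I, symmetric])
  have lhs: "iter_dir_deriv (vs @ [v]) (?F t a f) x
      = (\<Sum>l\<in>UNIV. v $ l * iter_dir_deriv vs (?F t (a + w l) (?D l)) x)" if "x \<in> dilation w t -` S" for t x
  proof -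
    have "iter_dir_deriv (vs @ [v]) (?F t a f) x
       = iter_dir_deriv vs (\<lambda>x. \<Sum>l\<in>UNIV. v $ l * ?F t (a + w l) (?D l) x) x"
      unfolding iter_dir_deriv_snoc
    proof (rule iter_dir_deriv_cong_open[OF open_dilation_vimage[OF S(1)] that])
      fix y assume "y \<in> dilation w t -` S"
      then have y: "dilation w t y \<in> S" by simp
      note df = smooth_on_differentiable[OF snoc.prems(1) y]
      have "(\<lambda>x. f (dilation w t x)) differentiable at y"
        by (rule smooth_on_differentiable[OF smooth_on_dilation[OF S(1) snoc.prems(1)]]) (use y in simp)
      from dird_cmult[OF this, of v "t ^ a / t ^ b"]
      have "dird v (?F t a f) y = t ^ a / t ^ b * dird (dilation w t v) f (dilation w t y)"
        by (simp add: dird_dilation[OF df])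
      also have "\<dots> = (\<Sum>l\<in>UNIV. v $ l * ?F t (a + w l) (?D l) y)"
        unfolding dird_expand[OF df, of "dilation w t v"] sum_distrib_left
        by (rule sum.cong) (simp_all add: power_add)
      finally show "dird v (?F t a f) y = (\<Sum>l\<in>UNIV. v $ l * ?F t (a + w l) (?D l) y)" .
    qed
    also have "\<dots> = (\<Sum>l\<in>UNIV. v $ l * iter_dir_deriv vs (?F t (a + w l) (?D l)) x)"
      by (rule iter_dir_deriv_lincomb[OF open_dilation_vimage[OF S(1)] Fs that])
        (rule smooth_on_dird[OF snoc.prems(1)])
    finally show ?thesis .
  qed
  have "\<forall>\<^sub>F t in at 0. \<forall>x\<in>K. iter_dir_deriv (vs @ [v]) (?F t a f) x
      = (\<Sum>l\<in>UNIV. v $ l * iter_dir_deriv vs (?F t (a + w l) (?D l)) x)"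
    using eventually_dilation_in[where w = w, OF w S K]
    by (rule eventually_mono) (intro ballI lhs, blast)
  from uniform_limit_cong[OF this, of "iter_dir_deriv (vs @ [v]) (homog w a b f)"
      "\<lambda>x. \<Sum>l\<in>UNIV. v $ l * iter_dir_deriv vs (homog w (a + w l) b (?D l)) x"] rhs lim
  show ?case by simp
qed

lemma uniform_limit_vec:
  fixes F :: "'t \<Rightarrow> 'a \<Rightarrow> real ^ 'n"
  assumes "\<And>k. uniform_limit K (\<lambda>t x. F t x $ k) (\<lambda>x. G x $ k) net"
  shows "uniform_limit K F G net"
proof -
  have "uniform_limit K (\<lambda>t x. \<Sum>k\<in>UNIV. F t x $ k *\<^sub>R axis k (1::real)) (\<lambda>x. \<Sum>k\<in>UNIV. G x $ k *\<^sub>R axis k 1) net"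
    by (intro uniform_limit_sum' bounded_linear.uniform_limit[OF bounded_linear_scaleR_left] assms)
  then show ?thesis by (simp flip: vec_eq_sum_axis)
qed

lemma uniform_limit_transform:
  assumes "uniform_limit K f l F" "\<forall>\<^sub>F t in F. \<forall>x\<in>K. f t x = g t x" "\<And>x. x \<in> K \<Longrightarrow> l x = m x"
  shows "uniform_limit K g m F"
  using uniform_limit_cong[OF assms(2), of l m] assms by simp

lemma is_model_field_unique:
  assumes "is_model_field w j X M" "is_model_field w j X M'"
  shows "M = M'"
proof
  fix x
  have "((\<lambda>t. t ^ w j *\<^sub>R dilation_pullback w t X x) \<longlongrightarrow> N x) (at 0)" if "is_model_field w j X N" for N
    using that[unfolded is_model_field_def, rule_format, of "{x}" "[]"] by simp
  from this[OF assms(1)] this[OF assms(2)] show "M x = M' x"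
    by (rule tendsto_unique[OF trivial_limit_at])
qed

section \<open>Frames rescaled by dilations\<close>

definition rescaled :: "('n::finite \<Rightarrow> nat) \<Rightarrow> ('n \<Rightarrow> 'n vfield) \<Rightarrow> real \<Rightarrow> 'n \<Rightarrow> 'n vfield" where
  "rescaled w Z t j = (\<lambda>x. t ^ w j *\<^sub>R dilation_pullback w t (Z j) x)"

lemma rescaled_nth: "rescaled w Z t j x $ k = t ^ w j * (Z j (dilation w t x) $ k / t ^ w k)"
  by (simp add: rescaled_def dilation_pullback_def)

lemma dilation_rescaled:
  "t \<noteq> 0 \<Longrightarrow> dilation w t (rescaled w Z t j x) = t ^ w j *\<^sub>R Z j (dilation w t x)"
  by (simp add: vec_eq_iff rescaled_nth)

lemma is_model_field_tendsto:
  assumes "is_model_field w j (Z j) M"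
  shows "((\<lambda>t. iter_dir_deriv vs (rescaled w Z t j) x) \<longlongrightarrow> iter_dir_deriv vs M x) (at 0)"
  using assms[unfolded is_model_field_def, rule_format, of "{x}" vs] by (simp add: rescaled_def)

context smooth_frame
begin

lemma smooth_rescaled: "smooth_on (dilation w t -` S) (rescaled w Y t j)"
proof (rule smooth_on_vec[OF open_dilation_vimage[OF open_S]])
  fix k
  have "smooth_on (dilation w t -` S) (\<lambda>x. (t ^ w j / t ^ w k) * (Y j (dilation w t x) $ k))"
    by (intro smooth_on_mult smooth_on_const open_dilation_vimage smooth_on_nth smooth_on_dilation smooth_Y open_S)
  then show "smooth_on (dilation w t -` S) (\<lambda>x. rescaled w Y t j x $ k)"
    by (simp add: rescaled_nth)
qed

lemma smooth_frame_rescaled: "smooth_frame (dilation w t -` S) (rescaled w Y t)"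
  by unfold_locales (intro open_dilation_vimage open_S smooth_rescaled)+

lemma frame_apply_rescaled:
  assumes t: "t \<noteq> 0" and f: "smooth_on S f" and "dilation w t x \<in> S"
  shows "frame_apply (rescaled w Y t) I (\<lambda>x. f (dilation w t x)) x
    = t ^ index_weight w I * frame_apply Y I f (dilation w t x)"
  using assms(3)
proof (induction I arbitrary: x)
  case (Cons i I)
  let ?g = "frame_apply Y I f"
  have x: "x \<in> dilation w t -` S" using Cons.prems by simp
  note dg = smooth_on_differentiable[OF smooth_frame_apply[OF f] Cons.prems]
  have dd: "(\<lambda>x. ?g (dilation w t x)) differentiable at x"
    by (rule smooth_on_differentiable[OF smooth_on_dilation[OF open_S smooth_frame_apply[OF f]] x])
  have "frame_apply (rescaled w Y t) (i # I) (\<lambda>x. f (dilation w t x)) x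
     = vf_apply (rescaled w Y t i) (\<lambda>x. t ^ index_weight w I * ?g (dilation w t x)) x"
    unfolding frame_apply_Cons
    by (rule vf_apply_cong_open[OF open_dilation_vimage[OF open_S] x]) (use Cons.IH in simp)
  also have "\<dots> = t ^ index_weight w I * dird (t ^ w i *\<^sub>R Y i (dilation w t x)) ?g (dilation w t x)"
    unfolding vf_apply_eq_dird dird_cmult[OF dd] dird_dilation[OF dg] dilation_rescaled[OF t] ..
  also have "\<dots> = t ^ index_weight w (i # I) * frame_apply Y (i # I) f (dilation w t x)"
    using linear_scale[OF linear_dird[OF dg]] by (simp add: frame_apply_Cons vf_apply_eq_dird power_add)
  finally show ?case .
qed simp

text \<open>The rescaled fields contribute t to the power of the weight of \<open>I\<close>, and the
  coordinate composed with the dilation contributes \<open>t ^ w k\<close>; for equal weights the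
  two cancel.\<close>

lemma frame_apply_rescaled_coord:
  assumes "t \<noteq> 0" "0 \<in> S" "index_weight w I = w k"
  shows "frame_apply (rescaled w Y t) I (\<lambda>x. x $ k) 0 = frame_apply Y I (\<lambda>x. x $ k) 0"
proof -
  interpret R: smooth_frame "dilation w t -` S" "rescaled w Y t" by (rule smooth_frame_rescaled)
  have s: "smooth_on T (\<lambda>x. x $ k)" if "open T" for T :: "(real ^ 'n) set"
    by (rule smooth_on_nth[OF that smooth_on_id])
  have "t ^ w k * frame_apply (rescaled w Y t) I (\<lambda>x. x $ k) 0
      = frame_apply (rescaled w Y t) I (\<lambda>x. t ^ w k * x $ k) 0"
    by (rule R.frame_apply_cmult[symmetric, OF s[OF R.open_S]]) (use assms in simp)
  also have "\<dots> = t ^ w k * frame_apply Y I (\<lambda>x. x $ k) 0"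
    using frame_apply_rescaled[OF assms(1) s[OF open_S], where x = 0 and I = I and w = w] assms by simp
  finally show ?thesis using assms(1) by simp
qed

end

text \<open>Convergence of all derivatives at the single point 0, for functions on domains that vary
  with t. This notion is closed under products and derivatives, which is what passing to the limit
  in a word of fields requires.\<close>

locale jet_limit =
  fixes U :: "real \<Rightarrow> 'a::real_normed_vector set"
  assumes open_U: "\<And>t. open (U t)" and zero_U: "\<And>t. 0 \<in> U t"
begin

definition jlim :: "(real \<Rightarrow> 'a \<Rightarrow> real) \<Rightarrow> ('a \<Rightarrow> real) \<Rightarrow> bool" where
  "jlim F f \<longleftrightarrow> (\<forall>t. smooth_on (U t) (F t)) \<and> smooth_on UNIV f \<and>
     (\<forall>vs. ((\<lambda>t. iter_dir_deriv vs (F t) 0) \<longlongrightarrow> iter_dir_deriv vs f 0) (at 0))"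

lemma jlim_tendsto: "jlim F f \<Longrightarrow> ((\<lambda>t. iter_dir_deriv vs (F t) 0) \<longlongrightarrow> iter_dir_deriv vs f 0) (at 0)"
  by (simp add: jlim_def)

lemma jlim_add:
  assumes "jlim F f" "jlim G g" shows "jlim (\<lambda>t x. F t x + G t x) (\<lambda>x. f x + g x)"
proof -
  have s: "smooth_on (U t) (F t)" "smooth_on (U t) (G t)" "smooth_on UNIV f" "smooth_on UNIV g" for t
    using assms by (auto simp: jlim_def)
  have "((\<lambda>t. iter_dir_deriv vs (\<lambda>x. F t x + G t x) 0) \<longlongrightarrow> iter_dir_deriv vs (\<lambda>x. f x + g x) 0) (at 0)" for vs
    unfolding iter_dir_deriv_add[OF open_U s(1,2) zero_U] iter_dir_deriv_add[OF open_UNIV s(3,4) UNIV_I]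
    by (intro tendsto_add jlim_tendsto assms)
  then show ?thesis using s by (simp add: jlim_def smooth_on_add open_U)
qed

lemma jlim_cong:
  assumes H: "jlim H h" and F: "\<And>t x. x \<in> U t \<Longrightarrow> F t x = H t x" and f: "\<And>x. f x = h x"
  shows "jlim F f"
proof -
  have fh: "f = h" using f by (rule ext)
  have "smooth_on (U t) (F t)" for t
    using smooth_on_cong[OF open_U F] H by (simp add: jlim_def)
  moreover have "iter_dir_deriv vs (F t) 0 = iter_dir_deriv vs (H t) 0" for vs t
    by (rule iter_dir_deriv_cong_open[OF open_U zero_U F])
  ultimately show ?thesis using H unfolding fh by (simp add: jlim_def)
qed

lemma jlim_const: "jlim (\<lambda>t x. c) (\<lambda>x. c)"
  unfolding jlim_def by simp

lemma jlim_sum: "(\<And>k. k \<in> I \<Longrightarrow> jlim (F k) (f k)) \<Longrightarrow> jlim (\<lambda>t x. \<Sum>k\<in>I. F k t x) (\<lambda>x. \<Sum>k\<in>I. f k x)"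
  by (induction I rule: infinite_finite_induct) (simp_all add: jlim_const jlim_add)

lemma jlim_dird: "jlim F f \<Longrightarrow> jlim (\<lambda>t. dird v (F t)) (dird v f)"
  unfolding jlim_def iter_dir_deriv_snoc[symmetric] by (auto intro: smooth_on_dird)

lemma jlim_mult:
  assumes "jlim F f" "jlim G g" shows "jlim (\<lambda>t x. F t x * G t x) (\<lambda>x. f x * g x)"
proof -
  have "((\<lambda>t. iter_dir_deriv vs (\<lambda>x. F t x * G t x) 0) \<longlongrightarrow> iter_dir_deriv vs (\<lambda>x. f x * g x) 0) (at 0)" for vs
    using assms
  proof (induction vs arbitrary: F f G g rule: rev_induct)
    case Nil
    have "((\<lambda>t. F t 0) \<longlongrightarrow> f 0) (at 0)" "((\<lambda>t. G t 0) \<longlongrightarrow> g 0) (at 0)"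
      using jlim_tendsto[OF Nil(1), of "[]"] jlim_tendsto[OF Nil(2), of "[]"] by simp_all
    then show ?case by (simp add: tendsto_mult)
  next
    case (snoc v vs)
    have leib: "iter_dir_deriv (vs @ [v]) (\<lambda>x. p x * q x) 0
        = iter_dir_deriv vs (\<lambda>x. dird v p x * q x) 0 + iter_dir_deriv vs (\<lambda>x. p x * dird v q x) 0"
      if "open T" "0 \<in> T" "smooth_on T p" "smooth_on T q" for T and p q :: "'a \<Rightarrow> real"
    proof -
      have "iter_dir_deriv (vs @ [v]) (\<lambda>x. p x * q x) 0 = iter_dir_deriv vs (\<lambda>x. dird v p x * q x + p x * dird v q x) 0"
        unfolding iter_dir_deriv_snoc
        by (rule iter_dir_deriv_cong_open[OF that(1,2)])
          (rule dird_mult[OF smooth_on_differentiable[OF that(3)] smooth_on_differentiable[OF that(4)]])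
      also have "\<dots> = iter_dir_deriv vs (\<lambda>x. dird v p x * q x) 0 + iter_dir_deriv vs (\<lambda>x. p x * dird v q x) 0"
        by (rule iter_dir_deriv_add[OF that(1) _ _ that(2)]) (intro smooth_on_mult smooth_on_dird that)+
      finally show ?thesis .
    qed
    have s: "smooth_on (U t) (F t)" "smooth_on (U t) (G t)" "smooth_on UNIV f" "smooth_on UNIV g" for t
      using snoc.prems by (auto simp: jlim_def)
    show ?case
      unfolding leib[OF open_U zero_U s(1,2)] leib[OF open_UNIV UNIV_I s(3,4)]
      by (intro tendsto_add snoc.IH jlim_dird snoc.prems)
  qed
  then show ?thesis
    using assms by (simp add: jlim_def smooth_on_mult open_U)
qed

end

text \<open>By dilation invariance the value for the rescaled frame is the same for all nonzero t,
  and as t tends to 0 it converges to the value for the model fields.\<close>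

lemma (in smooth_frame) frame_apply_model:
  assumes S0: "0 \<in> S" and m: "\<And>j. is_model_field w j (Y j) (M j)" and M: "\<And>j. smooth_on UNIV (M j)"
    and I: "index_weight w I = w k"
  shows "frame_apply Y I (\<lambda>x. x $ k) 0 = frame_apply M I (\<lambda>x. x $ k) 0"
proof -
  define U where "U = (\<lambda>t. dilation w t -` S)"
  interpret jet_limit U by unfold_locales (auto simp: U_def open_dilation_vimage open_S S0)
  have s: "smooth_on T (\<lambda>x. x $ k)" if "open T" for T :: "(real ^ 'n) set"
    by (rule smooth_on_nth[OF that smooth_on_id])
  have coeff: "jlim (\<lambda>t x. rescaled w Y t j x $ l) (\<lambda>x. M j x $ l)" for j l
    unfolding jlim_def
  proof (intro conjI allI)
    show "smooth_on (U t) (\<lambda>x. rescaled w Y t j x $ l)" for t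
      unfolding U_def by (intro smooth_on_nth open_dilation_vimage open_S smooth_rescaled)
    show "smooth_on UNIV (\<lambda>x. M j x $ l)" by (intro smooth_on_nth open_UNIV M)
    show "((\<lambda>t. iter_dir_deriv vs (\<lambda>x. rescaled w Y t j x $ l) 0) \<longlongrightarrow> iter_dir_deriv vs (\<lambda>x. M j x $ l) 0) (at 0)" for vs
      unfolding iter_dir_deriv_nth[OF open_UNIV M UNIV_I]
        iter_dir_deriv_nth[OF open_U[unfolded U_def] smooth_rescaled zero_U[unfolded U_def]]
      by (intro tendsto_vec_nth is_model_field_tendsto m)
  qed
  have "jlim (\<lambda>t. frame_apply (rescaled w Y t) J (\<lambda>x. x $ k)) (frame_apply M J (\<lambda>x. x $ k))" for J
  proof (induction J)
    case Nil
    then show ?case by (simp add: jlim_def s open_U)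
  next
    case (Cons i J)
    let ?G = "\<lambda>t. frame_apply (rescaled w Y t) J (\<lambda>x. x $ k)" and ?g = "frame_apply M J (\<lambda>x. x $ k)"
    let ?H = "\<lambda>t x. \<Sum>l\<in>UNIV. rescaled w Y t i x $ l * dird (axis l 1) (?G t) x"
    let ?h = "\<lambda>x. \<Sum>l\<in>UNIV. M i x $ l * dird (axis l 1) ?g x"
    have H: "jlim ?H ?h" by (intro jlim_sum jlim_mult coeff jlim_dird Cons.IH)
    have G: "smooth_on (U t) (?G t)" "smooth_on UNIV ?g" for t using Cons.IH by (auto simp: jlim_def)
    show ?case
      unfolding frame_apply_Cons
    proof (rule jlim_cong[OF H])
      fix t x assume "x \<in> U t"
      from dird_expand[OF smooth_on_differentiable[OF G(1) this], of "rescaled w Y t i x"]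
      show "vf_apply (rescaled w Y t i) (?G t) x = ?H t x" by (simp add: vf_apply_eq_dird)
    next
      fix x
      from dird_expand[OF smooth_on_differentiable[OF G(2) UNIV_I], of "M i x"]
      show "vf_apply (M i) ?g x = ?h x" by (simp add: vf_apply_eq_dird)
    qed
  qed
  from jlim_tendsto[OF this[of I], of "[]"]
  have "((\<lambda>t. frame_apply (rescaled w Y t) I (\<lambda>x. x $ k) 0) \<longlongrightarrow> frame_apply M I (\<lambda>x. x $ k) 0) (at 0)"
    by simp
  moreover have "\<forall>\<^sub>F t in at 0. frame_apply (rescaled w Y t) I (\<lambda>x. x $ k) 0 = frame_apply Y I (\<lambda>x. x $ k) 0"
    using frame_apply_rescaled_coord[OF _ S0 I] by (intro eventually_at_topological[THEN iffD2] exI[of _ UNIV]) auto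
  ultimately have "((\<lambda>t. frame_apply Y I (\<lambda>x. x $ k) 0) \<longlongrightarrow> frame_apply M I (\<lambda>x. x $ k) 0) (at (0::real))"
    by (rule Lim_transform_eventually)
  then show ?thesis by (rule tendsto_unique[OF trivial_limit_at tendsto_const])
qed

section \<open>Frames in privileged coordinates\<close>

locale privileged_frame = adapted_hframe S Z w L
  for S :: "(real ^ 'n::finite) set" and Z :: "'n \<Rightarrow> 'n vfield" and w L +
  assumes coord_order: "\<And>k. order_ge w Z (\<lambda>x. x $ k) 0 (w k)"
begin

lemma order_ge_flat: "smooth_on S f \<Longrightarrow> flat m f \<Longrightarrow> order_ge w Z f 0 m"
  unfolding order_ge_def using frame_apply_flat(1)[of f m] length_le_weight le_less_trans by blast

lemma order_ge_one: "order_ge w Z f 0 0"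
  by (simp add: order_ge_def)

lemma order_ge_power: "smooth_on S f \<Longrightarrow> order_ge w Z f 0 N \<Longrightarrow> order_ge w Z (\<lambda>x. f x ^ n) 0 (N * n)"
proof (induction n)
  case (Suc n)
  then show ?case
    using order_ge_mult[OF Suc.prems(1) smooth_on_power[OF open_S Suc.prems(1), of n] zero_S Suc.prems(2), of "N * n"]
    by simp
qed (simp add: order_ge_one)

lemma order_ge_prod:
  "finite K \<Longrightarrow> (\<And>k. k \<in> K \<Longrightarrow> smooth_on S (f k)) \<Longrightarrow> (\<And>k. k \<in> K \<Longrightarrow> order_ge w Z (f k) 0 (N k)) \<Longrightarrow>
    order_ge w Z (\<lambda>x. \<Prod>k\<in>K. f k x) 0 (\<Sum>k\<in>K. N k)"
proof (induction K rule: finite_induct)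
  case (insert k K)
  have "smooth_on S (\<lambda>x. \<Prod>k\<in>K. f k x)" by (rule smooth_on_prod[OF open_S]) (use insert in auto)
  from order_ge_mult[OF _ this zero_S, of "f k" w "N k" "\<Sum>k\<in>K. N k"] insert show ?case by simp
qed (simp add: order_ge_one)

lemma order_ge_monomial: "order_ge w Z (monomial \<alpha>) 0 (multi_weight w \<alpha>)"
  unfolding monomial_def[abs_def] multi_weight_def
  by (intro order_ge_prod order_ge_power smooth_on_power smooth_on_nth smooth_on_id open_S coord_order finite)

text \<open>In privileged coordinates a monomial has order at least its weight. Subtracting from
  \<open>f\<close> a Taylor remainder and the monomials of weight at least \<open>N\<close> leaves a
  polynomial of weight below \<open>N\<close> and order at least \<open>N\<close>, whose
  coefficients vanish.\<close>

lemma tcoeff_eq_0: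
  assumes f: "smooth_on S f" and o: "order_ge w Z f 0 N" and \<alpha>: "multi_weight w \<alpha> < N"
  shows "tcoeff f \<alpha> = 0"
proof -
  let ?A = "{\<alpha>. multi_weight w \<alpha> < N}" and ?D = "{\<alpha> :: 'n \<Rightarrow> nat. multi_degree \<alpha> \<le> N}"
  have finA: "finite ?A" by (rule finite_subset[OF _ finite_multi_weight_le[of w N, OF w_pos]]) auto
  have AD: "?A \<subseteq> ?D"
  proof
    fix \<alpha> assume "\<alpha> \<in> ?A"
    then show "\<alpha> \<in> ?D" using multi_degree_le_weight[of w \<alpha>, OF w_pos] by simp
  qed
  let ?q = "\<lambda>x. \<Sum>\<alpha>\<in>?A. tcoeff f \<alpha> * monomial \<alpha> x"
  let ?p = "\<lambda>x. \<Sum>\<alpha>\<in>?D - ?A. tcoeff f \<alpha> * monomial \<alpha> x"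
  have sp: "smooth_on S ?p" by (rule smooth_poly[OF open_S])
  have sr: "smooth_on S (\<lambda>x. f x - taylor N f x)" by (intro smooth_on_diff f smooth_taylor open_S)
  have "order_ge w Z (\<lambda>x. f x - taylor N f x) 0 N"
    by (rule order_ge_mono[OF order_ge_flat[OF sr flat_taylor_remainder[OF open_S zero_S f]]]) simp
  moreover have "order_ge w Z ?p 0 N"
    by (intro order_ge_sum order_ge_cmult smooth_on_mult smooth_on_const smooth_monomial open_S zero_S
        order_ge_mono[OF order_ge_monomial]) auto
  ultimately have "order_ge w Z (\<lambda>x. f x - (f x - taylor N f x) - ?p x) 0 N"
    by (intro order_ge_diff[OF smooth_on_diff[OF open_S f sr] sp zero_S] order_ge_diff[OF f sr zero_S] o)
  moreover have "(\<lambda>x. f x - (f x - taylor N f x) - ?p x) = ?q"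
  proof
    fix x
    show "f x - (f x - taylor N f x) - ?p x = ?q x"
      unfolding taylor_def
      using sum.subset_diff[OF AD finite_multi_degree_le, of "\<lambda>\<alpha>. tcoeff f \<alpha> * monomial \<alpha> x"] by linarith
  qed
  ultimately have "order_ge w Z ?q 0 N" by (simp only:)
  from poly_coeffs_eq_0[OF finA _ this] \<alpha> show ?thesis by simp
qed

definition model :: "'n \<Rightarrow> 'n vfield" where
  "model j = (\<lambda>x. \<chi> k. homog w (w j) (w k) (\<lambda>x. Z j x $ k) x)"

lemma model_nth: "model j x $ k = homog w (w j) (w k) (\<lambda>x. Z j x $ k) x"
  by (simp add: model_def)

lemma smooth_model: "smooth_on T (model j)" 
  by (rule smooth_on_subset[OF smooth_on_vec[OF open_UNIV]]) (simp_all add: model_nth smooth_homog)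

text \<open>The component \<open>k\<close> of \<open>Z j\<close> is \<open>Z j\<close> applied to
  the coordinate \<open>k\<close>, which lowers the order \<open>w k\<close> by at most
  \<open>w j\<close>.\<close>

lemma coeff_vanish: "multi_weight w \<alpha> + w j < w k \<Longrightarrow> tcoeff (\<lambda>x. Z j x $ k) \<alpha> = 0"
proof (rule tcoeff_eq_0)
  show "smooth_on S (\<lambda>x. Z j x $ k)" by (rule smooth_on_nth[OF open_S smooth_Y])
  show "order_ge w Z (\<lambda>x. Z j x $ k) 0 (w k - w j)"
    using order_ge_vf_apply[OF coord_order, of j k] by (simp only: vf_apply_nth)
qed simp

text \<open>\<open>X\<close> is compared with \<open>Z j\<close> on \<open>S\<close> only, because a
  pushforward carries no meaning off the image of its domain; the dilations bring every compact set
  into \<open>S\<close> eventually.\<close>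

lemma is_model_field_model:
  assumes X: "\<And>y. y \<in> S \<Longrightarrow> X y = Z j y"
  shows "is_model_field w j X (model j)"
  unfolding is_model_field_def
proof (intro allI impI)
  fix vs and K :: "(real ^ 'n) set" assume "compact K"
  then have K: "bounded K" by (rule compact_imp_bounded)
  have "uniform_limit K (\<lambda>t. iter_dir_deriv vs (rescaled w Z t j)) (iter_dir_deriv vs (model j)) (at 0)"
  proof (rule uniform_limit_vec)
    fix k
    have "uniform_limit K (\<lambda>t. iter_dir_deriv vs (\<lambda>x. t ^ w j * (Z j (dilation w t x) $ k / t ^ w k)))
      (iter_dir_deriv vs (homog w (w j) (w k) (\<lambda>x. Z j x $ k))) (at 0)"
      by (rule uniform_limit_homog_derivs[where w = w, OF w_pos open_S zero_S smooth_on_nth[OF open_S smooth_Y] K coeff_vanish])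
    moreover have "\<forall>\<^sub>F t in at 0. \<forall>x\<in>K. iter_dir_deriv vs (\<lambda>x. t ^ w j * (Z j (dilation w t x) $ k / t ^ w k)) x
        = iter_dir_deriv vs (rescaled w Z t j) x $ k"
      using eventually_dilation_in[where w = w, OF w_pos open_S zero_S K]
    proof (rule eventually_mono, intro ballI)
      fix t x assume "t \<noteq> 0 \<and> (\<forall>x\<in>K. dilation w t x \<in> S)" "x \<in> K"
      then have "x \<in> dilation w t -` S" by simp
      from iter_dir_deriv_nth[OF open_dilation_vimage[OF open_S] smooth_rescaled this, of vs j k]
      show "iter_dir_deriv vs (\<lambda>x. t ^ w j * (Z j (dilation w t x) $ k / t ^ w k)) x
        = iter_dir_deriv vs (rescaled w Z t j) x $ k" by (simp only: rescaled_nth)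
    qed
    moreover have "iter_dir_deriv vs (homog w (w j) (w k) (\<lambda>x. Z j x $ k)) x = iter_dir_deriv vs (model j) x $ k" for x
      using iter_dir_deriv_nth[OF open_UNIV smooth_model UNIV_I, of vs j k x] by (simp only: model_nth)
    ultimately show "uniform_limit K (\<lambda>t x. iter_dir_deriv vs (rescaled w Z t j) x $ k) (\<lambda>x. iter_dir_deriv vs (model j) x $ k) (at 0)"
      by (rule uniform_limit_transform)
  qed
  moreover have "\<forall>\<^sub>F t in at 0. \<forall>x\<in>K. iter_dir_deriv vs (\<lambda>x. t ^ w j *\<^sub>R dilation_pullback w t X x) x
     = iter_dir_deriv vs (rescaled w Z t j) x"
    using eventually_dilation_in[where w = w, OF w_pos open_S zero_S K]
  proof (rule eventually_mono, intro ballI)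
    fix t x assume "t \<noteq> 0 \<and> (\<forall>x\<in>K. dilation w t x \<in> S)" "x \<in> K"
    then have x: "x \<in> dilation w t -` S" by simp
    show "iter_dir_deriv vs (\<lambda>x. t ^ w j *\<^sub>R dilation_pullback w t X x) x = iter_dir_deriv vs (rescaled w Z t j) x"
      by (rule iter_dir_deriv_cong_open[OF open_dilation_vimage[OF open_S] x])
        (simp add: rescaled_def dilation_pullback_def X)
  qed
  ultimately show "uniform_limit K (\<lambda>t. iter_dir_deriv vs (\<lambda>x. t ^ w j *\<^sub>R dilation_pullback w t X x)) (iter_dir_deriv vs (model j)) (at 0)"
    by (auto elim!: uniform_limit_transform elim: eventually_mono)
qed

lemma model_tendsto:
  "((\<lambda>t. iter_dir_deriv vs (rescaled w Z t j) x) \<longlongrightarrow> iter_dir_deriv vs (model j) x) (at 0)"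
  by (rule is_model_field_tendsto[OF is_model_field_model]) (rule refl)

lemma model_in_polys: "(\<lambda>x. model j x $ k) \<in> polys {\<alpha>. multi_weight w \<alpha> + w j = w k}"
  unfolding model_nth homog_def by (rule polysI) (rule refl)

lemma model_0: "model j 0 = axis j 1"
proof -
  have "((\<lambda>t. rescaled w Z t j 0) \<longlongrightarrow> model j 0) (at 0)"
    using model_tendsto[of "[]" j 0] by simp
  moreover have "\<forall>\<^sub>F t in at 0. rescaled w Z t j 0 = axis j 1"
    by (intro eventually_at_topological[THEN iffD2] exI[of _ UNIV])
      (auto simp: vec_eq_iff rescaled_nth Z_0 axis_def)
  ultimately have "((\<lambda>t. axis j 1) \<longlongrightarrow> model j 0) (at (0::real))"
    by (rule Lim_transform_eventually)
  from tendsto_unique[OF trivial_limit_at tendsto_const this] show ?thesis by simp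
qed

lemma rescaled_bracket:
  assumes t: "t \<noteq> 0" and x: "dilation w t x \<in> S"
  shows "vf_bracket (rescaled w Z t i) (rescaled w Z t j) x
    = (\<Sum>l\<in>UNIV. (t ^ (w i + w j) / t ^ w l * L i j l (dilation w t x)) *\<^sub>R rescaled w Z t l x)"
proof -
  let ?y = "dilation w t x"
  have d: "dird (rescaled w Z t i x) (rescaled w Z t j) x $ k
     = t ^ (w i + w j) / t ^ w k * dird (Z i ?y) (Z j) ?y $ k" for i j k
  proof -
    have dx: "rescaled w Z t j differentiable at x"
      by (rule smooth_on_differentiable[OF smooth_rescaled]) (use x in simp)
    have dy: "(\<lambda>x. Z j x $ k) differentiable at ?y"
      by (rule smooth_on_differentiable[OF smooth_on_nth[OF open_S smooth_Y] x])
    have dz: "(\<lambda>x. Z j (dilation w t x) $ k) differentiable at x"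
      by (rule smooth_on_differentiable[OF smooth_on_dilation[OF open_S smooth_on_nth[OF open_S smooth_Y]]]) (use x in simp)
    have "dird (rescaled w Z t i x) (rescaled w Z t j) x $ k
       = dird (rescaled w Z t i x) (\<lambda>x. (t ^ w j / t ^ w k) * (Z j (dilation w t x) $ k)) x"
      using dird_nth[OF dx, of "rescaled w Z t i x" k] by (simp add: rescaled_nth)
    also have "\<dots> = (t ^ w j / t ^ w k) * dird (t ^ w i *\<^sub>R Z i ?y) (\<lambda>x. Z j x $ k) ?y"
      unfolding dird_cmult[OF dz] dird_dilation[where f = "\<lambda>x. Z j x $ k", OF dy] dilation_rescaled[OF t] ..
    also have "\<dots> = (t ^ w j / t ^ w k) * (t ^ w i * dird (Z i ?y) (\<lambda>x. Z j x $ k) ?y)"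
      using linear_scale[OF linear_dird[OF dy]] by simp
    also have "\<dots> = t ^ (w i + w j) / t ^ w k * dird (Z i ?y) (Z j) ?y $ k"
      using dird_nth[OF smooth_on_differentiable[OF smooth_Y x]] by (simp add: power_add mult_ac)
    finally show ?thesis .
  qed
  have "vf_bracket (rescaled w Z t i) (rescaled w Z t j) x $ k
     = (\<Sum>l\<in>UNIV. (t ^ (w i + w j) / t ^ w l * L i j l ?y) *\<^sub>R rescaled w Z t l x) $ k" for k
  proof -
    have "vf_bracket (rescaled w Z t i) (rescaled w Z t j) x $ k = t ^ (w i + w j) / t ^ w k * vf_bracket (Z i) (Z j) ?y $ k"
      unfolding vf_bracket_eq_dird by (simp add: d add.commute right_diff_distrib)
    also have "\<dots> = (\<Sum>l\<in>UNIV. t ^ (w i + w j) / t ^ w k * (L i j l ?y * Z l ?y $ k))"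
      unfolding bracket[OF x] by (simp add: sum_distrib_left)
    also have "\<dots> = (\<Sum>l\<in>UNIV. (t ^ (w i + w j) / t ^ w l * L i j l ?y) * rescaled w Z t l x $ k)"
      by (rule sum.cong) (use t in \<open>simp_all add: rescaled_nth field_simps\<close>)
    finally show ?thesis by simp
  qed
  then show ?thesis by (simp add: vec_eq_iff)
qed

text \<open>The limit of the bracket relations of the rescaled frame. The coefficient of a field of
  weight \<open>w l\<close> carries t to the power w i + w j - w l: it tends to 0 for smaller
  \<open>w l\<close>, is already 0 for larger \<open>w l\<close>, and tends to its value at 0 in the
  case of equality.\<close>

lemma model_bracket_eq:
  "vf_bracket (model i) (model j) x
    = (\<Sum>l\<in>UNIV. (if w l = w i + w j then L i j l 0 else 0) *\<^sub>R model l x)"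
proof -
  have lim0: "((\<lambda>t. rescaled w Z t j x) \<longlongrightarrow> model j x) (at 0)" for j
    using model_tendsto[of "[]" j x] by simp
  have lim1: "((\<lambda>t. dird v (rescaled w Z t j) x) \<longlongrightarrow> dird v (model j) x) (at 0)" for v j
    using model_tendsto[of "[v]" j x] by (simp add: iter_dir_deriv_Cons)
  have ev: "\<forall>\<^sub>F t in at 0. t \<noteq> 0 \<and> (\<forall>y\<in>{x}. dilation w t y \<in> S)"
    by (rule eventually_dilation_in[where w = w, OF w_pos open_S zero_S]) simp
  have lim2: "((\<lambda>t. dird (rescaled w Z t i x) (rescaled w Z t j) x) \<longlongrightarrow> dird (model i x) (model j) x) (at 0)" for i j
  proof -
    have "((\<lambda>t. \<Sum>m\<in>UNIV. rescaled w Z t i x $ m *\<^sub>R dird (axis m 1) (rescaled w Z t j) x)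
       \<longlongrightarrow> (\<Sum>m\<in>UNIV. model i x $ m *\<^sub>R dird (axis m 1) (model j) x)) (at 0)"
      by (intro tendsto_sum tendsto_scaleR tendsto_vec_nth lim0 lim1)
    moreover have "\<forall>\<^sub>F t in at 0. (\<Sum>m\<in>UNIV. rescaled w Z t i x $ m *\<^sub>R dird (axis m 1) (rescaled w Z t j) x)
        = dird (rescaled w Z t i x) (rescaled w Z t j) x"
      using ev
    proof (rule eventually_mono)
      fix t assume "t \<noteq> 0 \<and> (\<forall>y\<in>{x}. dilation w t y \<in> S)"
      then have "rescaled w Z t j differentiable at x"
        by (intro smooth_on_differentiable[OF smooth_rescaled]) simp
      from dird_expand[OF this, of "rescaled w Z t i x"]
      show "(\<Sum>m\<in>UNIV. rescaled w Z t i x $ m *\<^sub>R dird (axis m 1) (rescaled w Z t j) x)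
        = dird (rescaled w Z t i x) (rescaled w Z t j) x" by simp
    qed
    ultimately have "((\<lambda>t. dird (rescaled w Z t i x) (rescaled w Z t j) x)
        \<longlongrightarrow> (\<Sum>m\<in>UNIV. model i x $ m *\<^sub>R dird (axis m 1) (model j) x)) (at 0)"
      by (rule Lim_transform_eventually)
    then show ?thesis
      using dird_expand[OF smooth_on_differentiable[OF smooth_model UNIV_I], of "model i x" j x] by simp
  qed
  have "((\<lambda>t. vf_bracket (rescaled w Z t i) (rescaled w Z t j) x) \<longlongrightarrow> vf_bracket (model i) (model j) x) (at 0)"
    unfolding vf_bracket_eq_dird by (intro tendsto_diff lim2)
  moreover have "\<forall>\<^sub>F t in at 0. vf_bracket (rescaled w Z t i) (rescaled w Z t j) x
     = (\<Sum>l\<in>UNIV. (t ^ (w i + w j) / t ^ w l * L i j l (dilation w t x)) *\<^sub>R rescaled w Z t l x)"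
    using ev by (rule eventually_mono) (rule rescaled_bracket; simp)
  ultimately have "((\<lambda>t. \<Sum>l\<in>UNIV. (t ^ (w i + w j) / t ^ w l * L i j l (dilation w t x)) *\<^sub>R rescaled w Z t l x)
      \<longlongrightarrow> vf_bracket (model i) (model j) x) (at 0)"
    by (rule Lim_transform_eventually)
  moreover have "((\<lambda>t. \<Sum>l\<in>UNIV. (t ^ (w i + w j) / t ^ w l * L i j l (dilation w t x)) *\<^sub>R rescaled w Z t l x)
      \<longlongrightarrow> (\<Sum>l\<in>UNIV. (if w l = w i + w j then L i j l 0 else 0) *\<^sub>R model l x)) (at 0)"
  proof (intro tendsto_sum tendsto_scaleR lim0)
    fix l
    show "((\<lambda>t. t ^ (w i + w j) / t ^ w l * L i j l (dilation w t x)) \<longlongrightarrow>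
       (if w l = w i + w j then L i j l 0 else 0)) (at 0)"
    proof (cases "w i + w j < w l")
      case True
      have "\<forall>\<^sub>F t in at 0. 0 = t ^ (w i + w j) / t ^ w l * L i j l (dilation w t x)"
        using ev by (rule eventually_mono) (use L_eq_0 True in auto)
      from Lim_transform_eventually[OF tendsto_const this] True show ?thesis by auto
    next
      case False
      have "continuous_on S (L i j l)" by (rule smooth_on_continuous[OF smooth_L])
      then have "isCont (L i j l) 0" using continuous_on_eq_continuous_at[OF open_S] zero_S by blast
      moreover have "((\<lambda>t. dilation w t x) \<longlongrightarrow> 0) (at 0)"
      proof (rule vec_tendstoI)
        fix k
        have "((\<lambda>t. t ^ w k * x $ k) \<longlongrightarrow> (0::real) ^ w k * x $ k) (at 0)" by (intro tendsto_intros)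
        then show "((\<lambda>t. dilation w t x $ k) \<longlongrightarrow> 0 $ k) (at 0)" using w_pos[of k] by (simp add: zero_power)
      qed
      ultimately have "((\<lambda>t. L i j l (dilation w t x)) \<longlongrightarrow> L i j l 0) (at 0)"
        by (rule isCont_tendsto_compose)
      from tendsto_eq_rhs[OF tendsto_mult[OF tendsto_power_quotient[of "w l" "w i + w j"] this]] False
      show ?thesis by auto
    qed
  qed
  ultimately show ?thesis by (rule tendsto_unique[OF trivial_limit_at])
qed

end

section \<open>Exponential coordinates of a graded frame\<close>

lemma dird_monomial_euler: "dird x (monomial \<alpha>) x = multi_degree \<alpha> * monomial \<alpha> x"
proof -
  have "dird x (monomial \<alpha>) x = (\<Sum>l\<in>UNIV. x $ l * (\<alpha> l * monomial (\<alpha>(l := \<alpha> l - 1)) x))"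
    using dird_expand[OF smooth_on_differentiable[OF smooth_monomial[OF open_UNIV] UNIV_I], of x \<alpha> x]
    by (simp add: dird_monomial)
  also have "\<dots> = (\<Sum>l\<in>UNIV. \<alpha> l * monomial \<alpha> x)"
  proof (rule sum.cong[OF refl])
    fix l
    have "monomial \<alpha> x = monomial (single l) x * monomial (\<alpha>(l := \<alpha> l - 1)) x" if "\<alpha> l \<noteq> 0"
    proof -
      have "\<alpha> = (\<lambda>j. single l j + (\<alpha>(l := \<alpha> l - 1)) j)" using that by (auto simp: single_def fun_eq_iff)
      then show ?thesis by (metis monomial_add)
    qed
    then show "x $ l * (\<alpha> l * monomial (\<alpha>(l := \<alpha> l - 1)) x) = \<alpha> l * monomial \<alpha> x"
      by (cases "\<alpha> l = 0") (simp_all add: monomial_single)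
  qed
  finally show ?thesis by (simp add: multi_degree_def sum_distrib_right)
qed

text \<open>By Euler's identity, radial differentiation multiplies a monomial by its degree;
  dividing the coefficients by the degree inverts this when constants are excluded.\<close>

lemma radial_antiderivative:
  assumes f: "f \<in> polys A" and "finite A" and pos: "\<And>\<alpha>. \<alpha> \<in> A \<Longrightarrow> 0 < multi_degree \<alpha>"
  shows "\<exists>g \<in> polys A. \<forall>x. dird x g x = f x"
proof -
  obtain c where c: "f = (\<lambda>x. \<Sum>\<alpha>\<in>A. c \<alpha> * monomial \<alpha> x)" using f by (rule polysE)
  define g where "g = (\<lambda>x. \<Sum>\<alpha>\<in>A. c \<alpha> / multi_degree \<alpha> * monomial \<alpha> x)"
  have dm: "monomial \<alpha> differentiable at x" for \<alpha> x
    by (rule smooth_on_differentiable[OF smooth_monomial[OF open_UNIV] UNIV_I])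
  have "dird x g x = f x" for x
  proof -
    have "dird x g x = (\<Sum>\<alpha>\<in>A. dird x (\<lambda>x. c \<alpha> / multi_degree \<alpha> * monomial \<alpha> x) x)"
      unfolding g_def
      by (rule dird_sum, rule smooth_on_differentiable[OF smooth_on_mult[OF open_UNIV smooth_on_const smooth_monomial[OF open_UNIV]] UNIV_I])
    also have "\<dots> = f x"
      unfolding c dird_cmult[OF dm] dird_monomial_euler
    proof (rule sum.cong[OF refl])
      fix \<alpha> assume "\<alpha> \<in> A"
      then have "real (multi_degree \<alpha>) \<noteq> 0" using pos by simp
      then show "c \<alpha> / multi_degree \<alpha> * (multi_degree \<alpha> * monomial \<alpha> x) = c \<alpha> * monomial \<alpha> x" by simp
    qed
    finally show ?thesis .
  qed
  moreover have "g \<in> polys A" by (rule polysI, rule g_def)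
  ultimately show ?thesis by blast
qed

lemma dird_commute_vec:
  fixes f :: "'a::real_normed_vector \<Rightarrow> real ^ 'n"
  assumes "open S" "x \<in> S" "smooth_on S f"
  shows "dird u (dird v f) x = dird v (dird u f) x"
proof -
  have "dird u (dird v f) x $ k = dird v (dird u f) x $ k" for k
    using iter_dir_deriv_nth[OF assms(1,3,2), of "[u, v]" k] iter_dir_deriv_nth[OF assms(1,3,2), of "[v, u]" k]
      dird_commute[OF assms(1,2) smooth_on_nth[OF assms(1,3)], of u v k]
    by (simp add: iter_dir_deriv_Cons)
  then show ?thesis by (simp add: vec_eq_iff)
qed

section \<open>The graded bracket and its nilpotency\<close>

definition graded_bracket ::
  "('n::finite \<Rightarrow> nat) \<Rightarrow> ('n \<Rightarrow> 'n \<Rightarrow> 'n \<Rightarrow> real) \<Rightarrow> real ^ 'n \<Rightarrow> real ^ 'n \<Rightarrow> real ^ 'n" where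
  "graded_bracket w c x y =
     (\<chi> k. \<Sum>i\<in>UNIV. \<Sum>j\<in>UNIV. if w k = w i + w j then x $ i * y $ j * c i j k else 0)"

lemma graded_bracket_nth:
  "graded_bracket w c x y $ k = (\<Sum>i\<in>UNIV. \<Sum>j\<in>UNIV. if w k = w i + w j then x $ i * y $ j * c i j k else 0)"
  by (simp add: graded_bracket_def)

lemma bilinear_graded_bracket: "bilinear (graded_bracket w c)"
  unfolding bilinear_def
proof (intro conjI allI)
  fix x show "linear (graded_bracket w c x)"
    by (rule linearI)
      (simp_all add: vec_eq_iff graded_bracket_nth sum.distrib[symmetric] sum_distrib_left
        if_distrib[of "\<lambda>z. _ * z"] algebra_simps cong: if_cong, (intro allI sum.cong; simp add: algebra_simps)+)
next
  fix y show "linear (\<lambda>x. graded_bracket w c x y)"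
    by (rule linearI)
      (simp_all add: vec_eq_iff graded_bracket_nth sum.distrib[symmetric] sum_distrib_left
        if_distrib[of "\<lambda>z. _ * z"] algebra_simps cong: if_cong, (intro allI sum.cong; simp add: algebra_simps)+)
qed

lemma graded_bracket_lower:
  assumes "\<And>j. 0 < w j" "\<And>l. w l < w k \<Longrightarrow> y $ l = 0"
  shows "graded_bracket w c x y $ k = 0"
  unfolding graded_bracket_nth
  by (intro sum.neutral ballI) (use assms in \<open>auto simp: less_add_same_cancel2\<close>)

text \<open>Weights are at least 1, so each bracket with \<open>x\<close> raises the lowest weight
  present in \<open>y\<close> by at least 1.\<close>

lemma graded_bracket_pow_nth:
  assumes w: "\<And>j. 0 < w j" and "\<And>l. w l < N \<Longrightarrow> y $ l = 0" and "w k < N + m"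
  shows "(graded_bracket w c x ^^ m) y $ k = 0"
  using assms(3)
proof (induction m arbitrary: k)
  case (Suc m)
  show ?case unfolding funpow.simps comp_def
    by (rule graded_bracket_lower[where w = w, OF w]) (use Suc in simp)
qed (use assms in simp)

lemma graded_bracket_pow_eq_0:
  assumes w: "\<And>j. 0 < w j" and "\<And>j. w j \<le> r" "r \<le> m"
  shows "(graded_bracket w c x ^^ m) y = 0"
proof -
  have "(graded_bracket w c x ^^ m) y $ k = 0" for k
  proof (rule graded_bracket_pow_nth[where N = 1])
    show "w k < 1 + m" using assms(2)[of k] assms(3) by simp
    fix l assume "w l < 1" then show "y $ l = 0" using w[of l] by simp
  qed (rule w)
  then show ?thesis by (simp add: vec_eq_iff)
qed

lemma linear_graded_bracket_pow: "linear (graded_bracket w c x ^^ m)"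
proof (induction m)
  case (Suc m)
  have "linear (graded_bracket w c x)" using bilinear_graded_bracket unfolding bilinear_def by blast
  then show ?case using linear_compose[OF Suc] by (simp add: comp_def)
qed (simp add: id_def linear_id[unfolded id_def])

text \<open>\<open>b\<close> is the coefficient sequence of the power series \<open>F = z / (1 - exp (-z))\<close>, the solution of
  \<open>z F' = F + z F - F\<^sup>2\<close> with \<open>F(0) = 1\<close>.\<close>

definition riccati :: "(nat \<Rightarrow> real) \<Rightarrow> bool" where
  "riccati b \<longleftrightarrow> b 0 = 1 \<and>
     (\<forall>m. real m * b m = b m + (if m = 0 then 0 else b (m - 1)) - (\<Sum>i\<le>m. b i * b (m - i)))"

locale graded_frame =
  fixes w :: "'n::finite \<Rightarrow> nat" and M :: "'n \<Rightarrow> 'n vfield" and c :: "'n \<Rightarrow> 'n \<Rightarrow> 'n \<Rightarrow> real"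
  assumes w_pos: "\<And>j. 0 < w j"
    and M_polys: "\<And>j k. (\<lambda>x. M j x $ k) \<in> polys {\<alpha>. multi_weight w \<alpha> + w j = w k}"
    and M_0: "\<And>j. M j 0 = axis j 1"
    and M_bracket: "\<And>i j x. vf_bracket (M i) (M j) x
      = (\<Sum>l\<in>UNIV. (if w l = w i + w j then c i j l else 0) *\<^sub>R M l x)"
begin

sublocale gr: weight_grading w "eq_exps w"
  by (rule weight_grading_eq) (rule w_pos)

text \<open>A monomial of weight \<open>w k - w j\<close> can only contain coordinates of at most
  that weight.\<close>

lemma M_cong:
  assumes "\<And>l. w l + w j \<le> w k \<Longrightarrow> x $ l = y $ l"
  shows "M j x $ k = M j y $ k"
proof -
  obtain d where d: "(\<lambda>x. M j x $ k) = (\<lambda>x. \<Sum>\<alpha> | multi_weight w \<alpha> + w j = w k. d \<alpha> * monomial \<alpha> x)"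
    using M_polys by (rule polysE)
  have "monomial \<alpha> x = monomial \<alpha> y" if "multi_weight w \<alpha> + w j = w k" for \<alpha>
  proof (rule gr.monomial_cong_lower, rule assms)
    fix l assume "\<alpha> l \<noteq> 0"
    then have "w l \<le> w l * \<alpha> l" by simp
    also have "\<dots> \<le> multi_weight w \<alpha>" unfolding multi_weight_def by (rule member_le_sum) auto
    finally show "w l + w j \<le> w k" using that by simp
  qed
  then have "(\<Sum>\<alpha> | multi_weight w \<alpha> + w j = w k. d \<alpha> * monomial \<alpha> x)
     = (\<Sum>\<alpha> | multi_weight w \<alpha> + w j = w k. d \<alpha> * monomial \<alpha> y)" by (intro sum.cong) auto
  then show ?thesis using fun_cong[OF d, of x] fun_cong[OF d, of y] by simp
qed

lemma M_diag: "w k \<le> w j \<Longrightarrow> M j x $ k = axis j 1 $ k"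
  unfolding M_0[symmetric]
proof (rule M_cong)
  fix l assume "w k \<le> w j" "w l + w j \<le> w k"
  then show "x $ l = 0 $ l" using w_pos[of l] by simp
qed

lemma smooth_M: "smooth_on UNIV (M j)"
  by (rule smooth_on_vec[OF open_UNIV smooth_on_polys[OF M_polys open_UNIV]])

lemma M_differentiable: "M j differentiable at x"
  by (rule smooth_on_differentiable[OF smooth_M UNIV_I])

text \<open>The component \<open>k\<close> of \<open>M j\<close> does not change along axes of
  weight at least \<open>w k\<close>, so only directions of smaller weight contribute to its
  derivative.\<close>

lemma dird_M_cong:
  assumes "\<And>l. w l < w k \<Longrightarrow> u $ l = 0"
  shows "dird u (M j) x $ k = 0"
proof -
  have "dird (axis l 1) (\<lambda>x. M j x $ k) x = 0" if "\<not> w l < w k" for l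
  proof -
    have "M j (x + s *\<^sub>R axis l 1) $ k = M j x $ k" for s
      by (rule M_cong) (use that w_pos[of j] in \<open>auto simp: axis_def\<close>)
    moreover have "((\<lambda>s. M j (x + s *\<^sub>R axis l 1) $ k) has_vector_derivative dird (axis l 1) (\<lambda>x. M j x $ k) (x + 0 *\<^sub>R axis l 1)) (at 0)"
      by (rule dird_along_line)
        (rule smooth_on_differentiable[OF smooth_on_nth[OF open_UNIV smooth_M] UNIV_I])
    ultimately have "((\<lambda>s::real. M j x $ k) has_vector_derivative dird (axis l 1) (\<lambda>x. M j x $ k) x) (at 0)" by simp
    then show ?thesis using vector_derivative_unique_at[OF _ has_vector_derivative_const] by blast
  qed
  then have "u $ l *\<^sub>R dird (axis l 1) (\<lambda>x. M j x $ k) x = 0" for l using assms by (cases "w l < w k") auto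
  then have "dird u (\<lambda>x. M j x $ k) x = 0"
    unfolding dird_expand[OF smooth_on_differentiable[OF smooth_on_nth[OF open_UNIV smooth_M] UNIV_I], of u j k x]
    by (intro sum.neutral ballI)
  then show ?thesis using dird_nth[OF M_differentiable] by simp
qed

text \<open>By \<open>M_diag\<close>, among the fields of weight at least \<open>w k\<close> only
  \<open>M k\<close> has a component \<open>k\<close>, and this component is 1.\<close>

lemma M_sum_nth:
  "(\<Sum>j\<in>UNIV. x $ j *\<^sub>R M j y) $ k = x $ k + (\<Sum>j | w j < w k. x $ j * M j y $ k)"
proof -
  have "(\<Sum>j\<in>UNIV. x $ j * M j y $ k) = (\<Sum>j\<in>UNIV - {j. w j < w k}. x $ j * M j y $ k) + (\<Sum>j | w j < w k. x $ j * M j y $ k)"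
    by (rule sum.subset_diff) auto
  also have "(\<Sum>j\<in>UNIV - {j. w j < w k}. x $ j * M j y $ k) = (\<Sum>j\<in>UNIV - {j. w j < w k}. if j = k then x $ j else 0)"
    by (rule sum.cong) (auto simp: M_diag axis_def)
  also have "\<dots> = x $ k" by (subst sum.delta) auto
  finally show ?thesis by simp
qed

text \<open>The flow equations along all rays are replaced by one radial differential equation for a
  polynomial map. Apart from the term \<open>x $ k\<close>, the right-hand side of component
  \<open>k\<close> involves components of \<open>E\<close> of smaller weight only, and
  \<open>radial_antiderivative\<close> integrates it; so components are found in the order of their
  weights.\<close>

lemma exp_exists: "\<exists>E. gr.form E \<and> (\<forall>x. dird x E x = (\<Sum>j\<in>UNIV. x $ j *\<^sub>R M j (E x)))"
proof -
  have "\<exists>E. gr.form E \<and> (\<forall>k x. w k \<le> n \<longrightarrow> dird x (\<lambda>x. E x $ k) x = (\<Sum>j\<in>UNIV. x $ j *\<^sub>R M j (E x)) $ k)" for n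
  proof (induction n)
    case 0
    have "\<not> w k \<le> 0" for k using w_pos[of k] by simp
    then show ?case using gr.form_id by blast
  next
    case (Suc n)
    then obtain E where E: "gr.form E"
      "\<And>k x. w k \<le> n \<Longrightarrow> dird x (\<lambda>x. E x $ k) x = (\<Sum>j\<in>UNIV. x $ j *\<^sub>R M j (E x)) $ k" by blast
    have "\<exists>g \<in> polys (eq_exps w (w k) 2). \<forall>x. dird x g x = (\<Sum>j | w j < w k. x $ j * M j (E x) $ k)" for k
    proof (rule radial_antiderivative)
      show "(\<lambda>x. \<Sum>j | w j < w k. x $ j * M j (E x) $ k) \<in> polys (eq_exps w (w k) 2)"
      proof (rule polys_sum)
        fix j assume j: "j \<in> {j. w j < w k}"
        have "(\<lambda>x. M j x $ k) \<in> polys (eq_exps w (w k - w j) 1)"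
        proof (rule polys_mono[OF gr.finite_A _ M_polys], rule subsetI)
          fix \<alpha> assume "\<alpha> \<in> {\<alpha>. multi_weight w \<alpha> + w j = w k}"
          then have a: "multi_weight w \<alpha> = w k - w j" "multi_weight w \<alpha> \<noteq> 0" using j by auto
          then have "multi_degree \<alpha> \<noteq> 0" by (auto simp: multi_degree_eq_0_iff)
          with a show "\<alpha> \<in> eq_exps w (w k - w j) 1" by (simp add: eq_exps_def)
        qed
        from gr.polys_A_mult[OF gr.coord_in_polys gr.polys_compose[OF this gr.formD[OF E(1)]], of j] j
        show "(\<lambda>x. x $ j * M j (E x) $ k) \<in> polys (eq_exps w (w k) 2)"
          by (simp add: numeral_2_eq_2)
      qed
    qed (use gr.finite_A in \<open>auto simp: eq_exps_def\<close>)
    then obtain g where g: "\<And>k. g k \<in> polys (eq_exps w (w k) 2)"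
      "\<And>k x. dird x (g k) x = (\<Sum>j | w j < w k. x $ j * M j (E x) $ k)" by metis
    \<comment> \<open>Only the components of weight \<open>Suc n\<close> count at this stage; those
      of larger weight are provisional and are recomputed later.\<close>
    define E' where "E' = (\<lambda>x. \<chi> k. if w k \<le> n then E x $ k else x $ k + g k x)"
    have form: "gr.form E'"
      unfolding gr.form_def
    proof
      fix k
      show "(\<lambda>x. E' x $ k - x $ k) \<in> polys (eq_exps w (w k) 2)"
        using E(1) g(1)[of k] by (cases "w k \<le> n") (simp_all add: E'_def gr.form_def)
    qed
    have MEE: "M j (E' x) $ k = M j (E x) $ k" if "w k \<le> Suc n" for j k x
    proof (rule M_cong)
      fix l assume "w l + w j \<le> w k"
      then have "w l \<le> n" using that w_pos[of j] by simp
      then show "E' x $ l = E x $ l" by (simp add: E'_def)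
    qed
    have "dird x (\<lambda>x. E' x $ k) x = (\<Sum>j\<in>UNIV. x $ j *\<^sub>R M j (E' x)) $ k" if k: "w k \<le> Suc n" for k x
    proof (cases "w k \<le> n")
      case True
      then have "dird x (\<lambda>x. E' x $ k) x = dird x (\<lambda>x. E x $ k) x" by (simp add: E'_def)
      then show ?thesis using E(2)[OF True] MEE[OF k] by simp
    next
      case False
      have "dird x (\<lambda>x. E' x $ k) x = dird x (\<lambda>x. x $ k + g k x) x" using False by (simp add: E'_def)
      also have "\<dots> = x $ k + (\<Sum>j | w j < w k. x $ j * M j (E x) $ k)"
        unfolding g(2)[symmetric]
        by (subst dird_add) (auto simp: dird_bounded_linear[OF bounded_linear_vec_nth]
            intro!: bounded_linear_imp_differentiable bounded_linear_vec_nth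
              smooth_on_differentiable[OF smooth_on_polys[OF g(1) open_UNIV] UNIV_I])
      finally show ?thesis unfolding M_sum_nth MEE[OF k] .
    qed
    with form show ?case by blast
  qed
  from this[of "Max (range w)"] obtain E where E: "gr.form E"
    "\<And>k x. w k \<le> Max (range w) \<Longrightarrow> dird x (\<lambda>x. E x $ k) x = (\<Sum>j\<in>UNIV. x $ j *\<^sub>R M j (E x)) $ k" by blast
  have "dird x E x = (\<Sum>j\<in>UNIV. x $ j *\<^sub>R M j (E x))" for x
  proof -
    have "dird x E x $ k = (\<Sum>j\<in>UNIV. x $ j *\<^sub>R M j (E x)) $ k" for k
      using E(2)[of k x] dird_nth[OF smooth_on_differentiable[OF gr.smooth_form[OF E(1) open_UNIV] UNIV_I], where x = x and v = x and k = k]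
      by simp
    then show ?thesis by (simp add: vec_eq_iff)
  qed
  with E(1) show ?thesis by blast
qed

definition E :: "real ^ 'n \<Rightarrow> real ^ 'n" where
  "E = (SOME E. gr.form E \<and> (\<forall>x. dird x E x = (\<Sum>j\<in>UNIV. x $ j *\<^sub>R M j (E x))))"

lemma form_E: "gr.form E" and radial_E: "dird x E x = (\<Sum>j\<in>UNIV. x $ j *\<^sub>R M j (E x))"
  using someI_ex[OF exp_exists] unfolding E_def[symmetric] by blast+

lemma smooth_E: "smooth_on UNIV E"
  by (rule gr.smooth_form[OF form_E open_UNIV])

lemma E_differentiable: "E differentiable at x"
  by (rule smooth_on_differentiable[OF smooth_E UNIV_I])

lemma ray_E: "dird x E (s *\<^sub>R x) = (\<Sum>j\<in>UNIV. x $ j *\<^sub>R M j (E (s *\<^sub>R x)))"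
proof (cases "s = 0")
  case True
  then show ?thesis
    by (simp add: gr.dird_form_0[OF form_E] gr.form_0[OF form_E] M_0 flip: vec_eq_sum_axis)
next
  case False
  have "s *\<^sub>R dird x E (s *\<^sub>R x) = dird (s *\<^sub>R x) E (s *\<^sub>R x)"
    using linear_scale[OF linear_dird[OF E_differentiable]] by simp
  also have "\<dots> = s *\<^sub>R (\<Sum>j\<in>UNIV. x $ j *\<^sub>R M j (E (s *\<^sub>R x)))"
    unfolding radial_E by (simp add: scaleR_sum_right)
  finally show ?thesis using False by simp
qed

text \<open>By induction on the weight: once the components of smaller weight agree, component
  \<open>k\<close> of the velocity is the same along both curves, so their difference has derivative
  0 and starts at 0.\<close>

lemma flow_unique:
  assumes \<gamma>0: "\<gamma> 0 = 0"
    and \<gamma>: "\<And>t. t \<in> {0..1} \<Longrightarrow> (\<gamma> has_vector_derivative (\<Sum>j\<in>UNIV. x $ j *\<^sub>R M j (\<gamma> t))) (at t within {0..1})"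
    and t: "t \<in> {0..1}"
  shows "\<gamma> t = E (t *\<^sub>R x)"
proof -
  have "\<forall>t\<in>{0..1}. \<gamma> t $ k = E (t *\<^sub>R x) $ k" for k
  proof (induction "w k" arbitrary: k rule: less_induct)
    case less
    have "((\<lambda>t. \<gamma> t $ k - E (0 + t *\<^sub>R x) $ k) has_vector_derivative 0) (at t within {0..1})" if t: "t \<in> {0..1}" for t
    proof -
      have "((\<lambda>t. \<gamma> t $ k - E (0 + t *\<^sub>R x) $ k) has_vector_derivative
        (\<Sum>j\<in>UNIV. x $ j *\<^sub>R M j (\<gamma> t)) $ k - dird x E (0 + t *\<^sub>R x) $ k) (at t within {0..1})"
        by (intro has_vector_derivative_diff bounded_linear.has_vector_derivative[OF bounded_linear_vec_nth] \<gamma> t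
            dird_along_line E_differentiable)
      moreover have "(\<Sum>j\<in>UNIV. x $ j *\<^sub>R M j (\<gamma> t)) $ k = dird x E (0 + t *\<^sub>R x) $ k"
      proof -
        have "M j (\<gamma> t) $ k = M j (E (t *\<^sub>R x)) $ k" for j
          by (rule M_cong) (use less t w_pos[of j] in auto)
        then show ?thesis by (simp add: ray_E)
      qed
      ultimately show ?thesis by simp
    qed
    from has_vector_derivative_zero_constant[OF convex_real_interval(5) this]
    obtain d where d: "\<And>t. t \<in> {0..1} \<Longrightarrow> \<gamma> t $ k - E (0 + t *\<^sub>R x) $ k = d" by blast
    have "d = 0" using d[of 0] \<gamma>0 gr.form_0[OF form_E] by simp
    then show ?case using d by simp
  qed
  with t show ?thesis by (simp add: vec_eq_iff)
qed

lemma frame_exp_eq: "frame_exp M = E"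
proof
  fix x
  have flow: "((\<lambda>t. E (t *\<^sub>R x)) has_vector_derivative (\<Sum>j\<in>UNIV. x $ j *\<^sub>R M j (E (t *\<^sub>R x)))) (at t within {0..1})" for t
    using dird_along_line[of E 0 t x "{0..1}", OF E_differentiable] by (simp add: ray_E)
  show "frame_exp M x = E x"
    unfolding frame_exp_def
  proof (rule the_equality)
    show "\<exists>\<gamma>. \<gamma> 0 = 0 \<and> \<gamma> 1 = E x \<and>
      (\<forall>t\<in>{0..1}. (\<gamma> has_vector_derivative (\<Sum>j\<in>UNIV. x $ j *\<^sub>R M j (\<gamma> t))) (at t within {0..1}))"
      using flow gr.form_0[OF form_E] by (intro exI[of _ "\<lambda>t. E (t *\<^sub>R x)"]) auto
  next
    fix y assume "\<exists>\<gamma>. \<gamma> 0 = 0 \<and> \<gamma> 1 = y \<and>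
      (\<forall>t\<in>{0..1}. (\<gamma> has_vector_derivative (\<Sum>j\<in>UNIV. x $ j *\<^sub>R M j (\<gamma> t))) (at t within {0..1}))"
    then obtain \<gamma> where "\<gamma> 0 = 0" "\<gamma> 1 = y"
      "\<And>t. t \<in> {0..1} \<Longrightarrow> (\<gamma> has_vector_derivative (\<Sum>j\<in>UNIV. x $ j *\<^sub>R M j (\<gamma> t))) (at t within {0..1})" by blast
    then show "y = E x" using flow_unique[of \<gamma> x 1] by simp
  qed
qed

end

text \<open>Along the ray \<open>s x\<close>, let \<open>P\<close> be the frame at \<open>E (s x)\<close>, \<open>D\<close> the differential of \<open>E\<close> and
  \<open>F\<close> the power series applied to \<open>s ad x\<close>. The equation \<open>D F = P\<close> holds because the defect
  \<open>G = P - D F\<close> solves \<open>s G' = s G ad + s Q G - G F\<close>. Since \<open>ad\<close>, \<open>Q\<close> and \<open>F - 1\<close> are strictly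
  triangular with respect to the weights, this is \<open>(s G)' = 0\<close> entry by entry.\<close>

locale graded_frame_ray = graded_frame w M c
  for w :: "'n::finite \<Rightarrow> nat" and M :: "'n \<Rightarrow> 'n vfield" and c +
  fixes x :: "real ^ 'n" and b :: "nat \<Rightarrow> real" and r :: nat
  assumes b: "riccati b" and w_le: "\<And>j. w j \<le> r"
begin

abbreviation ad :: "real ^ 'n \<Rightarrow> real ^ 'n" where "ad \<equiv> graded_bracket w c x"

definition P :: "real \<Rightarrow> real ^ 'n \<Rightarrow> real ^ 'n" where
  "P s v = (\<Sum>j\<in>UNIV. v $ j *\<^sub>R M j (E (s *\<^sub>R x)))"

text \<open>The derivative, at the point of the ray, of the field whose flow is followed. By
  \<open>dird_M_cong\<close> it is strictly triangular with respect to the weights.\<close>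

definition Q :: "real \<Rightarrow> real ^ 'n \<Rightarrow> real ^ 'n" where
  "Q s u = (\<Sum>i\<in>UNIV. x $ i *\<^sub>R dird u (M i) (E (s *\<^sub>R x)))"

definition D :: "real \<Rightarrow> real ^ 'n \<Rightarrow> real ^ 'n" where
  "D s u = dird u E (s *\<^sub>R x)"

definition D' :: "real \<Rightarrow> real ^ 'n \<Rightarrow> real ^ 'n" where
  "D' s u = dird x (dird u E) (s *\<^sub>R x)"

definition F :: "real \<Rightarrow> real ^ 'n \<Rightarrow> real ^ 'n" where
  "F s v = (\<Sum>m<r. (b m * s ^ m) *\<^sub>R (ad ^^ m) v)"

definition F' :: "real \<Rightarrow> real ^ 'n \<Rightarrow> real ^ 'n" where
  "F' s v = (\<Sum>m<r. (b m * (real m * s ^ (m - 1))) *\<^sub>R (ad ^^ m) v)"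

lemma linear_P: "linear (P s)"
  by (rule linearI) (simp_all add: P_def scaleR_add_left sum.distrib scaleR_sum_right)

lemma linear_Q: "linear (Q s)"
proof (rule linearI)
  fix u v show "Q s (u + v) = Q s u + Q s v"
    by (simp add: Q_def linear_add[OF linear_dird[OF M_differentiable]] scaleR_add_right sum.distrib)
next
  fix a u show "Q s (a *\<^sub>R u) = a *\<^sub>R Q s u"
    by (simp add: Q_def linear_scale[OF linear_dird[OF M_differentiable]] scaleR_sum_right mult.commute)
qed

lemma linear_D: "linear (D s)"
  unfolding D_def by (rule linear_dird[OF E_differentiable])

lemma linear_F: "linear (F s)"
  unfolding F_def by (intro linear_compose_sum ballI linear_compose_scale_right linear_graded_bracket_pow)

text \<open>Differentiating \<open>M j\<close> along the field x_1 M_1 + ... + x_n M_n is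
  differentiating that field along \<open>M j\<close>, plus a bracket. The bracket relations turn
  the bracket part into \<open>P s (ad v)\<close>; the rest is \<open>Q s (P s v)\<close>.\<close>

lemma P_deriv: "((\<lambda>s. P s v) has_vector_derivative (P s (ad v) + Q s (P s v))) (at s)"
proof -
  let ?z = "E (s *\<^sub>R x)"
  have "((\<lambda>s. \<Sum>j\<in>UNIV. v $ j *\<^sub>R M j (E (0 + s *\<^sub>R x))) has_vector_derivative
      (\<Sum>j\<in>UNIV. v $ j *\<^sub>R dird x (\<lambda>y. M j (E y)) (0 + s *\<^sub>R x))) (at s)"
    by (intro has_vector_derivative_sum bounded_linear.has_vector_derivative[OF bounded_linear_scaleR_right] dird_along_line
        smooth_on_differentiable[OF smooth_on_compose[OF open_UNIV _ smooth_M smooth_E]]) auto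
  moreover have "(\<Sum>j\<in>UNIV. v $ j *\<^sub>R dird x (\<lambda>y. M j (E y)) (0 + s *\<^sub>R x)) = P s (ad v) + Q s (P s v)"
  proof -
    have "dird x (\<lambda>y. M j (E y)) (s *\<^sub>R x) = (\<Sum>i\<in>UNIV. x $ i *\<^sub>R (vf_bracket (M i) (M j) ?z + dird (M j ?z) (M i) ?z))" for j
      unfolding dird_compose[OF E_differentiable M_differentiable] ray_E vf_bracket_eq_dird
      by (simp add: linear_sum[OF linear_dird[OF M_differentiable]] linear_scale[OF linear_dird[OF M_differentiable]])
    then have "(\<Sum>j\<in>UNIV. v $ j *\<^sub>R dird x (\<lambda>y. M j (E y)) (0 + s *\<^sub>R x))
      = (\<Sum>j\<in>UNIV. \<Sum>i\<in>UNIV. (v $ j * x $ i) *\<^sub>R vf_bracket (M i) (M j) ?z)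
        + (\<Sum>j\<in>UNIV. \<Sum>i\<in>UNIV. (v $ j * x $ i) *\<^sub>R dird (M j ?z) (M i) ?z)"
      by (simp add: scaleR_sum_right scaleR_add_right sum.distrib)
    also have "(\<Sum>j\<in>UNIV. \<Sum>i\<in>UNIV. (v $ j * x $ i) *\<^sub>R dird (M j ?z) (M i) ?z) = Q s (P s v)"
      unfolding Q_def P_def
      by (subst sum.swap) (simp add: linear_sum[OF linear_dird[OF M_differentiable]]
          linear_scale[OF linear_dird[OF M_differentiable]] scaleR_sum_right mult.commute)
    also have "(\<Sum>j\<in>UNIV. \<Sum>i\<in>UNIV. (v $ j * x $ i) *\<^sub>R vf_bracket (M i) (M j) ?z)
      = (\<Sum>j\<in>UNIV. \<Sum>i\<in>UNIV. \<Sum>l\<in>UNIV. (if w l = w i + w j then x $ i * v $ j * c i j l else 0) *\<^sub>R M l ?z)"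
      unfolding M_bracket scaleR_sum_right
      by (intro sum.cong refl) (simp add: mult.commute mult.left_commute)
    also have "\<dots> = (\<Sum>i\<in>UNIV. \<Sum>j\<in>UNIV. \<Sum>l\<in>UNIV. (if w l = w i + w j then x $ i * v $ j * c i j l else 0) *\<^sub>R M l ?z)"
      by (rule sum.swap)
    also have "\<dots> = (\<Sum>i\<in>UNIV. \<Sum>l\<in>UNIV. \<Sum>j\<in>UNIV. (if w l = w i + w j then x $ i * v $ j * c i j l else 0) *\<^sub>R M l ?z)"
      by (rule sum.cong[OF refl], rule sum.swap)
    also have "\<dots> = (\<Sum>l\<in>UNIV. \<Sum>i\<in>UNIV. \<Sum>j\<in>UNIV. (if w l = w i + w j then x $ i * v $ j * c i j l else 0) *\<^sub>R M l ?z)"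
      by (rule sum.swap)
    also have "\<dots> = P s (ad v)"
      unfolding P_def graded_bracket_nth by (simp add: scaleR_sum_left)
    finally show ?thesis .
  qed
  ultimately show ?thesis by (simp add: P_def)
qed

lemma D_deriv: "((\<lambda>s. D s u) has_vector_derivative D' s u) (at s)"
  using dird_along_line[of "dird u E" 0 s x UNIV, OF smooth_on_differentiable[OF smooth_on_dird[OF smooth_E] UNIV_I]]
  by (simp add: D_def D'_def)

text \<open>The radial equation for \<open>E\<close> is differentiated in the direction
  \<open>u\<close>. The product rule produces \<open>D s u\<close>, and symmetry of second
  derivatives identifies the other term on the left with \<open>s *\<^sub>R D' s u\<close>.\<close>

lemma D'_eq: "s *\<^sub>R D' s u = P s u + s *\<^sub>R Q s (D s u) - D s u"
proof -
  let ?y = "s *\<^sub>R x"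
  have dE: "dird v E differentiable at y" for v y
    by (rule smooth_on_differentiable[OF smooth_on_dird[OF smooth_E] UNIV_I])
  have nth: "(\<lambda>y. y $ l) differentiable at y" for l and y :: "real ^ 'n"
    by (intro bounded_linear_imp_differentiable bounded_linear_vec_nth)
  have dn: "dird u (\<lambda>y. y $ l) y = u $ l" for l and y :: "real ^ 'n"
    by (simp add: dird_bounded_linear[OF bounded_linear_vec_nth])
  have cE: "(\<lambda>y. M i (E y)) differentiable at y" for i y
    by (rule smooth_on_differentiable[OF smooth_on_compose[OF open_UNIV subset_UNIV smooth_M smooth_E] UNIV_I])
  have sc: "(\<lambda>y. y $ l *\<^sub>R f y) differentiable at y" if "f differentiable at y" for f :: "real ^ 'n \<Rightarrow> real ^ 'n" and l y
    using has_derivative_scaleR[OF has_derivative_dird[OF nth] has_derivative_dird[OF that]]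
    unfolding differentiable_def by blast
  have "(\<lambda>y. \<Sum>l\<in>UNIV. y $ l *\<^sub>R dird (axis l 1) E y) = (\<lambda>y. \<Sum>i\<in>UNIV. y $ i *\<^sub>R M i (E y))"
    by (rule ext) (simp only: dird_expand[OF E_differentiable, symmetric] radial_E)
  then have "dird u (\<lambda>y. \<Sum>l\<in>UNIV. y $ l *\<^sub>R dird (axis l 1) E y) ?y = dird u (\<lambda>y. \<Sum>i\<in>UNIV. y $ i *\<^sub>R M i (E y)) ?y"
    by simp
  moreover have "dird u (\<lambda>y. \<Sum>l\<in>UNIV. y $ l *\<^sub>R dird (axis l 1) E y) ?y
     = (\<Sum>l\<in>UNIV. ?y $ l *\<^sub>R dird u (dird (axis l 1) E) ?y + u $ l *\<^sub>R dird (axis l 1) E ?y)"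
    by (subst dird_sum[OF sc[OF dE]]) (simp add: dird_scaleR[OF nth dE] dn)
  moreover have "\<dots> = dird ?y (dird u E) ?y + D s u"
    unfolding D_def
    using dird_expand[OF dE, of ?y u ?y] dird_expand[OF E_differentiable, of u ?y]
    by (simp add: sum.distrib dird_commute_vec[OF open_UNIV UNIV_I smooth_E, of u])
  moreover have "dird u (\<lambda>y. \<Sum>i\<in>UNIV. y $ i *\<^sub>R M i (E y)) ?y
     = (\<Sum>i\<in>UNIV. ?y $ i *\<^sub>R dird (D s u) (M i) (E ?y) + u $ i *\<^sub>R M i (E ?y))"
    by (subst dird_sum[OF sc[OF cE]])
      (simp add: dird_scaleR[OF nth cE] dn dird_compose[OF E_differentiable M_differentiable] D_def)
  moreover have "\<dots> = s *\<^sub>R Q s (D s u) + P s u"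
    by (simp add: Q_def P_def sum.distrib scaleR_sum_right)
  moreover have "dird ?y (dird u E) ?y = s *\<^sub>R D' s u"
    unfolding D'_def using linear_scale[OF linear_dird[OF dE]] by simp
  ultimately show ?thesis by (simp add: algebra_simps)
qed

lemma F_deriv: "((\<lambda>s. F s v) has_vector_derivative F' s v) (at s)"
proof -
  have "((\<lambda>s. b m * s ^ m) has_real_derivative b m * (real m * s ^ (m - 1))) (at s)" for m
    by (rule DERIV_cmult) (use DERIV_pow[of m s UNIV] in simp)
  then have "((\<lambda>s. (b m * s ^ m) *\<^sub>R (ad ^^ m) v) has_vector_derivative (b m * (real m * s ^ (m - 1))) *\<^sub>R (ad ^^ m) v) (at s)" for m
    unfolding has_real_derivative_iff_has_vector_derivative
    by (rule bounded_linear.has_vector_derivative[OF bounded_linear_scaleR_left])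
  then show ?thesis unfolding F_def F'_def by (intro has_vector_derivative_sum)
qed

lemma ad_pow_eq_0: "r \<le> m \<Longrightarrow> (ad ^^ m) v = 0"
  by (rule graded_bracket_pow_eq_0[OF w_pos w_le])

text \<open>Cauchy product of the truncated series. Products of degree \<open>r\<close> and more may
  be dropped, since these powers of \<open>ad\<close> vanish.\<close>

lemma F_F: "F s (F s v) = (\<Sum>m<r. ((\<Sum>i\<le>m. b i * b (m - i)) * s ^ m) *\<^sub>R (ad ^^ m) v)"
proof -
  let ?g = "\<lambda>i j. (b i * b j * s ^ (i + j)) *\<^sub>R (ad ^^ (i + j)) v"
  have "F s (F s v) = (\<Sum>i<r. \<Sum>j<r. ?g i j)"
    unfolding F_def
    by (simp add: linear_sum[OF linear_graded_bracket_pow] linear_scale[OF linear_graded_bracket_pow]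
        scaleR_sum_right funpow_add power_add mult_ac)
  also have "\<dots> = (\<Sum>(i, j)\<in>{..<r} \<times> {..<r}. ?g i j)" by (rule sum.cartesian_product)
  also have "\<dots> = (\<Sum>(i, j)\<in>{(i, j). i + j < r}. ?g i j)"
    by (rule sum.mono_neutral_right) (auto, metis ad_pow_eq_0 not_less)
  also have "\<dots> = (\<Sum>k<r. \<Sum>i\<le>k. ?g i (k - i))" by (rule sum.triangle_reindex)
  also have "\<dots> = (\<Sum>m<r. ((\<Sum>i\<le>m. b i * b (m - i)) * s ^ m) *\<^sub>R (ad ^^ m) v)"
    by (intro sum.cong refl) (simp add: sum_distrib_right scaleR_sum_left)
  finally show ?thesis .
qed

lemma F_ad: "s *\<^sub>R F s (ad v) = (\<Sum>m<r. ((if m = 0 then 0 else b (m - 1)) * s ^ m) *\<^sub>R (ad ^^ m) v)"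
proof -
  let ?g = "\<lambda>m. ((if m = 0 then 0 else b (m - 1)) * s ^ m) *\<^sub>R (ad ^^ m) v"
  have "s *\<^sub>R F s (ad v) = (\<Sum>m<r. ?g (Suc m))"
    unfolding F_def scaleR_sum_right by (rule sum.cong) (simp_all add: funpow_swap1 mult_ac)
  also have "\<dots> = sum ?g {..<Suc r}" unfolding sum.lessThan_Suc_shift by simp
  also have "\<dots> = sum ?g {..<r}" by (simp add: ad_pow_eq_0)
  finally show ?thesis .
qed

text \<open>The coefficient recursion in \<open>riccati\<close>, multiplied by powers of s
  \<open>ad\<close> and summed.\<close>

lemma F'_eq: "s *\<^sub>R F' s v = F s v + s *\<^sub>R F s (ad v) - F s (F s v)"
proof -
  have "s *\<^sub>R F' s v = (\<Sum>m<r. ((m * b m) * s ^ m) *\<^sub>R (ad ^^ m) v)"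
    unfolding F'_def scaleR_sum_right
  proof (rule sum.cong[OF refl])
    fix m show "s *\<^sub>R (b m * (real m * s ^ (m - 1))) *\<^sub>R (ad ^^ m) v = ((m * b m) * s ^ m) *\<^sub>R (ad ^^ m) v"
      by (cases m) (simp_all add: mult_ac)
  qed
  also have "\<dots> = F s v + s *\<^sub>R F s (ad v) - F s (F s v)"
    unfolding F_ad F_F unfolding F_def[of s v] sum.distrib[symmetric] sum_subtractf[symmetric]
      scaleR_add_left[symmetric] scaleR_diff_left[symmetric]
    by (rule sum.cong[OF refl]) (use b in \<open>simp add: riccati_def left_diff_distrib distrib_right\<close>)
  finally show ?thesis .
qed

definition G :: "real \<Rightarrow> real ^ 'n \<Rightarrow> real ^ 'n" where
  "G s v = P s v - D s (F s v)"

definition G' :: "real \<Rightarrow> real ^ 'n \<Rightarrow> real ^ 'n" where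
  "G' s v = P s (ad v) + Q s (P s v) - (D s (F' s v) + D' s (F s v))"

lemma linear_G: "linear (G s)"
  unfolding G_def
  by (intro linear_compose_sub linear_P linear_compose[OF linear_F linear_D, unfolded comp_def])

lemma D_F_deriv: "((\<lambda>s. D s (F s v)) has_vector_derivative (D s (F' s v) + D' s (F s v))) (at s)"
proof -
  have D_exp: "D s u = (\<Sum>l\<in>UNIV. u $ l *\<^sub>R D s (axis l 1))" for s u
    unfolding D_def by (rule dird_expand[OF E_differentiable])
  have D'_exp: "D' s u = (\<Sum>l\<in>UNIV. u $ l *\<^sub>R D' s (axis l 1))" for s u
    unfolding D'_def dird_commute_vec[OF open_UNIV UNIV_I smooth_E, of x]
    by (rule dird_expand) (rule smooth_on_differentiable[OF smooth_on_dird[OF smooth_E] UNIV_I])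
  have "((\<lambda>s. F s v $ l *\<^sub>R D s (axis l 1)) has_vector_derivative
     (F s v $ l *\<^sub>R D' s (axis l 1) + F' s v $ l *\<^sub>R D s (axis l 1))) (at s)" for l
    by (rule has_vector_derivative_scaleR[OF _ D_deriv])
      (unfold has_real_derivative_iff_has_vector_derivative,
        rule bounded_linear.has_vector_derivative[OF bounded_linear_vec_nth F_deriv])
  then have "((\<lambda>s. \<Sum>l\<in>UNIV. F s v $ l *\<^sub>R D s (axis l 1)) has_vector_derivative
     (\<Sum>l\<in>UNIV. F s v $ l *\<^sub>R D' s (axis l 1) + F' s v $ l *\<^sub>R D s (axis l 1))) (at s)"
    by (intro has_vector_derivative_sum)
  then show ?thesis
    using D_exp[of _ "F _ v"] D_exp[of s "F' s v"] D'_exp[of s "F s v"] by (simp add: sum.distrib add.commute)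
qed

lemma G_deriv: "((\<lambda>s. G s v) has_vector_derivative G' s v) (at s)"
  unfolding G_def G'_def by (intro has_vector_derivative_diff P_deriv D_F_deriv)

text \<open>In the combination of the derivative formulas the terms \<open>D s (F s v)\<close>
  cancel, and the quadratic term joins with \<open>P s (F s v)\<close> to form
  \<open>G s (F s v)\<close>.\<close>

lemma G'_eq: "s *\<^sub>R G' s v = s *\<^sub>R G s (ad v) + s *\<^sub>R Q s (G s v) - G s (F s v)"
proof -
  have "s *\<^sub>R D s (F' s v) = D s (F s v) + s *\<^sub>R D s (F s (ad v)) - D s (F s (F s v))"
    unfolding linear_scale[OF linear_D, symmetric] F'_eq
    by (simp add: linear_add[OF linear_D] linear_diff[OF linear_D])
  then show ?thesis
    unfolding G'_def G_def
    by (simp add: scaleR_add_right scaleR_diff_right D'_eq linear_diff[OF linear_Q])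
qed

lemma F_axis_nth:
  assumes "w l \<le> w j"
  shows "F s (axis j 1) $ l = axis j 1 $ l"
proof -
  have r: "0 < r" using w_pos[of j] w_le[of j] by simp
  have z: "(ad ^^ m) (axis j 1) $ l = 0" if "0 < m" for m
    by (rule graded_bracket_pow_nth[OF w_pos, where N = "w j"]) (use that assms in \<open>auto simp: axis_def\<close>)
  have "F s (axis j 1) $ l = (\<Sum>m<r. (b m * s ^ m) * (ad ^^ m) (axis j 1) $ l)"
    unfolding F_def by simp
  also have "\<dots> = (\<Sum>m<r. if m = 0 then axis j 1 $ l else 0)"
    by (rule sum.cong) (use b z in \<open>auto simp: riccati_def\<close>)
  finally show ?thesis using r by simp
qed

lemma G_eq_0: "G s (axis j 1) $ k = 0"
\<comment> \<open>\<open>Q\<close> relates component \<open>k\<close> to components of smaller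
  weight, while \<open>ad\<close> and F - 1 relate \<open>axis j 1\<close> to axes of larger weight.
  The measure drops in both cases; the subtraction is never truncated, because
  \<open>w j \<le> r\<close>.\<close>
proof (induction "w k + (r - w j)" arbitrary: j k s rule: less_induct)
  case less
  have up: "G s u $ k = (\<Sum>l | w l \<le> w j. u $ l * G s (axis l 1) $ k)" for s u
  proof -
    have "G s u = (\<Sum>l\<in>UNIV. u $ l *\<^sub>R G s (axis l 1))"
      by (subst vec_eq_sum_axis[of u]) (simp add: linear_sum[OF linear_G] linear_scale[OF linear_G])
    then have "G s u $ k = (\<Sum>l\<in>UNIV. u $ l * G s (axis l 1) $ k)" by simp
    also have "\<dots> = (\<Sum>l | w l \<le> w j. u $ l * G s (axis l 1) $ k)"
    proof (rule sum.mono_neutral_right)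
      show "\<forall>l\<in>UNIV - {l. w l \<le> w j}. u $ l * G s (axis l 1) $ k = 0"
      proof
        fix l assume "l \<in> UNIV - {l. w l \<le> w j}"
        then have "w k + (r - w l) < w k + (r - w j)" using w_le[of l] by auto
        then show "u $ l * G s (axis l 1) $ k = 0" by (simp add: less.hyps)
      qed
    qed auto
    finally show ?thesis .
  qed
  have ad0: "G s (ad (axis j 1)) $ k = 0" for s
    unfolding up[of s "ad (axis j 1)"]
  proof (intro sum.neutral ballI)
    fix l assume "l \<in> {l. w l \<le> w j}"
    then have "(ad ^^ 1) (axis j 1) $ l = 0"
      by (intro graded_bracket_pow_nth[OF w_pos, where N = "w j"]) (auto simp: axis_def)
    then show "ad (axis j 1) $ l * G s (axis l 1) $ k = 0" by simp
  qed
  have GF: "G s (F s (axis j 1)) $ k = G s (axis j 1) $ k" for s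
    unfolding up[of s "F s (axis j 1)"] by (subst up[of s "axis j 1"], intro sum.cong) (simp_all add: F_axis_nth)
  have Q0: "Q s (G s (axis j 1)) $ k = 0" for s
  proof -
    have "dird (G s (axis j 1)) (M i) z $ k = 0" for i z
      by (rule dird_M_cong) (simp add: less.hyps)
    then show ?thesis by (simp add: Q_def)
  qed
  have eq: "s * G' s (axis j 1) $ k = - G s (axis j 1) $ k" for s
    using arg_cong[OF G'_eq[of s "axis j 1"], of "\<lambda>v. v $ k"] by (simp add: ad0 GF Q0)
  have "((\<lambda>s. s * G s (axis j 1) $ k) has_real_derivative s * G' s (axis j 1) $ k + 1 * G s (axis j 1) $ k) (at s)" for s
    by (rule DERIV_mult'[OF DERIV_ident])
      (unfold has_real_derivative_iff_has_vector_derivative,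
        rule bounded_linear.has_vector_derivative[OF bounded_linear_vec_nth G_deriv])
  then have "((\<lambda>s. s * G s (axis j 1) $ k) has_real_derivative 0) (at s)" for s by (simp add: eq)
  then have "s * G s (axis j 1) $ k = 0 * G 0 (axis j 1) $ k"
    using DERIV_isconst_all by blast
  \<comment> \<open>For nonzero \<open>s\<close> the claim follows by division; at
    \<open>s = 0\<close> the equation \<open>eq\<close> itself reads 0 = - G.\<close>
  then show ?case using eq[of 0] by (cases "s = 0") auto
qed

lemma dird_E_F: "dird (\<Sum>m<r. b m *\<^sub>R (ad ^^ m) (axis j 1)) E x = M j (E x)"
proof -
  have "G 1 (axis j 1) = 0" by (simp add: vec_eq_iff G_eq_0)
  moreover have "P 1 (axis j 1) = M j (E x)"
  proof -
    have "P 1 (axis j 1) = (\<Sum>i\<in>UNIV. if i = j then M i (E x) else 0)"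
      unfolding P_def by (rule sum.cong) (auto simp: axis_def)
    then show ?thesis by simp
  qed
  ultimately show ?thesis by (simp add: G_def D_def F_def)
qed

end

section \<open>The left-invariant fields of the Dynkin product\<close>

text \<open>A word in \<open>x\<close> and \<open>y\<close> is encoded as a list of Booleans, with \<open>True\<close> for \<open>y\<close>. Of the bracketed
  words only those with a single \<open>y\<close>, in one of the last two places, contribute to the differential
  at \<open>y = 0\<close>.\<close>

fun wcoef :: "bool list \<Rightarrow> real" where
  "wcoef [] = 0"
| "wcoef (b # u) = (if b then if u = [] then 1 else if u = [False] then - 1 else 0 else wcoef u)"

lemma wcoef_replicate_False [simp]: "wcoef (replicate k False @ u) = wcoef u"
  by (induction k) auto

text \<open>Product rule at y = 0. If the outermost letter is \<open>y\<close>, the inner bracket is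
  evaluated at 0 and is then nonzero only for the one-letter word \<open>x\<close>, because [x, x] =
  0; antisymmetry supplies the sign. If the outermost letter is \<open>x\<close>, one more power of
  \<open>B x\<close> appears.\<close>

lemma nested_bracket_deriv:
  fixes B :: "real ^ 'n \<Rightarrow> real ^ 'n \<Rightarrow> real ^ 'n"
  assumes B: "bilinear B" and xx: "B x x = 0" and anti: "\<And>v. B v x = - B x v"
  shows "((\<lambda>y. nested_bracket B (map (\<lambda>b. if b then y else x) u)) has_derivative
    (\<lambda>v. wcoef u *\<^sub>R (B x ^^ (length u - 1)) v)) (at 0)"
proof (induction u rule: induct_list012)
  case 1
  then show ?case by simp
next
  case (2 b)
  then show ?case by (cases b) simp_all
next
  case (3 b c u)
  interpret bounded_bilinear B using B by (simp add: bilinear_conv_bounded_bilinear)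
  let ?N = "\<lambda>u y. nested_bracket B (map (\<lambda>b. if b then y else x) u)"
  have N0: "?N u 0 = (if u = [False] then x else 0)" for u
  proof (induction u rule: induct_list012)
    case (3 b c u)
    then show ?case by (auto simp: zero_left zero_right xx)
  qed auto
  have step: "?N (b # c # u) y = B (if b then y else x) (?N (c # u) y)" for y by simp
  have fb: "((\<lambda>y. if b then y else x) has_derivative (\<lambda>v. if b then v else 0)) (at 0)"
    by (cases b) simp_all
  have "((\<lambda>y. ?N (b # c # u) y) has_derivative
     (\<lambda>v. B (if b then 0 else x) (wcoef (c # u) *\<^sub>R (B x ^^ (length (c # u) - 1)) v) + B (if b then v else 0) (?N (c # u) 0))) (at 0)"
    unfolding step using FDERIV[OF fb 3(2)] by (simp cong: if_cong)
  moreover have "B (if b then 0 else x) (wcoef (c # u) *\<^sub>R (B x ^^ (length (c # u) - 1)) v) + B (if b then v else 0) (?N (c # u) 0)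
     = wcoef (b # c # u) *\<^sub>R (B x ^^ (length (b # c # u) - 1)) v" for v
  proof (cases b)
    case True
    then show ?thesis unfolding N0 by (auto simp: zero_left zero_right anti)
  next
    case False
    then show ?thesis by (simp add: zero_left scaleR_right)
  qed
  ultimately show ?case by simp
qed

abbreviation ptotal :: "(nat \<times> nat) list \<Rightarrow> nat" where
  "ptotal ps \<equiv> (\<Sum>(p, q)\<leftarrow>ps. p + q)"

definition dword :: "(nat \<times> nat) list \<Rightarrow> bool list" where
  "dword ps = concat (map (\<lambda>(p, q). replicate p False @ replicate q True) ps)"

lemma dword_simps [simp]:
  "dword [] = []" "dword ((p, q) # ps) = replicate p False @ replicate q True @ dword ps"
  by (simp_all add: dword_def)

lemma dword_append: "dword (ps @ qs) = dword ps @ dword qs"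
  by (simp add: dword_def)

lemma length_dword: "length (dword ps) = ptotal ps"
  by (induction ps) auto

lemma map_dword:
  "map (\<lambda>b. if b then y else x) (dword ps) = concat (map (\<lambda>(p, q). replicate p x @ replicate q y) ps)"
  by (induction ps) auto

section \<open>The part of Dynkin's formula that is linear in the second factor\<close>

definition dcoef :: "(nat \<times> nat) list \<Rightarrow> real" where
  "dcoef ps = (- 1) ^ (length ps - 1) /
     (real (length ps) * real (ptotal ps) * (\<Prod>(p, q)\<leftarrow>ps. fact p * fact q))"

definition dsets :: "nat \<Rightarrow> (nat \<times> nat) list set" where
  "dsets t = {ps. ps \<noteq> [] \<and> (\<forall>(p, q)\<in>set ps. 0 < p + q) \<and> ptotal ps = t}"

text \<open>The coefficient of (ad x)^m in the differential at 0 of the left translation by x. A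
  word of total degree \<open>Suc m\<close> with a single \<open>y\<close> carries \<open>m\<close>
  letters \<open>x\<close>, hence the shift.\<close>

definition dyn :: "nat \<Rightarrow> real" where
  "dyn m = (\<Sum>ps\<in>dsets (Suc m). dcoef ps * wcoef (dword ps))"

lemma length_le_total: "\<forall>(p, q)\<in>set ps. 0 < p + q \<Longrightarrow> length ps \<le> ptotal ps"
  by (induction ps) auto

lemma entries_le_total: "(p, q) \<in> set ps \<Longrightarrow> p \<le> ptotal ps \<and> q \<le> ptotal ps"
  by (induction ps) auto

lemma finite_dsets: "finite (dsets t)"
proof (rule finite_subset)
  show "dsets t \<subseteq> {ps. set ps \<subseteq> {..t} \<times> {..t} \<and> length ps \<le> t}"
    unfolding dsets_def using entries_le_total length_le_total by (auto; fastforce)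
qed (rule finite_lists_length_le, simp)

lemma left_invariant_dynkin:
  fixes B :: "real ^ 'n \<Rightarrow> real ^ 'n \<Rightarrow> real ^ 'n"
  assumes B: "bilinear B" and xx: "B x x = 0" and anti: "\<And>v. B v x = - B x v"
  shows "left_invariant_field (dynkin_product r B) v x = (\<Sum>m<r. dyn m *\<^sub>R (B x ^^ m) v)"
proof -
  let ?S = "{ps. ps \<noteq> [] \<and> (\<forall>(p, q)\<in>set ps. 0 < p + q) \<and> ptotal ps \<le> r}"
  have S: "?S = (\<Union>m<r. dsets (Suc m))"
  proof (intro equalityI subsetI)
    fix ps :: "(nat \<times> nat) list" assume ps: "ps \<in> ?S"
    then have "length ps \<le> ptotal ps" by (intro length_le_total) simp
    moreover have "length ps \<noteq> 0" using ps by simp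
    ultimately have "0 < ptotal ps" by linarith
    then show "ps \<in> (\<Union>m<r. dsets (Suc m))"
      using ps by (intro UN_I[of "ptotal ps - 1"]) (auto simp: dsets_def)
  qed (auto simp: dsets_def)
  have "((\<lambda>y. dynkin_product r B x y) has_derivative
      (\<lambda>v. \<Sum>ps\<in>?S. dcoef ps *\<^sub>R (wcoef (dword ps) *\<^sub>R (B x ^^ (length (dword ps) - 1)) v))) (at 0)"
    unfolding dynkin_product_def dcoef_def[symmetric] map_dword[symmetric]
    by (intro has_derivative_sum has_derivative_scaleR_right nested_bracket_deriv[OF B xx anti])
  from fun_cong[OF frechet_derivative_at[OF this], of v]
  have "left_invariant_field (dynkin_product r B) v x
     = (\<Sum>ps\<in>?S. dcoef ps *\<^sub>R (wcoef (dword ps) *\<^sub>R (B x ^^ (length (dword ps) - 1)) v))"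
    by (simp only: left_invariant_field_def)
  also have "\<dots> = (\<Sum>m<r. \<Sum>ps\<in>dsets (Suc m). dcoef ps *\<^sub>R (wcoef (dword ps) *\<^sub>R (B x ^^ (length (dword ps) - 1)) v))"
    unfolding S by (rule sum.UNION_disjoint) (auto simp: finite_dsets, auto simp: dsets_def)
  also have "\<dots> = (\<Sum>m<r. dyn m *\<^sub>R (B x ^^ m) v)"
  proof (rule sum.cong[OF refl])
    fix m
    have "(\<Sum>ps\<in>dsets (Suc m). dcoef ps *\<^sub>R (wcoef (dword ps) *\<^sub>R (B x ^^ (length (dword ps) - 1)) v))
       = (\<Sum>ps\<in>dsets (Suc m). (dcoef ps * wcoef (dword ps)) *\<^sub>R (B x ^^ m) v)"
      by (rule sum.cong) (auto simp: dsets_def length_dword)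
    then show "(\<Sum>ps\<in>dsets (Suc m). dcoef ps *\<^sub>R (wcoef (dword ps) *\<^sub>R (B x ^^ (length (dword ps) - 1)) v))
       = dyn m *\<^sub>R (B x ^^ m) v" by (simp add: dyn_def scaleR_sum_left)
  qed
  finally show ?thesis .
qed

text \<open>Together with \<open>penult_word\<close>, the shapes of the contributing words. The
  blocks of \<open>x\<close> alone come first and must be nonempty, a condition kept in
  \<open>splits\<close>; the exponent \<open>p\<close> in the block that contains \<open>y\<close>
  may be 0.\<close>

definition last_word :: "nat list \<times> nat \<Rightarrow> (nat \<times> nat) list" where
  "last_word = (\<lambda>(qs, p). map (\<lambda>p. (p, 0)) qs @ [(p, 1)])"

definition penult_word :: "nat list \<times> nat \<Rightarrow> (nat \<times> nat) list" where
  "penult_word = (\<lambda>(qs, p). map (\<lambda>p. (p, 0)) qs @ [(p, 1), (1, 0)])"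

definition splits :: "nat \<Rightarrow> (nat list \<times> nat) set" where
  "splits m = {(qs, p). (\<forall>q\<in>set qs. 0 < q) \<and> sum_list qs + p = m}"

lemma dword_eq_Nil: "\<forall>(p, q)\<in>set ps. 0 < p + q \<Longrightarrow> dword ps = [] \<Longrightarrow> ps = []"
  by (cases ps) auto

lemma dword_eq_single:
  assumes "\<forall>(p, q)\<in>set ps. 0 < p + q" "dword ps = [False]"
  shows "ps = [(1, 0)]"
proof (cases ps)
  case (Cons a ps')
  obtain p q where a: "a = (p, q)" by (cases a)
  have w: "replicate p False @ replicate q True @ dword ps' = [False]" and pq: "0 < p + q"
    using assms Cons a by auto
  then have "p = 1 \<and> q = 0 \<and> dword ps' = []"
    by (cases p; cases q) (auto simp: append_eq_Cons_conv)
  moreover then have "ps' = []" using dword_eq_Nil[of ps'] assms Cons by simp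
  ultimately show ?thesis using Cons a by simp
qed (use assms in simp)

lemma wcoef_dword_nonzero:
  "\<forall>(p, q)\<in>set ps. 0 < p + q \<Longrightarrow> wcoef (dword ps) \<noteq> 0 \<Longrightarrow>
    \<exists>qs p. (\<forall>q\<in>set qs. 0 < q) \<and> (ps = last_word (qs, p) \<or> ps = penult_word (qs, p))"
proof (induction ps)
  case (Cons a ps)
  obtain p q where a: "a = (p, q)" by (cases a)
  show ?case
  proof (cases q)
    case 0
    then have "wcoef (dword ps) \<noteq> 0" using Cons.prems a by simp
    then obtain qs p' where "\<forall>q\<in>set qs. 0 < q" "ps = last_word (qs, p') \<or> ps = penult_word (qs, p')"
      using Cons by auto
    then show ?thesis
      using Cons.prems(1) a 0 by (intro exI[of _ "p # qs"] exI[of _ p']) (auto simp: last_word_def penult_word_def)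
  next
    case (Suc q')
    then have "replicate q' True @ dword ps = [] \<or> replicate q' True @ dword ps = [False]"
      using Cons.prems(2) a by (auto split: if_splits)
    then have q': "q' = 0" and "dword ps = [] \<or> dword ps = [False]" by (cases q'; auto)+
    then have "ps = [] \<or> ps = [(1, 0)]"
      using dword_eq_Nil[of ps] dword_eq_single[of ps] Cons.prems(1) by auto
    then show ?thesis
      using a Suc q' by (intro exI[of _ "[]"] exI[of _ p]) (auto simp: last_word_def penult_word_def)
  qed
qed simp

lemma dword_map_zero: "dword (map (\<lambda>p. (p, 0)) qs) = replicate (sum_list qs) False"
  by (induction qs) (auto simp: replicate_add)

lemma wcoef_last_word: "wcoef (dword (last_word (qs, p))) = 1"
  by (simp add: last_word_def dword_append dword_map_zero)

lemma wcoef_penult_word: "wcoef (dword (penult_word (qs, p))) = - 1"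
  by (simp add: penult_word_def dword_append dword_map_zero)

lemma total_words:
  "ptotal (last_word (qs, p)) = sum_list qs + p + 1"
  "ptotal (penult_word (qs, p)) = sum_list qs + p + 2"
  by (induction qs) (auto simp: last_word_def penult_word_def)

lemma prod_fact_words:
  "(\<Prod>(p, q)\<leftarrow>last_word (qs, p). fact p * fact q :: real) = (\<Prod>q\<leftarrow>qs. fact q) * fact p"
  "(\<Prod>(p, q)\<leftarrow>penult_word (qs, p). fact p * fact q :: real) = (\<Prod>q\<leftarrow>qs. fact q) * fact p"
  by (induction qs) (auto simp: last_word_def penult_word_def)

definition tsum :: "(nat \<Rightarrow> real) \<Rightarrow> nat \<Rightarrow> real" where
  "tsum h m = (\<Sum>(qs, p)\<in>splits m. h (length qs) / ((\<Prod>q\<leftarrow>qs. fact q) * fact p))"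

lemma inj_words: "inj last_word" "inj penult_word"
proof -
  have i: "inj (\<lambda>p::nat. (p, 0::nat))" by (auto simp: inj_def)
  show "inj last_word" "inj penult_word"
    using map_injective[OF _ i] by (auto simp: inj_def last_word_def penult_word_def)
qed

lemma last_word_neq_penult_word: "last_word a \<noteq> penult_word b"
proof
  assume "last_word a = penult_word b"
  then have "last (last_word a) = last (penult_word b)" by simp
  then show False by (simp add: last_word_def penult_word_def split: prod.splits)
qed

text \<open>Multiplication by \<open>Suc m\<close> clears the total degree from the denominator of
  Dynkin's formula. With l pure blocks the words have l + 1 or l + 2 blocks. The value -1 of
  \<open>wcoef\<close> on \<open>penult_word\<close> compensates the sign of its extra block, and
  its extra letter lowers \<open>m\<close> by 1.\<close>

lemma dyn_eq:
  "real (Suc m) * dyn m = tsum (\<lambda>l. (- 1) ^ l / real (l + 1)) m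
     + (if m = 0 then 0 else tsum (\<lambda>l. (- 1) ^ l / real (l + 2)) (m - 1))"
proof -
  let ?f = "\<lambda>ps. dcoef ps * wcoef (dword ps)"
  let ?A1 = "last_word ` splits m"
  let ?A2 = "penult_word ` (if m = 0 then {} else splits (m - 1))"
  have pos: "\<forall>(p, q)\<in>set (last_word (qs, p')). 0 < p + q" "\<forall>(p, q)\<in>set (penult_word (qs, p')). 0 < p + q"
    if "\<forall>q\<in>set qs. 0 < q" for p' qs
    using that by (auto simp: last_word_def penult_word_def)
  have ne: "last_word a \<noteq> []" "penult_word a \<noteq> []" for a
    by (cases a; simp add: last_word_def penult_word_def)+
  have sub: "?A1 \<union> ?A2 \<subseteq> dsets (Suc m)"
  proof
    fix ps assume "ps \<in> ?A1 \<union> ?A2"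
    then obtain qs p where "(\<forall>q\<in>set qs. 0 < q)"
      "ps = last_word (qs, p) \<and> sum_list qs + p = m \<or> ps = penult_word (qs, p) \<and> m \<noteq> 0 \<and> sum_list qs + p = m - 1"
      by (auto simp: splits_def split: if_splits)
    then show "ps \<in> dsets (Suc m)"
      using pos[of qs p] ne[of "(qs, p)"] total_words[of qs p] unfolding dsets_def mem_Collect_eq
      by (elim disjE conjE) (simp_all only:, simp_all)
  qed
  have fin: "finite ?A1" "finite ?A2"
    using finite_subset[OF sub finite_dsets] by (rule finite_subset[rotated], blast)+
  have "dyn m = sum ?f (?A1 \<union> ?A2)"
    unfolding dyn_def
  proof (rule sum.mono_neutral_right[OF finite_dsets sub], rule ballI)
    fix ps assume ps: "ps \<in> dsets (Suc m) - (?A1 \<union> ?A2)"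
    have "wcoef (dword ps) = 0"
    proof (rule ccontr)
      assume "wcoef (dword ps) \<noteq> 0"
      then obtain qs p where q: "\<forall>q\<in>set qs. 0 < q" "ps = last_word (qs, p) \<or> ps = penult_word (qs, p)"
        using wcoef_dword_nonzero[of ps] ps unfolding dsets_def by blast
      from q(2) show False
      proof
        assume e: "ps = last_word (qs, p)"
        then have "(qs, p) \<in> splits m" using ps q total_words(1)[of qs p] by (auto simp: dsets_def splits_def)
        then show False using ps e by blast
      next
        assume e: "ps = penult_word (qs, p)"
        then have "sum_list qs + p + 2 = Suc m" using ps total_words(2)[of qs p] by (simp add: dsets_def)
        then have "(qs, p) \<in> (if m = 0 then {} else splits (m - 1))" using q by (auto simp: splits_def)
        then show False using ps e by blast
      qed
    qed
    then show "?f ps = 0" by simp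
  qed
  also have "\<dots> = sum ?f ?A1 + sum ?f ?A2"
    using fin last_word_neq_penult_word by (intro sum.union_disjoint) auto
  also have "sum ?f ?A1 = (\<Sum>a\<in>splits m. ?f (last_word a))"
    by (rule sum.reindex_cong[OF inj_on_subset[OF inj_words(1)] refl]) auto
  also have "sum ?f ?A2 = (\<Sum>a\<in>(if m = 0 then {} else splits (m - 1)). ?f (penult_word a))"
    by (rule sum.reindex_cong[OF inj_on_subset[OF inj_words(2)] refl]) auto
  finally have dm: "dyn m = (\<Sum>a\<in>splits m. ?f (last_word a))
     + (\<Sum>a\<in>(if m = 0 then {} else splits (m - 1)). ?f (penult_word a))" .
  have "real (Suc m) * (\<Sum>a\<in>splits m. ?f (last_word a)) = tsum (\<lambda>l. (- 1) ^ l / real (l + 1)) m"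
    unfolding tsum_def sum_distrib_left
  proof (rule sum.cong[OF refl])
    fix a assume a: "a \<in> splits m"
    obtain qs p where qp: "a = (qs, p)" by (cases a)
    have "ptotal (last_word (qs, p)) = Suc m" using a qp by (simp add: total_words splits_def)
    then show "real (Suc m) * ?f (last_word a)
        = (case a of (qs, p) \<Rightarrow> (- 1) ^ length qs / real (length qs + 1) / ((\<Prod>q\<leftarrow>qs. fact q) * fact p))"
      unfolding qp dcoef_def wcoef_last_word prod_fact_words
      by (simp add: last_word_def del: of_nat_Suc)
  qed
  moreover have "real (Suc m) * (\<Sum>a\<in>(if m = 0 then {} else splits (m - 1)). ?f (penult_word a))
     = (if m = 0 then 0 else tsum (\<lambda>l. (- 1) ^ l / real (l + 2)) (m - 1))"
  proof (cases "m = 0")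
    case False
    have "real (Suc m) * (\<Sum>a\<in>splits (m - 1). ?f (penult_word a)) = tsum (\<lambda>l. (- 1) ^ l / real (l + 2)) (m - 1)"
      unfolding tsum_def sum_distrib_left
    proof (rule sum.cong[OF refl])
      fix a assume a: "a \<in> splits (m - 1)"
      obtain qs p where qp: "a = (qs, p)" by (cases a)
      have "ptotal (penult_word (qs, p)) = Suc m" using a qp False by (simp add: total_words splits_def)
      then show "real (Suc m) * ?f (penult_word a)
        = (case a of (qs, p) \<Rightarrow> (- 1) ^ length qs / real (length qs + 2) / ((\<Prod>q\<leftarrow>qs. fact q) * fact p))"
        unfolding qp dcoef_def wcoef_penult_word prod_fact_words
        by (simp add: penult_word_def del: of_nat_Suc)
    qed
    then show ?thesis using False by simp
  qed simp
  ultimately show ?thesis unfolding dm distrib_left by simp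
qed

section \<open>Summation by generating functions\<close>

abbreviation (input) expm1 :: "real fps" where "expm1 \<equiv> fps_exp 1 - 1"

definition pos_lists :: "nat \<Rightarrow> nat \<Rightarrow> nat list set" where
  "pos_lists i s = {qs. length qs = i \<and> (\<forall>q\<in>set qs. 0 < q) \<and> sum_list qs = s}"

lemma pos_lists_Suc: "pos_lists (Suc i) s = (\<lambda>(q, qs). q # qs) ` (SIGMA q:{1..s}. pos_lists i (s - q))"
proof (intro equalityI subsetI)
  fix l assume l: "l \<in> pos_lists (Suc i) s"
  then obtain q qs where "l = q # qs" by (auto simp: pos_lists_def length_Suc_conv)
  then show "l \<in> (\<lambda>(q, qs). q # qs) ` (SIGMA q:{1..s}. pos_lists i (s - q))"
    using l by (intro image_eqI[of _ _ "(q, qs)"]) (auto simp: pos_lists_def)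
qed (auto simp: pos_lists_def)

lemma finite_pos_lists: "finite (pos_lists i s)"
proof (induction i arbitrary: s)
  case 0
  have "pos_lists 0 s \<subseteq> {[]}" by (auto simp: pos_lists_def)
  then show ?case by (rule finite_subset) simp
qed (auto simp: pos_lists_Suc)

lemma fps_nth_expm1_power:
  "fps_nth (expm1 ^ i) s = (\<Sum>qs\<in>pos_lists i s. 1 / (\<Prod>q\<leftarrow>qs. fact q))"
proof (induction i arbitrary: s)
  case 0
  have "pos_lists 0 s = (if s = 0 then {[]} else {})" by (auto simp: pos_lists_def)
  then show ?case by simp
next
  case (Suc i)
  have "fps_nth (expm1 ^ Suc i) s = (\<Sum>q=0..s. fps_nth expm1 q * fps_nth (expm1 ^ i) (s - q))"
    by (simp add: fps_mult_nth)
  also have "\<dots> = (\<Sum>q=1..s. fps_nth expm1 q * fps_nth (expm1 ^ i) (s - q))"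
    by (rule sum.mono_neutral_right) (auto simp: not_less_eq_eq)
  also have "\<dots> = (\<Sum>q=1..s. \<Sum>qs\<in>pos_lists i (s - q). 1 / fact q * (1 / (\<Prod>q\<leftarrow>qs. fact q)))"
    by (rule sum.cong) (auto simp: Suc.IH sum_distrib_left)
  also have "\<dots> = (\<Sum>(q, qs)\<in>(SIGMA q:{1..s}. pos_lists i (s - q)). 1 / fact q * (1 / (\<Prod>q\<leftarrow>qs. fact q)))"
    by (rule sum.Sigma) (auto simp: finite_pos_lists)
  also have "\<dots> = (\<Sum>qs\<in>pos_lists (Suc i) s. 1 / (\<Prod>q\<leftarrow>qs. fact q))"
    unfolding pos_lists_Suc by (subst sum.reindex) (auto simp: inj_on_def intro!: sum.cong)
  finally show ?case .
qed

text \<open>Each pure block contributes a factor exp z - 1 and the letters \<open>x\<close> in the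
  block with \<open>y\<close> contribute exp z, while \<open>h\<close> weighs the number of pure
  blocks.\<close>

lemma tsum_eq: "tsum h m = fps_nth (fps_compose (Abs_fps h) expm1 * fps_exp 1) m"
proof -
  let ?f = "\<lambda>qs p. h (length qs) / ((\<Prod>q\<leftarrow>qs. fact q) * fact p)"
  have len: "length qs \<le> sum_list qs" if "\<forall>q\<in>set qs. 0 < q" for qs :: "nat list"
    using that
  proof (induction qs)
    case (Cons q qs)
    then have "0 < q" "length qs \<le> sum_list qs" by auto
    then show ?case by simp
  qed simp
  have "fps_nth (fps_compose (Abs_fps h) expm1 * fps_exp 1) m
     = (\<Sum>s=0..m. \<Sum>i=0..s. \<Sum>qs\<in>pos_lists i s. ?f qs (m - s))"
    unfolding fps_mult_nth fps_compose_nth fps_nth_expm1_power sum_distrib_left sum_distrib_right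
    by (intro sum.cong refl) (auto simp: pos_lists_def)
  also have "\<dots> = (\<Sum>s=0..m. \<Sum>qs\<in>(\<Union>i\<in>{0..s}. pos_lists i s). ?f qs (m - s))"
    by (intro sum.cong refl sum.UNION_disjoint[symmetric]) (auto simp: finite_pos_lists, auto simp: pos_lists_def)
  also have "\<dots> = (\<Sum>(s, qs)\<in>(SIGMA s:{0..m}. \<Union>i\<in>{0..s}. pos_lists i s). ?f qs (m - s))"
    by (rule sum.Sigma) (auto simp: finite_pos_lists)
  also have "\<dots> = (\<Sum>(qs, p)\<in>splits m. ?f qs p)"
    by (rule sum.reindex_bij_witness[of _ "\<lambda>(qs, p). (sum_list qs, qs)" "\<lambda>(s, qs). (qs, m - s)"])
      (auto simp: splits_def pos_lists_def len)
  finally show ?thesis by (simp add: tsum_def)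
qed

lemma expm1_nth_0: "fps_nth expm1 0 = 0" and expm1_nonzero: "expm1 \<noteq> 0"
  by (auto simp: fps_exp_eq_1_iff)

text \<open>The composed series in u is log (1 + u) / u, and log (1 + u) = z for u = exp z -
  1.\<close>

lemma log_series_compose:
  "fps_compose (Abs_fps (\<lambda>l. (- 1) ^ l / real (l + 1))) expm1 * expm1 = fps_X"
proof -
  let ?H = "Abs_fps (\<lambda>l. (- 1) ^ l / real (l + 1)) :: real fps"
  have L: "fps_ln 1 = ?H * fps_X"
    by (rule fps_ext) (simp add: fps_ln_nth fps_mult_fps_X_commute fps_X_mult_nth)
  have "fps_compose (fps_ln 1) expm1 = fps_X"
    unfolding fps_ln_fps_exp_inv[OF one_neq_zero] by (rule fps_inv) simp_all
  then show ?thesis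
    unfolding L fps_compose_mult_distrib[OF expm1_nth_0] by (simp add: expm1_nth_0)
qed

text \<open>Here the series in u is (u - log (1 + u)) / u^2.\<close>

lemma log_series_compose2:
  "fps_compose (Abs_fps (\<lambda>l. (- 1) ^ l / real (l + 2))) expm1 * expm1 ^ 2 = expm1 - fps_X"
proof -
  let ?H = "Abs_fps (\<lambda>l. (- 1) ^ l / real (l + 1)) :: real fps"
  let ?H2 = "Abs_fps (\<lambda>l. (- 1) ^ l / real (l + 2)) :: real fps"
  have "?H2 * fps_X = 1 - ?H"
  proof (rule fps_ext)
    fix n show "fps_nth (?H2 * fps_X) n = fps_nth (1 - ?H) n"
      by (cases n) (simp_all add: fps_mult_fps_X_commute fps_X_mult_nth add_ac)
  qed
  then have "fps_compose (?H2 * fps_X) expm1 = fps_compose (1 - ?H) expm1" by simp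
  then have "fps_compose ?H2 expm1 * expm1 = 1 - fps_compose ?H expm1"
    unfolding fps_compose_mult_distrib[OF expm1_nth_0] fps_compose_sub_distrib by (simp add: expm1_nth_0)
  then have "fps_compose ?H2 expm1 * expm1 * expm1 = (1 - fps_compose ?H expm1) * expm1" by simp
  then show ?thesis
    using log_series_compose by (simp add: power2_eq_square left_diff_distrib mult.assoc)
qed

definition dyn_fps :: "real fps" where "dyn_fps = Abs_fps dyn"

text \<open>The factor \<open>Suc m\<close> in \<open>dyn_eq\<close> is the effect of
  differentiating z times the series, so the two sums there become closed expressions in z and exp
  z.\<close>

lemma deriv_X_dyn_fps: "fps_deriv (fps_X * dyn_fps) * expm1 ^ 2 = fps_exp 1 * fps_X * (2 * expm1 - fps_X)"
proof -
  let ?K1 = "fps_compose (Abs_fps (\<lambda>l. (- 1) ^ l / real (l + 1))) expm1"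
  let ?K2 = "fps_compose (Abs_fps (\<lambda>l. (- 1) ^ l / real (l + 2))) expm1"
  have "fps_deriv (fps_X * dyn_fps) = ?K1 * fps_exp 1 + fps_X * (?K2 * fps_exp 1)"
  proof (rule fps_ext)
    fix m
    have "fps_nth (fps_deriv (fps_X * dyn_fps)) m = real (Suc m) * dyn m"
      by (simp only: fps_deriv_nth fps_X_mult_nth) (simp add: dyn_fps_def)
    then show "fps_nth (fps_deriv (fps_X * dyn_fps)) m = fps_nth (?K1 * fps_exp 1 + fps_X * (?K2 * fps_exp 1)) m"
      unfolding dyn_eq tsum_eq by (simp only: fps_add_nth fps_X_mult_nth)
  qed
  then have "fps_deriv (fps_X * dyn_fps) * expm1 ^ 2
     = fps_exp 1 * ((?K1 * expm1) * expm1 + fps_X * (?K2 * expm1 ^ 2))"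
    by (simp only:) (simp add: algebra_simps power2_eq_square)
  then show ?thesis unfolding log_series_compose log_series_compose2 by (simp add: algebra_simps)
qed

text \<open>The expected answer z exp z / (exp z - 1) = z / (1 - exp (-z)) is verified rather than
  derived: z times it has the same derivative as z times \<open>dyn_fps\<close>, and both have
  constant term 0.\<close>

lemma dyn_fps_times_expm1: "dyn_fps * expm1 = fps_X * fps_exp 1"
proof -
  \<comment> \<open>\<open>T\<close> is (exp z - 1) / z. Its constant term 1 makes it invertible,
    unlike that of exp z - 1.\<close>
  define T where "T = (Abs_fps (\<lambda>n. 1 / fact (Suc n)) :: real fps)"
  have u: "expm1 = fps_X * T"
  proof (rule fps_ext)
    fix n show "fps_nth expm1 n = fps_nth (fps_X * T) n" by (cases n) (simp_all add: T_def algebra_simps)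
  qed
  have T0: "fps_nth T 0 \<noteq> 0" by (simp add: T_def)
  define F where "F = fps_exp 1 * inverse T"
  have F: "F * expm1 = fps_X * fps_exp 1"
    unfolding u F_def using inverse_mult_eq_1[OF T0] by (simp add: algebra_simps)
  have "fps_deriv (fps_X * (F * expm1)) = fps_deriv (fps_X * (fps_X * fps_exp 1))" unfolding F ..
  then have d: "fps_deriv (fps_X * F) * expm1 + fps_X * F * fps_exp 1 = 2 * fps_X * fps_exp 1 + fps_X * fps_X * fps_exp 1"
    by (simp add: algebra_simps)
  have "fps_deriv (fps_X * F) * expm1 ^ 2
      = (fps_deriv (fps_X * F) * expm1 + fps_X * F * fps_exp 1) * expm1 - fps_X * (F * expm1) * fps_exp 1"
    by (simp add: power2_eq_square algebra_simps)
  also have "\<dots> = fps_exp 1 * fps_X * (2 * expm1 - fps_X)"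
    unfolding d F by (simp add: algebra_simps)
  finally have "fps_deriv (fps_X * F) * expm1 ^ 2 = fps_deriv (fps_X * dyn_fps) * expm1 ^ 2"
    unfolding deriv_X_dyn_fps .
  then have "fps_deriv (fps_X * F) = fps_deriv (fps_X * dyn_fps)"
    using expm1_nonzero by simp
  then have "fps_X * F = fps_X * dyn_fps" unfolding fps_deriv_eq_iff by simp
  then have "F = dyn_fps" by simp
  then show ?thesis using F by simp
qed

text \<open>The identity F u = z exp z with u = exp z - 1 is differentiated and multiplied by z u.
  The result is the Riccati equation times u^2, and u^2 cancels among formal power series.\<close>

lemma riccati_dyn: "riccati dyn"
proof -
  let ?F = dyn_fps and ?u = expm1 and ?e = "fps_exp 1 :: real fps" and ?X = "fps_X :: real fps"
  note Fu = dyn_fps_times_expm1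
  have b0: "dyn 0 = 1"
  proof -
    have "fps_nth (?F * ?u) 1 = fps_nth (?X * ?e) 1" unfolding Fu ..
    then show ?thesis by (simp add: dyn_fps_def)
  qed
  have "fps_deriv (?F * ?u) = fps_deriv (?X * ?e)" unfolding Fu ..
  then have d: "fps_deriv ?F * ?u = ?e + ?X * ?e - ?F * ?e" by (simp add: algebra_simps)
  have "?X * fps_deriv ?F * ?u ^ 2 = ?X * (fps_deriv ?F * ?u) * ?u"
    by (simp add: power2_eq_square algebra_simps)
  also have "\<dots> = ?X * ?e * ?u + ?X * ?X * ?e * ?u - ?X * ?e * (?F * ?u)"
    unfolding d by (simp add: algebra_simps)
  also have "\<dots> = ?X * ?e * ?u + ?X * (?X * ?e) * ?u - (?X * ?e) * (?X * ?e)"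
    unfolding Fu by (simp add: algebra_simps)
  also have "\<dots> = (?F + ?X * ?F - ?F * ?F) * ?u ^ 2"
    unfolding Fu[symmetric] by (simp add: power2_eq_square algebra_simps)
  finally have "?X * fps_deriv ?F = ?F + ?X * ?F - ?F * ?F"
    using expm1_nonzero by simp
  then have "fps_nth (?X * fps_deriv ?F) m = fps_nth (?F + ?X * ?F - ?F * ?F) m" for m by (simp only:)
  moreover have "fps_nth (?F * ?F) m = (\<Sum>i\<le>m. dyn i * dyn (m - i))" for m
    by (simp add: fps_mult_nth dyn_fps_def atMost_atLeast0)
  moreover have "fps_nth (?X * fps_deriv ?F) m = real m * dyn m" for m
    by (cases m) (simp_all add: dyn_fps_def)
  moreover have "fps_nth (?X * ?F) m = (if m = 0 then 0 else dyn (m - 1))" "fps_nth ?F m = dyn m" for m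
    by (simp_all add: dyn_fps_def)
  ultimately have "real m * dyn m = dyn m + (if m = 0 then 0 else dyn (m - 1)) - (\<Sum>i\<le>m. dyn i * dyn (m - i))" for m
    by (simp only: fps_add_nth fps_sub_nth)
  with b0 show ?thesis by (simp add: riccati_def)
qed

section \<open>Carnot coordinates of a local frame\<close>

lemma inj_frame_comb:
  fixes f :: "'n::finite \<Rightarrow> real ^ 'n"
  assumes "inj f" "independent (range f)"
  shows "inj (\<lambda>v. \<Sum>j\<in>UNIV. v $ j *\<^sub>R f j)"
proof -
  have lin: "linear (\<lambda>v :: real ^ 'n. \<Sum>j\<in>UNIV. v $ j *\<^sub>R f j)"
    by (rule linearI) (simp_all add: scaleR_add_left sum.distrib scaleR_sum_right)
  have "v = 0" if "(\<Sum>j\<in>UNIV. v $ j *\<^sub>R f j) = 0" for v :: "real ^ 'n"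
  proof -
    have "(\<Sum>b\<in>range f. v $ inv f b *\<^sub>R b) = 0"
      using that by (simp add: sum.reindex[OF assms(1)] inv_f_f[OF assms(1)])
    then have "v $ inv f (f j) = 0" for j
      using independentD[OF assms(2), of "range f" "\<lambda>b. v $ inv f b" "f j"] by simp
    then show ?thesis by (simp add: inv_f_f[OF assms(1)] vec_eq_iff)
  qed
  then show ?thesis by (simp add: linear_injective_0[OF lin])
qed

lemma (in smooth_frame) smooth_frame_subset: "open V \<Longrightarrow> V \<subseteq> S \<Longrightarrow> smooth_frame V Y"
  by unfold_locales (auto intro: smooth_on_subset smooth_Y)

lemma (in privileged_frame) privileged_frame_subset:
  assumes "open V" "V \<subseteq> S" "0 \<in> V"
  shows "privileged_frame V Z w L"
proof -
  interpret V: smooth_frame V Z by (rule smooth_frame_subset[OF assms(1,2)])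
  show ?thesis
    by unfold_locales
      (use assms smooth_on_subset[OF smooth_L] L_eq_0 bracket w_pos coord_order Z_0 in auto)
qed

locale local_frame = hframe S Y w L
  for S :: "(real ^ 'n::finite) set" and Y :: "'n \<Rightarrow> 'n vfield" and w L +
  fixes a :: "real ^ 'n" and r :: nat
  assumes a_S: "a \<in> S" and inj_Y: "inj (\<lambda>j. Y j a)" and indep_Y: "independent (range (\<lambda>j. Y j a))"
    and w_le: "\<And>j. w j \<le> r"
begin

sublocale le: weight_grading w "le_exps w"
  by (rule weight_grading_le) (rule w_pos)

sublocale eq: weight_grading w "eq_exps w"
  by (rule weight_grading_eq) (rule w_pos)

lemma eq_form_imp_le_form: "eq.form p \<Longrightarrow> le.form p"
  unfolding eq.form_def le.form_def
  by (intro allI polys_mono[OF le.finite_A, where A = "eq_exps w _ 2"]) (auto simp: eq_exps_def le_exps_def)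

definition comb :: "real ^ 'n \<Rightarrow> real ^ 'n" where
  "comb v = (\<Sum>j\<in>UNIV. v $ j *\<^sub>R Y j a)"

lemma linear_comb: "linear comb"
  by (rule linearI) (simp_all add: comb_def scaleR_add_left sum.distrib scaleR_sum_right)

lemma inj_comb: "inj comb"
  unfolding comb_def[abs_def] by (rule inj_frame_comb[OF inj_Y indep_Y])

lemma comb_axis: "comb (axis j 1) = Y j a"
proof -
  have "comb (axis j 1) = (\<Sum>i\<in>UNIV. if i = j then Y i a else 0)"
    unfolding comb_def by (rule sum.cong) (auto simp: axis_def)
  then show ?thesis by simp
qed

definition lin :: "real ^ 'n \<Rightarrow> real ^ 'n" where
  "lin = (SOME g. linear g \<and> (\<forall>x. g (comb x) = x) \<and> (\<forall>x. comb (g x) = x))"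

lemma linear_lin: "linear lin" and lin_comb: "lin (comb x) = x" and comb_lin: "comb (lin x) = x"
  using someI_ex[OF linear_injective_isomorphism[OF linear_comb inj_comb]]
  unfolding lin_def[symmetric] by blast+

lemma linear_eq_lin:
  assumes "linear g" "\<And>j. g (Y j a) = axis j 1" shows "g = lin"
proof
  fix x
  have "g (comb v) = v" for v
    unfolding comb_def by (simp add: linear_sum[OF assms(1)] linear_scale[OF assms(1)] assms(2) flip: vec_eq_sum_axis)
  then show "g x = lin x" using comb_lin by metis
qed

definition T :: "real ^ 'n \<Rightarrow> real ^ 'n" where "T x = lin (x - a)"

definition T' :: "real ^ 'n \<Rightarrow> real ^ 'n" where "T' y = comb y + a"

lemma T_a [simp]: "T a = 0" by (simp add: T_def linear_0[OF linear_lin])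

lemma T_T' [simp]: "T (T' y) = y" and T'_T [simp]: "T' (T x) = x"
  by (simp_all add: T_def T'_def lin_comb comb_lin)

lemma affine_T: "affine_map T"
proof -
  have "T = (\<lambda>x. lin x + (- lin a))" by (rule ext) (simp add: T_def linear_diff[OF linear_lin])
  then show ?thesis unfolding affine_map_def using linear_lin by blast
qed

lemma affine_deriv:
  assumes "linear g" shows "dird v (\<lambda>x. g (x - a)) x = g v" "smooth_on UNIV (\<lambda>x. g (x - a))"
proof -
  have bl: "bounded_linear g" using assms by (simp add: linear_conv_bounded_linear)
  have "((\<lambda>x. g (x - a)) has_derivative (\<lambda>v. g (v - 0))) (at x)"
    by (intro bounded_linear.has_derivative[OF bl] has_derivative_diff has_derivative_ident has_derivative_const)
  then show "dird v (\<lambda>x. g (x - a)) x = g v" by (intro dird_eqI[THEN trans]) auto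
  show "smooth_on UNIV (\<lambda>x. g (x - a))"
    by (intro smooth_on_compose_linear[OF bl open_UNIV] smooth_on_diff open_UNIV smooth_on_id smooth_on_const)
qed

lemma smooth_T: "smooth_on UNIV T"
  unfolding T_def[abs_def] by (rule affine_deriv(2)[OF linear_lin])

lemma dird_T: "dird v T x = lin v"
  unfolding T_def[abs_def] by (rule affine_deriv(1)[OF linear_lin])

lemma smooth_T': "smooth_on UNIV T'"
  unfolding T'_def[abs_def]
  using linear_comb by (intro smooth_on_add open_UNIV smooth_on_bounded_linear smooth_on_const) (simp add: linear_conv_bounded_linear)

lemma lin_Y: "lin (Y j a) = axis j 1"
  using lin_comb[of "axis j 1"] by (simp add: comb_axis)

lemma pushforward_at_0:
  assumes "inj_on \<epsilon> V" "a \<in> V" "\<epsilon> a = 0"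
  shows "pushforward V \<epsilon> (Y j) 0 = dird (Y j a) \<epsilon> a"
proof -
  have "inv_into V \<epsilon> 0 = a" using assms inv_into_f_f[of \<epsilon> V a] by simp
  then show ?thesis by (simp add: pushforward_def dird_def)
qed

text \<open>All coordinates that occur are \<open>p \<circ> T\<close> with \<open>p\<close> triangular; they are globally invertible.\<close>

context
  fixes p :: "real ^ 'n \<Rightarrow> real ^ 'n"
  assumes p: "le.form p"
begin

definition coords :: "real ^ 'n \<Rightarrow> real ^ 'n" where "coords x = p (T x)"

definition coords_inv :: "real ^ 'n \<Rightarrow> real ^ 'n" where "coords_inv y = T' (inv p y)"

lemma coords_inverse [simp]: "coords_inv (coords x) = x" "coords (coords_inv y) = y"
  using le.form_bij[OF p] by (simp_all add: coords_def coords_inv_def bij_is_inj bij_is_surj surj_f_inv_f)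

lemma coords_a: "coords a = 0" by (simp add: coords_def le.form_0[OF p])

lemma coords_inv_0: "coords_inv 0 = a" using coords_inverse(1)[of a] by (simp add: coords_a)

lemma smooth_coords: "smooth_on UNIV coords"
  unfolding coords_def[abs_def]
  by (rule smooth_on_compose[OF open_UNIV subset_UNIV le.smooth_form[OF p open_UNIV] smooth_T])

lemma smooth_coords_inv: "smooth_on UNIV coords_inv"
  unfolding coords_inv_def[abs_def]
  by (rule smooth_on_compose[OF open_UNIV subset_UNIV smooth_T' le.smooth_form[OF le.form_inv[OF p] open_UNIV]])

lemma inj_coords: "inj_on coords V"
  by (rule inj_on_inverseI[of V coords_inv]) simp

lemma open_image_coords: "open V \<Longrightarrow> open (coords ` V)"
proof -
  assume "open V"
  moreover have "coords ` V = coords_inv -` V" by (auto intro!: image_eqI[of _ coords "coords_inv _"])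
  ultimately show ?thesis
    using smooth_on_continuous[OF smooth_coords_inv] by (simp add: open_vimage)
qed

interpretation cc: hcoord_change S Y "coords ` S" coords coords_inv w L
  by unfold_locales
    (auto simp: open_image_coords open_S intro: smooth_on_subset[OF smooth_coords] smooth_on_subset[OF smooth_coords_inv])

lemma Z_coords: "cc.Z j y = dird (Y j (coords_inv y)) coords (coords_inv y)"
  by (rule cc.Z_def)

lemma inv_into_coords: "y \<in> coords ` V \<Longrightarrow> inv_into V coords y = coords_inv y"
  using inv_into_f_f[OF inj_coords] by auto

lemma pushforward_coords: "y \<in> coords ` V \<Longrightarrow> pushforward V coords (Y j) y = cc.Z j y"
  by (simp add: pushforward_def cc.Z_def inv_into_coords dird_def)

lemma local_coords_coords: "open V \<Longrightarrow> a \<in> V \<Longrightarrow> V \<subseteq> S \<Longrightarrow> local_coords S a V coords"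
proof -
  assume V: "open V" "a \<in> V" "V \<subseteq> S"
  have "smooth_on (coords ` V) (inv_into V coords) \<longleftrightarrow> smooth_on (coords ` V) coords_inv"
    by (rule smooth_on_cong[OF open_image_coords[OF V(1)] inv_into_coords])
  then have "smooth_on (coords ` V) (inv_into V coords)"
    by (simp add: smooth_on_subset[OF smooth_coords_inv])
  then show ?thesis
    unfolding local_coords_def
    using V inj_coords smooth_on_subset[OF smooth_coords] open_image_coords by auto
qed

lemma dird_coords: "dird (Y j a) coords a = axis j 1"
proof -
  have "dird (Y j a) coords a = dird (dird (Y j a) T a) p (T a)"
    unfolding coords_def[abs_def]
    by (rule dird_compose) (auto intro: smooth_on_differentiable[OF smooth_T] smooth_on_differentiable[OF le.smooth_form[OF p open_UNIV]])
  then show ?thesis by (simp add: dird_T lin_Y le.dird_form_0[OF p])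
qed

lemma Z_at_0: "cc.Z j 0 = axis j 1"
  by (simp add: cc.Z_def coords_inv_0 dird_coords)

lemma zero_image: "0 \<in> coords ` S" using a_S coords_a by force

lemma adapted: "adapted_hframe (coords ` S) cc.Z w (\<lambda>i j k y. L i j k (coords_inv y))"
  by unfold_locales (rule zero_image Z_at_0)+

lemma frame_apply_coords:
  "smooth_on UNIV f \<Longrightarrow> frame_apply cc.Z I f 0 = frame_apply Y I (\<lambda>x. f (coords x)) a"
  using cc.frame_apply_comp[OF smooth_on_subset[OF _ subset_UNIV] a_S, of f I] by (simp add: coords_a)

lemma order_ge_coords:
  "smooth_on UNIV f \<Longrightarrow> order_ge w cc.Z f 0 N \<longleftrightarrow> order_ge w Y (\<lambda>x. f (coords x)) a N"
  by (simp add: order_ge_def frame_apply_coords)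

lemma smooth_coordinate: "smooth_on V (\<lambda>x :: real ^ 'n. x $ k)"
  by (rule smooth_on_subset[OF smooth_on_nth[OF open_UNIV smooth_on_id]]) simp

text \<open>The nonvanishing half of the order comes for free: \<open>Y k\<close> gives 1 on the
  coordinate \<open>k\<close> at \<open>a\<close>, and the word \<open>[k]\<close> has weight
  \<open>w k\<close>.\<close>

lemma privileged_coords_iff:
  "privileged S w Y a V coords \<longleftrightarrow>
     open V \<and> a \<in> V \<and> V \<subseteq> S \<and> (\<forall>k. order_ge w Y (\<lambda>x. coords x $ k) a (w k))"
proof -
  have one: "frame_apply Y [k] (\<lambda>x. coords x $ k) a = 1" for k
    using frame_apply_coords[OF smooth_coordinate, of "[k]" k]
    by (simp add: frame_apply_Cons vf_apply_nth Z_at_0)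
  have "has_order w Y (\<lambda>x. coords x $ k) a (w k) \<longleftrightarrow> order_ge w Y (\<lambda>x. coords x $ k) a (w k)" for k
    unfolding has_order_def order_ge_def using one[of k] by (auto intro!: exI[of _ "[k]"])
  moreover have "linearly_adapted S Y a V coords \<longleftrightarrow> open V \<and> a \<in> V \<and> V \<subseteq> S"
    unfolding linearly_adapted_def
    using local_coords_coords pushforward_at_0[OF inj_coords _ coords_a] coords_a dird_coords
    by (auto simp: local_coords_def)
  ultimately show ?thesis unfolding privileged_def by auto
qed

lemma privileged_frame_coords:
  assumes "\<And>k. order_ge w Y (\<lambda>x. coords x $ k) a (w k)"
  shows "privileged_frame (coords ` S) cc.Z w (\<lambda>i j k y. L i j k (coords_inv y))"
proof -
  interpret A: adapted_hframe "coords ` S" cc.Z w "\<lambda>i j k y. L i j k (coords_inv y)" by (rule adapted)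
  show ?thesis by unfold_locales (use order_ge_coords[OF smooth_coordinate] assms in blast)
qed

text \<open>Restricting the frame to the image of \<open>V\<close> leaves the model field unchanged,
  since that field is built from Taylor coefficients at 0.\<close>

lemma is_model_field_pushforward:
  assumes o: "\<And>k. order_ge w Y (\<lambda>x. coords x $ k) a (w k)" and V: "open V" "a \<in> V" "V \<subseteq> S"
  shows "is_model_field w j (pushforward V coords (Y j)) (privileged_frame.model cc.Z w j)"
proof -
  have "0 \<in> coords ` V" using V(2) coords_a by force
  then interpret P: privileged_frame "coords ` V" cc.Z w "\<lambda>i j k y. L i j k (coords_inv y)"
    using V by (intro privileged_frame.privileged_frame_subset[OF privileged_frame_coords[OF o]] open_image_coords) auto
  show ?thesis by (rule P.is_model_field_model) (rule pushforward_coords)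
qed

end

section \<open>The maps \<open>T_map\<close> and \<open>psi_hat\<close>, and the model fields of
  \<psi>\<close>

lemma form_id: "le.form (\<lambda>x. x)" by (rule le.form_id)

lemma coords_id: "coords (\<lambda>x. x) = T" by (rule ext) (simp add: coords_def[OF form_id])

lemma coords_eq: "le.form p \<Longrightarrow> coords p = p \<circ> T" by (rule ext) (simp add: coords_def)

lemma affine_at_a:
  assumes "affine_map g" "g a = 0" obtains h where "linear h" "g = (\<lambda>x. h (x - a))"
proof -
  obtain h b where h: "linear h" "g = (\<lambda>x. h x + b)" using assms(1) unfolding affine_map_def by blast
  then have "b = - h a" using assms(2) by (simp add: eq_neg_iff_add_eq_0 add.commute)
  then have "g = (\<lambda>x. h (x - a))" using h by (simp add: linear_diff[OF h(1)])
  with h(1) show thesis by (rule that)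
qed

lemma T_map_eq: "T_map S Y a = T"
  unfolding T_map_def
proof (rule the_equality)
  have "linearly_adapted S Y a S (coords (\<lambda>x. x))"
    unfolding linearly_adapted_def
    using local_coords_coords[OF form_id open_S a_S] pushforward_at_0[OF inj_coords[OF form_id] a_S coords_a[OF form_id]]
      coords_a[OF form_id] dird_coords[OF form_id] by auto
  then show "affine_map T \<and> (\<exists>V. linearly_adapted S Y a V T)" using affine_T coords_id by metis
next
  fix g assume g: "affine_map g \<and> (\<exists>V. linearly_adapted S Y a V g)"
  then obtain V where V: "linearly_adapted S Y a V g" by blast
  then have ga: "g a = 0" by (simp add: linearly_adapted_def)
  obtain h where h: "linear h" "g = (\<lambda>x. h (x - a))" using affine_at_a g ga by blast
  have "h (Y j a) = axis j 1" for j
    using V pushforward_at_0[of g V j] affine_deriv(1)[OF h(1), of "Y j a" a]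
    unfolding linearly_adapted_def local_coords_def by (simp add: h(2))
  then have "h = lin" by (rule linear_eq_lin[OF h(1)])
  then show "g = T" using h(2) by (simp add: T_def[abs_def])
qed

sublocale lf: adapted_hframe "coords (\<lambda>x. x) ` S" "coord_change.Z Y (coords (\<lambda>x. x)) (coords_inv (\<lambda>x. x))" w
  "\<lambda>i j k y. L i j k (coords_inv (\<lambda>x. x) y)"
  by (rule adapted[OF form_id])

abbreviation ZT :: "'n \<Rightarrow> 'n vfield" where "ZT \<equiv> coord_change.Z Y (coords (\<lambda>x. x)) (coords_inv (\<lambda>x. x))"

lemma frame_apply_ZT:
  "le.form p \<Longrightarrow> frame_apply ZT I (\<lambda>x. p x $ k) 0 = frame_apply Y I (\<lambda>x. coords p x $ k) a"
  using frame_apply_coords[OF form_id smooth_on_nth[OF open_UNIV le.smooth_form[OF _ open_UNIV]], of p I k]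
  by (simp add: coords_id coords_def)

text \<open>Both maps are read in the linear coordinates \<open>T\<close>, where a polynomial of
  weights below \<open>N k\<close> and order at least \<open>N k\<close> is 0. Uniqueness of
  \<open>psi_hat\<close> uses the bound \<open>w k\<close>, uniqueness of Carnot coordinates the
  next larger one.\<close>

lemma form_unique:
  assumes p: "le.form p" and q: "le.form q"
    and A: "\<And>k. (\<lambda>x. p x $ k - q x $ k) \<in> polys (A k)" "\<And>k. finite (A k)" "\<And>k \<alpha>. \<alpha> \<in> A k \<Longrightarrow> multi_weight w \<alpha> < N k"
    and eq: "\<And>k I. index_weight w I < N k \<Longrightarrow>
      frame_apply Y I (\<lambda>x. coords p x $ k) a = frame_apply Y I (\<lambda>x. coords q x $ k) a"
  shows "p = q"
proof
  fix x
  have s: "smooth_on V (\<lambda>x. f x $ k)" if "le.form f" for f k V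
    by (rule smooth_on_subset[OF smooth_on_nth[OF open_UNIV le.smooth_form[OF that open_UNIV]]]) simp
  have "p x $ k - q x $ k = 0" for k
  proof (rule lf.polys_eq_0[OF A])
    show "order_ge w ZT (\<lambda>x. p x $ k - q x $ k) 0 (N k)"
      unfolding order_ge_def
      using eq by (simp add: lf.frame_apply_diff[OF s[OF p] s[OF q] lf.zero_S] frame_apply_ZT p q)
  qed
  then show "p x = q x" by (simp add: vec_eq_iff)
qed

lemma lower_form: "lower_weight_form w p \<Longrightarrow> le.form p"
  using lower_imp_at_most_weight_form[of w p, OF w_pos] by (simp add: at_most_weight_form_iff le.form_def)

lemma psi_hat_exists:
  "\<exists>p. lower_weight_form w p \<and> (\<forall>k. order_ge w Y (\<lambda>x. coords p x $ k) a (w k))"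
proof -
  have "\<exists>q \<in> polys {\<alpha>. multi_weight w \<alpha> < w k \<and> 2 \<le> multi_degree \<alpha>}. order_ge w ZT (\<lambda>x. x $ k + q x) 0 (w k)" for k
  proof (rule lf.raise_order)
    show "smooth_on (coords (\<lambda>x. x) ` S) (\<lambda>x. x $ k)" by (rule smooth_coordinate[OF form_id])
    fix I :: "'n list" assume I: "length I \<le> 1" "index_weight w I < w k"
    \<comment> \<open>Adaptedness starts the correction process: \<open>ZT j\<close> is the
      coordinate field at 0, so a single field gives a nonzero value on \<open>x $ k\<close> only
      for \<open>j = k\<close>, and then its weight is not below \<open>w k\<close>.\<close>
    show "frame_apply ZT I (\<lambda>x. x $ k) 0 = 0"
    proof (cases I)
      case (Cons j J)
      then have "I = [j]" using I by simp
      then show ?thesis using I by (auto simp: frame_apply_Cons vf_apply_nth lf.Z_0 axis_def)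
    qed simp
  qed
  then have ex: "\<exists>q. q \<in> polys {\<alpha>. multi_weight w \<alpha> < w k \<and> 2 \<le> multi_degree \<alpha>} \<and> order_ge w ZT (\<lambda>x. x $ k + q x) 0 (w k)" for k
    unfolding Bex_def .
  define q where "q = (\<lambda>k. SOME q. q \<in> polys {\<alpha>. multi_weight w \<alpha> < w k \<and> 2 \<le> multi_degree \<alpha>} \<and> order_ge w ZT (\<lambda>x. x $ k + q x) 0 (w k))"
  have q: "q k \<in> polys {\<alpha>. multi_weight w \<alpha> < w k \<and> 2 \<le> multi_degree \<alpha>}"
    "order_ge w ZT (\<lambda>x. x $ k + q k x) 0 (w k)" for k
    using someI_ex[OF ex[of k]] unfolding q_def by blast+
  define p where "p = (\<lambda>x. \<chi> k. x $ k + q k x)"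
  have low: "lower_weight_form w p" unfolding lower_weight_form_iff using q(1) by (simp add: p_def)
  have "order_ge w Y (\<lambda>x. coords p x $ k) a (w k)" for k
    using q(2)[of k] unfolding order_ge_def frame_apply_ZT[OF lower_form[OF low], symmetric] by (simp add: p_def)
  with low show ?thesis by blast
qed

definition psih :: "real ^ 'n \<Rightarrow> real ^ 'n" where "psih = psi_hat S w Y a"

lemma psih_props: "lower_weight_form w psih" "order_ge w Y (\<lambda>x. coords psih x $ k) a (w k)"
proof -
  obtain p where p: "lower_weight_form w p" "\<And>k. order_ge w Y (\<lambda>x. coords p x $ k) a (w k)"
    using psi_hat_exists by blast
  have "psi_hat S w Y a = p"
    unfolding psi_hat_def T_map_eq
  proof (rule the_equality)
    have "privileged S w Y a S (coords p)"
      using privileged_coords_iff[OF lower_form[OF p(1)]] p(2) open_S a_S by blast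
    then show "lower_weight_form w p \<and> (\<exists>V. privileged S w Y a V (p \<circ> T))"
      using p(1) coords_eq[OF lower_form[OF p(1)]] by metis
  next
    fix q assume q: "lower_weight_form w q \<and> (\<exists>V. privileged S w Y a V (q \<circ> T))"
    then have lq: "lower_weight_form w q" by blast
    have oq: "order_ge w Y (\<lambda>x. coords q x $ k) a (w k)" for k
      using q privileged_coords_iff[OF lower_form[OF lq]] by (auto simp: coords_eq[OF lower_form[OF lq]])
    show "q = p"
    proof (rule form_unique[OF lower_form[OF lq] lower_form[OF p(1)], where N = w])
      fix k
      let ?A = "{\<alpha>. multi_weight w \<alpha> < w k \<and> 2 \<le> multi_degree \<alpha>}"
      have "(\<lambda>x. (q x $ k - x $ k) - (p x $ k - x $ k)) \<in> polys ?A"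
        using lq p(1) by (intro polys_diff[where f = "\<lambda>x. q x $ k - x $ k" and g = "\<lambda>x. p x $ k - x $ k"]) (simp_all add: lower_weight_form_iff)
      then show "(\<lambda>x. q x $ k - p x $ k) \<in> polys ?A" by simp
      show "finite ?A"
        by (rule finite_subset[OF _ finite_multi_weight_le[of w "w k", OF w_pos]]) auto
    qed (use oq p(2) in \<open>auto simp: order_ge_def\<close>)
  qed
  with p show "lower_weight_form w psih" "order_ge w Y (\<lambda>x. coords psih x $ k) a (w k)" by (simp_all add: psih_def)
qed

lemmas psih_form = lower_form[OF psih_props(1)]

lemma psi_map_eq: "psi_map S w Y a = coords psih"
  using coords_eq[OF psih_form] by (simp add: psi_map_def T_map_eq psih_def)

abbreviation Z\<psi> :: "'n \<Rightarrow> 'n vfield" where "Z\<psi> \<equiv> coord_change.Z Y (coords psih) (coords_inv psih)"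

sublocale psi: privileged_frame "coords psih ` S" Z\<psi> w "\<lambda>i j k y. L i j k (coords_inv psih y)"
  by (rule privileged_frame_coords[OF psih_form psih_props(2)])

lemma psi_model_eq: "psi_model S w Y a = psi.model"
proof
  fix j
  show "psi_model S w Y a j = psi.model j"
    unfolding psi_model_def psi_map_eq
  proof (rule the_equality)
    show "\<exists>V. privileged S w Y a V (coords psih) \<and> is_model_field w j (pushforward V (coords psih) (Y j)) (psi.model j)"
      using privileged_coords_iff[OF psih_form, of S] is_model_field_pushforward[OF psih_form psih_props(2) open_S a_S]
        psih_props(2) open_S a_S by blast
  next
    fix M assume "\<exists>V. privileged S w Y a V (coords psih) \<and> is_model_field w j (pushforward V (coords psih) (Y j)) M"
    then obtain V where "privileged S w Y a V (coords psih)" and M: "is_model_field w j (pushforward V (coords psih) (Y j)) M" by blast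
    then have V: "open V" "a \<in> V" "V \<subseteq> S" using privileged_coords_iff[OF psih_form] by blast+
    show "M = psi.model j"
      by (rule is_model_field_unique[OF M is_model_field_pushforward[OF psih_form psih_props(2) V]])
  qed
qed

section \<open>Structure constants at \<open>a\<close> and the left-invariant fields\<close>

definition c :: "'n \<Rightarrow> 'n \<Rightarrow> 'n \<Rightarrow> real" where "c i j k = L i j k a"

sublocale gf: graded_frame w psi.model c
proof unfold_locales
  fix i j x
  show "vf_bracket (psi.model i) (psi.model j) x = (\<Sum>l\<in>UNIV. (if w l = w i + w j then c i j l else 0) *\<^sub>R psi.model l x)"
    unfolding psi.model_bracket_eq coords_inv_0[OF psih_form] c_def ..
qed (rule w_pos psi.model_in_polys psi.model_0)+

lemma structure_coeff_eq: "structure_coeff Y a i j = (\<chi> k. c i j k)"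
  unfolding structure_coeff_def
proof (rule the_equality)
  show b: "vf_bracket (Y i) (Y j) a = (\<Sum>k\<in>UNIV. ((\<chi> k. c i j k) $ k) *\<^sub>R Y k a)"
    using bracket[OF a_S] by (simp add: c_def)
  fix l :: "real ^ 'n" assume "vf_bracket (Y i) (Y j) a = (\<Sum>k\<in>UNIV. (l $ k) *\<^sub>R Y k a)"
  then have "comb l = comb (\<chi> k. c i j k)" using b by (simp add: comb_def)
  then show "l = (\<chi> k. c i j k)" using inj_comb by (simp add: inj_eq)
qed

lemma model_bracket_eq: "model_bracket w Y a = graded_bracket w c"
  by (intro ext) (simp add: model_bracket_def graded_bracket_def structure_coeff_eq cong: if_cong)

lemma c_antisym: "c j i k = - c i j k"
proof -
  have "comb (\<chi> k. c j i k) = - comb (\<chi> k. c i j k)"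
  proof -
    have "vf_bracket (Y j) (Y i) a = - vf_bracket (Y i) (Y j) a" by (simp add: vf_bracket_eq_dird)
    then show ?thesis unfolding bracket[OF a_S] by (simp add: comb_def c_def)
  qed
  then have "comb (\<chi> k. c j i k) = comb (- (\<chi> k. c i j k))" by (simp add: linear_neg[OF linear_comb])
  then have "(\<chi> k. c j i k) = - (\<chi> k. c i j k)" using inj_comb by (simp add: inj_eq)
  then show ?thesis by (simp add: vec_eq_iff)
qed

lemma bracket_antisym: "graded_bracket w c v x = - graded_bracket w c x v"
proof -
  have "graded_bracket w c v x $ k = - graded_bracket w c x v $ k" for k
  proof -
    have "graded_bracket w c v x $ k = (\<Sum>j\<in>UNIV. \<Sum>i\<in>UNIV. if w k = w i + w j then v $ i * x $ j * c i j k else 0)"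
      unfolding graded_bracket_nth by (rule sum.swap)
    also have "\<dots> = (\<Sum>j\<in>UNIV. \<Sum>i\<in>UNIV. - (if w k = w j + w i then x $ j * v $ i * c j i k else 0))"
    proof (intro sum.cong refl)
      fix i j
      show "(if w k = w i + w j then v $ i * x $ j * c i j k else 0) = - (if w k = w j + w i then x $ j * v $ i * c j i k else 0)"
        unfolding c_antisym[of i j k] by (simp add: add.commute)
    qed
    finally show ?thesis unfolding graded_bracket_nth sum_negf .
  qed
  then show ?thesis by (simp add: vec_eq_iff)
qed

lemma bracket_self: "graded_bracket w c x x = 0"
proof -
  have "graded_bracket w c x x $ k = 0" for k
    using arg_cong[OF bracket_antisym[of x x], of "\<lambda>v. v $ k"] by simp
  then show ?thesis by (simp add: vec_eq_iff)
qed

definition Xa :: "'n \<Rightarrow> 'n vfield" where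
  "Xa j = left_invariant_field (dynkin_product r (model_bracket w Y a)) (axis j 1)"

lemma Xa_eq: "Xa j x = (\<Sum>m<r. dyn m *\<^sub>R (graded_bracket w c x ^^ m) (axis j 1))"
  unfolding Xa_def model_bracket_eq
  by (rule left_invariant_dynkin[OF bilinear_graded_bracket bracket_self bracket_antisym])

text \<open>The exponential map carries the left-invariant fields to the model fields of \<psi>: its
  differential takes any series in \<open>ad\<close> with \<open>riccati\<close> coefficients,
  applied to a basis vector, to the model field, and the Dynkin coefficients \<open>dyn\<close> form
  such a series.\<close>

lemma dird_E_Xa: "dird (Xa j x) gf.E x = psi.model j (gf.E x)"
proof -
  interpret graded_frame_ray w psi.model c x dyn r
    by unfold_locales (rule riccati_dyn w_le)+
  show ?thesis unfolding Xa_eq by (rule dird_E_F)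
qed

section \<open>The coordinates \<epsilon> as a triangular map after \<open>T\<close>\<close>

definition q :: "real ^ 'n \<Rightarrow> real ^ 'n" where "q = inv gf.E"

definition eps_hat :: "real ^ 'n \<Rightarrow> real ^ 'n" where "eps_hat x = q (psih x)"

lemma form_q: "eq.form q" unfolding q_def by (rule eq.form_inv[OF gf.form_E])

lemma q_E: "q (gf.E x) = x"
  using eq.form_bij[OF gf.form_E] by (simp add: q_def bij_is_inj)

lemma form_eps_hat: "le.form eps_hat"
  unfolding eps_hat_def[abs_def] by (rule le.form_compose[OF eq_form_imp_le_form[OF form_q] psih_form])

lemma eps_carnot_eq: "eps_carnot S w Y a = coords eps_hat"
  unfolding eps_carnot_def psi_model_eq gf.frame_exp_eq psi_map_eq
  by (rule ext) (simp add: coords_def[OF form_eps_hat] coords_def[OF psih_form] eps_hat_def q_def)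

lemma coords_eps: "coords eps_hat x = q (coords psih x)"
  by (simp add: coords_def[OF form_eps_hat] coords_def[OF psih_form] eps_hat_def)

lemma coords_inv_eps: "coords_inv eps_hat y = coords_inv psih (gf.E y)"
proof -
  have "coords eps_hat (coords_inv psih (gf.E y)) = y"
    by (simp add: coords_eps coords_inverse(2)[OF psih_form] q_E)
  then show ?thesis using coords_inverse(1)[OF form_eps_hat] by metis
qed

lemma smooth_q: "smooth_on V q"
  by (rule smooth_on_subset[OF eq.smooth_form[OF form_q open_UNIV]]) simp

text \<open>\<open>q\<close> is homogeneous, so its component \<open>k\<close> is a combination of
  monomials of weight \<open>w k\<close>, and these have order at least \<open>w k\<close> in the
  privileged coordinates \<psi>.\<close>

lemma order_eps: "order_ge w Y (\<lambda>x. coords eps_hat x $ k) a (w k)"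
proof -
  obtain d where d: "(\<lambda>x. q x $ k) = (\<lambda>x. \<Sum>\<alpha>\<in>eq_exps w (w k) 1. d \<alpha> * monomial \<alpha> x)"
    using eq.formD[OF form_q] by (rule polysE)
  have "order_ge w Z\<psi> (\<lambda>x. q x $ k) 0 (w k)"
    unfolding d
  proof (rule psi.order_ge_sum[OF _ psi.zero_S])
    fix \<alpha> assume "\<alpha> \<in> eq_exps w (w k) 1"
    then have "order_ge w Z\<psi> (monomial \<alpha>) 0 (w k)" using psi.order_ge_monomial[of \<alpha>] by (simp add: eq_exps_def)
    then show "order_ge w Z\<psi> (\<lambda>x. d \<alpha> * monomial \<alpha> x) 0 (w k)"
      by (rule psi.order_ge_cmult[OF smooth_monomial[OF psi.open_S] psi.zero_S])
  qed (intro smooth_on_mult smooth_on_const smooth_monomial psi.open_S)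
  then show ?thesis
    using order_ge_coords[OF psih_form smooth_on_nth[OF open_UNIV smooth_q, where k = k], of "w k"] by (simp add: coords_eps)
qed

abbreviation Z\<epsilon> :: "'n \<Rightarrow> 'n vfield" where "Z\<epsilon> \<equiv> coord_change.Z Y (coords eps_hat) (coords_inv eps_hat)"

sublocale eps: privileged_frame "coords eps_hat ` S" Z\<epsilon> w "\<lambda>i j k y. L i j k (coords_inv eps_hat y)"
  by (rule privileged_frame_coords[OF form_eps_hat order_eps])

lemma Z_eps_eq:
  "Z\<epsilon> j y = dird (Z\<psi> j (gf.E y)) q (gf.E y)"
proof -
  have z: "Z\<epsilon> j y = dird (Y j (coords_inv eps_hat y)) (coords eps_hat) (coords_inv eps_hat y)" 
    "Z\<psi> j z = dird (Y j (coords_inv psih z)) (coords psih) (coords_inv psih z)" for z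
    by (rule Z_coords[OF form_eps_hat] Z_coords[OF psih_form])+
  let ?x = "coords_inv psih (gf.E y)"
  have "dird v (coords eps_hat) ?x = dird (dird v (coords psih) ?x) q (coords psih ?x)" for v
    unfolding coords_eps[abs_def]
    by (rule dird_compose) (auto intro: smooth_on_differentiable[OF smooth_coords[OF psih_form]] smooth_on_differentiable[OF smooth_q])
  then show ?thesis unfolding z coords_inv_eps by (simp add: coords_inverse(2)[OF psih_form])
qed

lemma eq_form_dilation:
  assumes "eq.form f" shows "f (dilation w t x) = dilation w t (f x)"
proof -
  have "f (dilation w t x) $ k = t ^ w k * f x $ k" for k
  proof -
    obtain d where d: "(\<lambda>x. f x $ k) = (\<lambda>x. \<Sum>\<alpha>\<in>eq_exps w (w k) 1. d \<alpha> * monomial \<alpha> x)"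
      using eq.formD[OF assms] by (rule polysE)
    have "(\<Sum>\<alpha>\<in>eq_exps w (w k) 1. d \<alpha> * monomial \<alpha> (dilation w t x))
       = t ^ w k * (\<Sum>\<alpha>\<in>eq_exps w (w k) 1. d \<alpha> * monomial \<alpha> x)"
      unfolding sum_distrib_left by (rule sum.cong) (auto simp: monomial_dilation eq_exps_def)
    then show ?thesis using fun_cong[OF d, of x] fun_cong[OF d, of "dilation w t x"] by simp
  qed
  then show ?thesis by (simp add: vec_eq_iff)
qed

lemma q_differentiable: "q differentiable at x"
  by (rule smooth_on_differentiable[OF smooth_q[of UNIV] UNIV_I])

lemma dird_q_dilation: "dird (dilation w t v) q (dilation w t z) = dilation w t (dird v q z)"
proof -
  have "dird (dilation w t v) q (dilation w t z) = dird v (\<lambda>z. q (dilation w t z)) z"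
    by (rule dird_dilation[OF q_differentiable, symmetric])
  also have "\<dots> = dird v (\<lambda>z. dilation w t (q z)) z" by (simp add: eq_form_dilation[OF form_q])
  also have "\<dots> = dilation w t (dird v q z)"
    by (rule dird_compose_linear[OF bounded_linear_dilation q_differentiable])
  finally show ?thesis .
qed

text \<open>\<open>E\<close> and \<open>q\<close> commute with the dilations, so rescaling in the
  new coordinates is rescaling in the old ones, followed by the differential of \<open>q\<close> at
  a point independent of \<open>t\<close>.\<close>

lemma rescaled_eps:
  assumes "t \<noteq> 0"
  shows "rescaled w Z\<epsilon> t j x = dird (rescaled w Z\<psi> t j (gf.E x)) q (gf.E x)"
proof -
  let ?z = "gf.E x"
  have "t ^ w j *\<^sub>R Z\<epsilon> j (dilation w t x) = dird (t ^ w j *\<^sub>R Z\<psi> j (dilation w t ?z)) q (dilation w t ?z)"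
    unfolding Z_eps_eq eq_form_dilation[OF gf.form_E]
    using linear_scale[OF linear_dird[OF q_differentiable]] by simp
  also have "\<dots> = dilation w t (dird (rescaled w Z\<psi> t j ?z) q ?z)"
    unfolding dilation_rescaled[OF assms, symmetric] dird_q_dilation ..
  finally have "dilation w t (rescaled w Z\<epsilon> t j x) = dilation w t (dird (rescaled w Z\<psi> t j ?z) q ?z)"
    unfolding dilation_rescaled[OF assms] .
  then show ?thesis using assms by (simp add: vec_eq_iff)
qed

text \<open>The differential of \<open>q\<close> at a fixed point is linear and hence continuous, so
  the limit passes through it; since \<open>q\<close> inverts \<open>E\<close>, the relation
  \<open>dird_E_Xa\<close> then yields \<open>Xa j\<close>.\<close>

lemma eps_model_eq: "eps.model j = Xa j"
proof
  fix x
  have "((\<lambda>t. rescaled w Z\<psi> t j (gf.E x)) \<longlongrightarrow> psi.model j (gf.E x)) (at 0)"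
    using psi.model_tendsto[of "[]" j "gf.E x"] by simp
  moreover have "isCont (\<lambda>v. dird v q (gf.E x)) (psi.model j (gf.E x))"
    using linear_dird[OF q_differentiable] by (simp add: linear_continuous_at linear_conv_bounded_linear)
  ultimately have "((\<lambda>t. dird (rescaled w Z\<psi> t j (gf.E x)) q (gf.E x)) \<longlongrightarrow> dird (psi.model j (gf.E x)) q (gf.E x)) (at 0)"
    by (rule isCont_tendsto_compose[rotated])
  moreover have "\<forall>\<^sub>F t in at 0. dird (rescaled w Z\<psi> t j (gf.E x)) q (gf.E x) = rescaled w Z\<epsilon> t j x"
    by (intro eventually_at_topological[THEN iffD2] exI[of _ UNIV]) (auto simp: rescaled_eps)
  ultimately have "((\<lambda>t. rescaled w Z\<epsilon> t j x) \<longlongrightarrow> dird (psi.model j (gf.E x)) q (gf.E x)) (at 0)"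
    by (rule Lim_transform_eventually)
  moreover have "((\<lambda>t. rescaled w Z\<epsilon> t j x) \<longlongrightarrow> eps.model j x) (at 0)"
    using eps.model_tendsto[of "[]" j x] by simp
  ultimately have "eps.model j x = dird (psi.model j (gf.E x)) q (gf.E x)"
    by (rule tendsto_unique[OF trivial_limit_at, rotated])
  also have "\<dots> = dird (Xa j x) (\<lambda>x. q (gf.E x)) x"
    unfolding dird_E_Xa[symmetric] by (rule dird_compose[OF gf.E_differentiable q_differentiable, symmetric])
  also have "\<dots> = Xa j x"
    unfolding q_E by (simp add: dird_bounded_linear bounded_linear_ident)
  finally show "eps.model j x = Xa j x" .
qed

text \<open>As model fields are unique, the condition on them becomes an equation for the explicit
  field \<open>model\<close>.\<close>

lemma carnot_coords_iff:
  assumes p: "le.form p"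
  shows "carnot_coords S r w Y a V (coords p) \<longleftrightarrow> open V \<and> a \<in> V \<and> V \<subseteq> S \<and>
    (\<forall>k. order_ge w Y (\<lambda>x. coords p x $ k) a (w k)) \<and>
    privileged_frame.model (coord_change.Z Y (coords p) (coords_inv p)) w = Xa"
proof -
  have "is_model_field w j (pushforward V (coords p) (Y j)) (Xa j)
      \<longleftrightarrow> privileged_frame.model (coord_change.Z Y (coords p) (coords_inv p)) w j = Xa j"
    if "open V" "a \<in> V" "V \<subseteq> S" "\<And>k. order_ge w Y (\<lambda>x. coords p x $ k) a (w k)" for j
    using is_model_field_pushforward[OF p that(4,1-3), of j] is_model_field_unique by metis
  then show ?thesis
    unfolding carnot_coords_def privileged_coords_iff[OF p] Xa_def[symmetric] fun_eq_iff[of _ Xa] by blast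
qed

lemma carnot_coords_eps: "carnot_coords S r w Y a S (coords eps_hat)"
  unfolding carnot_coords_iff[OF form_eps_hat]
  using open_S a_S order_eps eps_model_eq by auto

text \<open>The right-hand side does not depend on \<open>p\<close>, so words of the critical weight
  take the same values for all Carnot coordinates of this form.\<close>

lemma frame_apply_carnot:
  assumes p: "le.form p" and "carnot_coords S r w Y a V (coords p)" and I: "index_weight w I = w k"
  shows "frame_apply Y I (\<lambda>x. coords p x $ k) a = frame_apply Xa I (\<lambda>x. x $ k) 0"
proof -
  let ?Z = "coord_change.Z Y (coords p) (coords_inv p)"
  have o: "\<And>k. order_ge w Y (\<lambda>x. coords p x $ k) a (w k)" and m: "privileged_frame.model ?Z w = Xa"
    using assms(2) unfolding carnot_coords_iff[OF p] by blast+
  interpret P: privileged_frame "coords p ` S" ?Z w "\<lambda>i j k y. L i j k (coords_inv p y)"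
    by (rule privileged_frame_coords[OF p o])
  have "frame_apply ?Z I (\<lambda>x. x $ k) 0 = frame_apply P.model I (\<lambda>x. x $ k) 0"
    by (rule P.frame_apply_model[OF P.zero_S P.is_model_field_model P.smooth_model I]) (rule refl)
  then show ?thesis
    using frame_apply_coords[OF p smooth_coordinate[OF p], of I k] m by simp
qed

lemma carnot_coords_unique:
  assumes p: "le.form p" and V: "carnot_coords S r w Y a V (coords p)"
  shows "p = eps_hat"
proof (rule form_unique[OF p form_eps_hat, where N = "\<lambda>k. Suc (w k)"])
  fix k
  have "(\<lambda>x. (p x $ k - x $ k) - (eps_hat x $ k - x $ k)) \<in> polys (le_exps w (w k) 2)"
    using p form_eps_hat by (intro polys_diff[where f = "\<lambda>x. p x $ k - x $ k" and g = "\<lambda>x. eps_hat x $ k - x $ k"]) (simp_all add: le.form_def)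
  then show "(\<lambda>x. p x $ k - eps_hat x $ k) \<in> polys (le_exps w (w k) 2)" by simp
  show "finite (le_exps w (w k) 2)" by (rule le.finite_A)
  fix I assume I: "index_weight w I < Suc (w k)"
  show "frame_apply Y I (\<lambda>x. coords p x $ k) a = frame_apply Y I (\<lambda>x. coords eps_hat x $ k) a"
  proof (cases "index_weight w I = w k")
    case True
    then show ?thesis using frame_apply_carnot[OF p V] frame_apply_carnot[OF form_eps_hat carnot_coords_eps] by simp
  next
    case False
    then have "index_weight w I < w k" using I by simp
    then show ?thesis
      using V[unfolded carnot_coords_iff[OF p]] order_eps[of k] by (simp add: order_ge_def)
  qed
qed (auto simp: le_exps_def)

theorem eps_carnot_characterization:
  "((\<exists>V. carnot_coords S r w Y a V \<epsilon>) \<and>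
      (\<exists>T p. affine_map T \<and> T a = 0 \<and>
             polynomial_diffeomorphism p \<and> at_most_weight_form w p \<and> \<epsilon> = p \<circ> T))
     \<longleftrightarrow> \<epsilon> = eps_carnot S w Y a"
proof
  assume "\<epsilon> = eps_carnot S w Y a"
  then have e: "\<epsilon> = coords eps_hat" by (simp add: eps_carnot_eq)
  have "at_most_weight_form w eps_hat"
    using form_eps_hat by (simp add: at_most_weight_form_iff le.form_def)
  moreover have "carnot_coords S r w Y a S \<epsilon>" unfolding e by (rule carnot_coords_eps)
  moreover have "\<epsilon> = eps_hat \<circ> T" unfolding e by (rule coords_eq[OF form_eps_hat])
  ultimately show "(\<exists>V. carnot_coords S r w Y a V \<epsilon>) \<and>
      (\<exists>T p. affine_map T \<and> T a = 0 \<and>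
             polynomial_diffeomorphism p \<and> at_most_weight_form w p \<and> \<epsilon> = p \<circ> T)"
    using affine_T T_a le.polynomial_diffeomorphism_form[OF form_eps_hat]
    by (intro conjI exI[of _ S] exI[of _ T] exI[of _ eps_hat])
next
  assume "(\<exists>V. carnot_coords S r w Y a V \<epsilon>) \<and>
      (\<exists>T p. affine_map T \<and> T a = 0 \<and>
             polynomial_diffeomorphism p \<and> at_most_weight_form w p \<and> \<epsilon> = p \<circ> T)"
  then obtain V g p where V: "carnot_coords S r w Y a V \<epsilon>" and g: "affine_map g" "g a = 0"
    and ap: "at_most_weight_form w p" and e: "\<epsilon> = p \<circ> g" by blast
  have p: "le.form p" using ap by (simp add: at_most_weight_form_iff le.form_def)
  obtain h where h: "linear h" "g = (\<lambda>x. h (x - a))" using affine_at_a[OF g] by blast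
  have la: "linearly_adapted S Y a V \<epsilon>" using V by (simp add: carnot_coords_def privileged_def)
  \<comment> \<open>The differential of \<open>p\<close> at 0 is the identity, so adaptedness of the
    composite is adaptedness of its affine part, which determines that part.\<close>
  have "h (Y j a) = axis j 1" for j
  proof -
    have "dird (Y j a) \<epsilon> a = axis j 1"
      using la pushforward_at_0[of \<epsilon> V j] by (simp add: linearly_adapted_def local_coords_def)
    moreover have "dird (Y j a) (\<lambda>x. p (g x)) a = dird (dird (Y j a) g a) p (g a)"
      by (rule dird_compose)
        (auto simp: h(2) intro: smooth_on_differentiable[OF affine_deriv(2)[OF h(1)]]
          smooth_on_differentiable[OF le.smooth_form[OF p open_UNIV]])
    moreover have "dird (Y j a) g a = h (Y j a)" unfolding h(2) by (rule affine_deriv(1)[OF h(1)])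
    ultimately show ?thesis using g(2) le.dird_form_0[OF p] by (simp add: e comp_def)
  qed
  then have "h = lin" by (rule linear_eq_lin[OF h(1)])
  then have "g = T" using h(2) by (simp add: T_def[abs_def])
  then have "\<epsilon> = coords p" using e coords_eq[OF p] by simp
  moreover from this V have "p = eps_hat" using carnot_coords_unique[OF p] by blast
  ultimately show "\<epsilon> = eps_carnot S w Y a" by (simp add: eps_carnot_eq)
qed

end

section \<open>Frames on Carnot manifolds in local coordinates\<close>

text \<open>Positions run through 1, ..., n without repetition. With \<open>D = d s\<close> this
  shows that there are as many frame fields of position at most \<open>d s\<close> as the rank of
  \<open>H s\<close>.\<close>

lemma card_le_position:
  fixes D :: nat
  assumes "D \<le> CARD('n::{finite,linorder})"
  shows "card {k :: 'n. card {..k} \<le> D} = D"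
proof -
  let ?f = "\<lambda>k :: 'n. card {..k}"
  have inj: "inj ?f"
  proof (rule injI, rule ccontr)
    fix k l :: 'n assume e: "card {..k} = card {..l}" and "k \<noteq> l"
    then have "{..k} \<subset> {..l} \<or> {..l} \<subset> {..k}" by (auto simp: atMost_subset_iff)
    then show False using e psubset_card_mono[of "{..k}" "{..l}"] psubset_card_mono[of "{..l}" "{..k}"] by auto
  qed
  have pos: "1 \<le> card {..k}" for k :: 'n
    using card_gt_0_iff[of "{..k}"] by (auto simp: Suc_le_eq)
  have sub: "range ?f \<subseteq> {1..CARD('n)}"
    using pos card_mono[of UNIV "{.._ :: 'n}"] by auto
  have "range ?f = {1..CARD('n)}"
    by (rule card_subset_eq[OF _ sub]) (simp_all add: card_image[OF inj])
  moreover have "?f ` {k. card {..k} \<le> D} = range ?f \<inter> {1..D}" using pos by auto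
  ultimately have "?f ` {k. card {..k} \<le> D} = {1..D}" using assms by auto
  then show ?thesis using card_image[OF inj_on_subset[OF inj subset_UNIV], of "{k. card {..k} \<le> D}"] by simp
qed

lemma smooth_on_det:
  fixes A :: "'a::real_normed_vector \<Rightarrow> real ^ 'n ^ 'n"
  assumes "open S" "\<And>i j. smooth_on S (\<lambda>x. A x $ i $ j)"
  shows "smooth_on S (\<lambda>x. det (A x))"
  unfolding det_def by (intro smooth_on_sum smooth_on_mult smooth_on_prod smooth_on_const assms)

text \<open>By Cramer's rule the coefficients are quotients of determinants in the components, and
  the denominator is nonzero because the fields form a frame.\<close>

lemma frame_coefficients:
  fixes Y :: "'n::finite \<Rightarrow> 'n vfield" and V :: "'n vfield"
  assumes S: "open S" and Y: "\<And>j. smooth_on S (Y j)" and V: "smooth_on S V"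
    and frame: "\<And>x. x \<in> S \<Longrightarrow> inj (\<lambda>j. Y j x) \<and> independent (range (\<lambda>j. Y j x))"
  shows "\<exists>l. (\<forall>k. smooth_on S (l k)) \<and> (\<forall>x\<in>S. V x = (\<Sum>k\<in>UNIV. l k x *\<^sub>R Y k x))"
proof -
  define A where "A = (\<lambda>x. \<chi> p q. Y q x $ p)"
  define B where "B = (\<lambda>k x. \<chi> p q. if q = k then V x $ p else Y q x $ p)"
  have mv: "A x *v v = (\<Sum>k\<in>UNIV. v $ k *\<^sub>R Y k x)" for x v
    by (simp add: vec_eq_iff A_def matrix_vector_mult_def mult.commute)
  have det: "det (A x) \<noteq> 0" if "x \<in> S" for x
  proof -
    have "inj ((*v) (A x))" unfolding mv[abs_def] using inj_frame_comb frame[OF that] by blast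
    then have "invertible (A x)" using matrix_left_invertible_injective invertible_left_inverse by blast
    then show ?thesis by (simp add: invertible_det_nz)
  qed
  define l where "l = (\<lambda>k x. det (B k x) / det (A x))"
  have "smooth_on S (l k)" for k
    unfolding l_def
  proof (rule smooth_on_divide[OF S _ _ det])
    show "smooth_on S (\<lambda>x. det (A x))"
      by (rule smooth_on_det[OF S]) (simp add: A_def smooth_on_nth[OF S Y])
    show "smooth_on S (\<lambda>x. det (B k x))"
    proof (rule smooth_on_det[OF S])
      fix i j show "smooth_on S (\<lambda>x. B k x $ i $ j)"
        by (cases "j = k") (simp_all add: B_def smooth_on_nth[OF S Y] smooth_on_nth[OF S V])
    qed
  qed
  moreover have "V x = (\<Sum>k\<in>UNIV. l k x *\<^sub>R Y k x)" if "x \<in> S" for x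
  proof -
    have "B k x = (\<chi> i j. if j = k then V x $ i else A x $ i $ j)" for k
      by (simp add: B_def A_def vec_eq_iff)
    then have "(\<chi> k. l k x) = (\<chi> k. det (\<chi> i j. if j = k then V x $ i else A x $ i $ j) / det (A x))"
      unfolding l_def by metis
    then have "A x *v (\<chi> k. l k x) = V x" unfolding cramer[OF det[OF that]] .
    then show ?thesis by (simp add: mv)
  qed
  ultimately show ?thesis by blast
qed

lemma smooth_vf_bracket:
  fixes X Y :: "'n::finite vfield"
  assumes "open S" "smooth_on S X" "smooth_on S Y"
  shows "smooth_on S (vf_bracket X Y)"
  unfolding vf_bracket_eq_dird[abs_def] by (intro smooth_on_diff smooth_on_dird_field assms)

lemma coefficient_eq_0:
  fixes f :: "'n::finite \<Rightarrow> real ^ 'n"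
  assumes "inj f" "independent (range f)"
    and "(\<Sum>k\<in>UNIV. l k *\<^sub>R f k) \<in> span (f ` K)" and "k \<notin> K"
  shows "l k = 0"
proof -
  have "inj_on f K" using assms(1) by (rule inj_on_subset) simp
  obtain u where u: "(\<Sum>k\<in>UNIV. l k *\<^sub>R f k) = (\<Sum>v\<in>f ` K. u v *\<^sub>R v)"
    using assms(3) by (auto simp: span_finite)
  have "(\<Sum>v\<in>f ` K. u v *\<^sub>R v) = (\<Sum>k\<in>K. u (f k) *\<^sub>R f k)"
    by (simp add: sum.reindex[OF \<open>inj_on f K\<close>])
  also have "\<dots> = (\<Sum>k\<in>UNIV. (if k \<in> K then u (f k) else 0) *\<^sub>R f k)"
    by (rule sum.mono_neutral_cong_left) auto
  finally have "(\<Sum>k\<in>UNIV. (\<chi> k. l k) $ k *\<^sub>R f k) = (\<Sum>k\<in>UNIV. (\<chi> k. if k \<in> K then u (f k) else 0) $ k *\<^sub>R f k)"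
    using u by simp
  then have "(\<chi> k. l k) = (\<chi> k. if k \<in> K then u (f k) else 0)"
    by (rule injD[OF inj_frame_comb[OF assms(1,2)]])
  then show ?thesis using assms(4) by (simp add: vec_eq_iff)
qed

locale carnot_frame =
  fixes A :: "('m::{t2_space,second_countable_topology}, 'n::{finite,linorder}) chart set"
    and r :: nat and d :: "nat \<Rightarrow> nat"
    and H :: "nat \<Rightarrow> 'm \<Rightarrow> ('m, 'n) tvec set"
    and a :: 'm and W :: "'m set" and X :: "'n \<Rightarrow> 'm \<Rightarrow> ('m, 'n) tvec"
    and U :: "'m set" and \<phi> :: "'m \<Rightarrow> (real, 'n) vec"
  assumes carnot: "carnot_manifold A r d H"
    and frame: "H_frame_near A d H a W X"
    and chart: "(U, \<phi>) \<in> A" and a_U: "a \<in> U"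
begin

abbreviation Y :: "'n \<Rightarrow> 'n vfield" where "Y \<equiv> \<lambda>j. in_chart (U, \<phi>) (X j)"

abbreviation S :: "(real, 'n) vec set" where "S \<equiv> \<phi> ` (U \<inter> W)"

lemmas carnot_props = carnot[unfolded carnot_manifold_def]

lemma carnot_structure: "smooth_structure A"
  and r_pos: "1 \<le> r"
  and carnot_subbundle: "s \<in> {1..r} \<Longrightarrow> subbundle A (d s) (H s)"
  and carnot_filtration: "s \<in> {1..<r} \<Longrightarrow> H s p \<subseteq> H (Suc s) p"
  and carnot_top: "H r p = tangent_space A p"
  and carnot_bracket: "\<lbrakk>1 \<le> s; 1 \<le> s'; s + s' \<le> r; smooth_section A (H s) V F; smooth_section A (H s') V G\<rbrakk> \<Longrightarrow>
    smooth_section A (H (s + s')) V (lie_bracket A F G)"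
  using carnot_props[THEN conjunct1]
    carnot_props[THEN conjunct2, THEN conjunct1]
    carnot_props[THEN conjunct2, THEN conjunct2, THEN conjunct1]
    carnot_props[THEN conjunct2, THEN conjunct2, THEN conjunct2, THEN conjunct1]
    carnot_props[THEN conjunct2, THEN conjunct2, THEN conjunct2, THEN conjunct2, THEN conjunct1]
    carnot_props[THEN conjunct2, THEN conjunct2, THEN conjunct2, THEN conjunct2, THEN conjunct2]
  by blast+

lemma chart_props:
  "open U" "open (\<phi> ` U)" "homeomorphism U (\<phi> ` U) \<phi> (chart_inv (U, \<phi>))"
proof -
  have "is_chart (U, \<phi>)"
    using carnot_structure chart unfolding smooth_structure_def by (elim conjE) (erule bspec)
  then show "open U" "open (\<phi> ` U)" "homeomorphism U (\<phi> ` U) \<phi> (chart_inv (U, \<phi>))"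
    by (simp_all add: is_chart_def)
qed

lemma open_W: "open W" and a_W: "a \<in> W"
  using frame by (auto simp: H_frame_near_def)

lemma open_S: "open S"
proof -
  have "openin (top_of_set (\<phi> ` U)) S"
    by (rule homeomorphism_imp_open_map[OF chart_props(3) openin_open_Int[OF open_W]])
  then show ?thesis by (rule openin_open_trans[OF _ chart_props(2)])
qed

lemma chart_inverse: "p \<in> U \<Longrightarrow> chart_inv (U, \<phi>) (\<phi> p) = p"
  using chart_props(3) by (simp add: homeomorphism_def)

lemma Y_eq: "p \<in> U \<Longrightarrow> Y j (\<phi> p) = X j p (U, \<phi>)"
  by (simp add: in_chart_def chart_inverse)

lemma section_X: "smooth_section A (H (weight d j)) W (X j)"
  using frame by (simp add: H_frame_near_def)

lemma smooth_Y: "smooth_on S (Y j)"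
proof -
  have "\<forall>c\<in>A. smooth_on (snd c ` (fst c \<inter> W)) (in_chart c (X j))"
    using section_X[of j] by (simp add: smooth_section_def smooth_vector_field_def)
  from bspec[OF this chart] show ?thesis by simp
qed

lemma frame_Y:
  assumes "x \<in> S" shows "inj (\<lambda>j. Y j x)" "independent (range (\<lambda>j. Y j x))"
proof -
  obtain p where p: "p \<in> U" "p \<in> W" "x = \<phi> p" using assms by blast
  have "\<forall>c\<in>A. p \<in> fst c \<longrightarrow> inj (\<lambda>j. X j p c) \<and> independent (range (\<lambda>j. X j p c))"
    using frame p by (simp add: H_frame_near_def)
  from bspec[OF this chart] p
  have "inj (\<lambda>j. X j p (U, \<phi>)) \<and> independent (range (\<lambda>j. X j p (U, \<phi>)))" by simp
  then show "inj (\<lambda>j. Y j x)" "independent (range (\<lambda>j. Y j x))" using p by (simp_all add: Y_eq)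
qed

section \<open>Fibres of the filtration and weights\<close>

definition E :: "nat \<Rightarrow> 'm \<Rightarrow> (real, 'n) vec set" where
  "E s p = (\<lambda>v. v (U, \<phi>)) ` H s p"

lemma fibre:
  assumes "s \<in> {1..r}" "p \<in> U"
  shows "subspace (E s p)" "dim (E s p) = d s"
proof -
  have "subbundle A (d s) (H s)" by (rule carnot_subbundle[OF assms(1)])
  then obtain V F where "p \<in> V" and "\<forall>q\<in>V. \<forall>c\<in>A. q \<in> fst c \<longrightarrow>
      inj_on (\<lambda>i. F i q c) {..<d s} \<and> independent ((\<lambda>i. F i q c) ` {..<d s}) \<and>
      (\<lambda>v. v c) ` H s q = span ((\<lambda>i. F i q c) ` {..<d s})"
    unfolding subbundle_def by blast
  from bspec[OF bspec[OF this(2,1)] chart] assms(2)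
  have F: "inj_on (\<lambda>i. F i p (U, \<phi>)) {..<d s}" "independent ((\<lambda>i. F i p (U, \<phi>)) ` {..<d s})"
    "E s p = span ((\<lambda>i. F i p (U, \<phi>)) ` {..<d s})"
    unfolding E_def by simp_all
  show "subspace (E s p)" unfolding F(3) by (rule subspace_span)
  show "dim (E s p) = d s"
    unfolding F(3) dim_span using dim_eq_card_independent[OF F(2)] card_image[OF F(1)] by simp
qed

lemma d_le: "s \<in> {1..r} \<Longrightarrow> d s \<le> CARD('n)"
  using fibre(2)[OF _ a_U] dim_subset_UNIV[of "E s a"] by simp

lemma d_r: "d r = CARD('n)"
proof -
  have aS: "\<phi> a \<in> S" using a_U a_W by blast
  have "X j a \<in> H r a" for j
    using section_X[of j] a_W unfolding carnot_top by (simp add: smooth_section_def smooth_vector_field_def)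
  then have "range (\<lambda>j. Y j (\<phi> a)) \<subseteq> E r a" by (auto simp: E_def Y_eq[OF a_U])
  then have "card (range (\<lambda>j. Y j (\<phi> a))) \<le> dim (E r a)"
    by (rule independent_card_le_dim[OF _ frame_Y(2)[OF aS]])
  then have "CARD('n) \<le> d r"
    using card_image[OF frame_Y(1)[OF aS]] fibre(2)[OF _ a_U, of r] r_pos by simp
  then show ?thesis using d_le[of r] r_pos by simp
qed

text \<open>Since \<open>d r\<close> is the dimension, \<open>r\<close> is a candidate in the
  minimum that defines the weight.\<close>

lemma weight_props: "1 \<le> weight d (j :: 'n)" "weight d (j :: 'n) \<le> r"
proof -
  have P: "1 \<le> r \<and> card {..j} \<le> d r" using r_pos card_mono[of UNIV "{..j}"] by (simp add: d_r)
  show "1 \<le> weight d j" unfolding weight_def using LeastI[of "\<lambda>s. 1 \<le> s \<and> card {..j} \<le> d s", OF P] by blast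
  show "weight d j \<le> r" unfolding weight_def using Least_le[of "\<lambda>s. 1 \<le> s \<and> card {..j} \<le> d s", OF P] .
qed

lemma weight_le: "1 \<le> s \<Longrightarrow> card {..j :: 'n} \<le> d s \<Longrightarrow> weight d j \<le> s"
  unfolding weight_def by (rule Least_le) simp

lemma H_mono: "s \<le> t \<Longrightarrow> 1 \<le> s \<Longrightarrow> t \<le> r \<Longrightarrow> H s p \<subseteq> H t p"
proof (induction t rule: dec_induct)
  case (step t)
  have "H t p \<subseteq> H (Suc t) p" using step by (intro carnot_filtration) simp
  then show ?case using step by auto
qed simp

text \<open>The frame fields of position at most \<open>d s\<close> lie in the fibre of
  \<open>H s\<close>, are independent and are \<open>d s\<close> in number, so they span it for
  reasons of dimension.\<close>

lemma fibre_span: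
  assumes s: "s \<in> {1..r}" and p: "p \<in> U" "p \<in> W"
  shows "E s p \<subseteq> span ((\<lambda>k. Y k (\<phi> p)) ` {k. weight d k \<le> s})"
proof -
  let ?K = "{k :: 'n. card {..k} \<le> d s}"
  let ?B = "(\<lambda>k. Y k (\<phi> p)) ` ?K"
  have pS: "\<phi> p \<in> S" using p by blast
  have "?B \<subseteq> E s p"
  proof
    fix v assume "v \<in> ?B"
    then obtain k where k: "card {..k} \<le> d s" "v = X k p (U, \<phi>)" using Y_eq[OF p(1)] by auto
    have "X k p \<in> H (weight d k) p" using section_X[of k] p by (simp add: smooth_section_def)
    then have "X k p \<in> H s p"
      using H_mono[of "weight d k" s p] weight_props[of k] weight_le[OF _ k(1)] s by auto
    then show "v \<in> E s p" by (auto simp: E_def k)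
  qed
  moreover have "independent ?B" by (rule independent_mono[OF frame_Y(2)[OF pS]]) blast
  moreover have "card ?B = d s"
    using card_image[OF inj_on_subset[OF frame_Y(1)[OF pS]], of ?K] card_le_position[OF d_le[OF s]] by simp
  ultimately have "E s p \<subseteq> span ?B"
    using card_ge_dim_independent[of ?B "E s p"] fibre(2)[OF s p(1)] by simp
  also have "\<dots> \<subseteq> span ((\<lambda>k. Y k (\<phi> p)) ` {k. weight d k \<le> s})"
    by (rule span_mono) (use weight_le s in auto)
  finally show ?thesis .
qed

lemma bracket_in_span:
  assumes "x \<in> S"
  shows "vf_bracket (Y i) (Y j) x \<in> span ((\<lambda>k. Y k x) ` {k. weight d k \<le> weight d i + weight d j})"
proof -
  obtain p where p: "p \<in> U" "p \<in> W" "x = \<phi> p" using assms by blast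
  show ?thesis
  proof (cases "weight d i + weight d j \<le> r")
    case True
    have "smooth_section A (H (weight d i + weight d j)) W (lie_bracket A (X i) (X j))"
      by (rule carnot_bracket[OF weight_props(1) weight_props(1) True section_X section_X])
    then have "lie_bracket A (X i) (X j) p \<in> H (weight d i + weight d j) p"
      using p by (simp add: smooth_section_def)
    moreover have "lie_bracket A (X i) (X j) p (U, \<phi>) = vf_bracket (Y i) (Y j) x"
      using p chart by (simp add: lie_bracket_def)
    ultimately have "vf_bracket (Y i) (Y j) x \<in> E (weight d i + weight d j) p"
      unfolding E_def by (metis image_eqI)
    then show ?thesis
      using fibre_span[of "weight d i + weight d j" p] True weight_props[of i] p by auto
  next
    case False
    have "weight d k \<le> weight d i + weight d j" for k :: 'n
      using False weight_props(2)[of k] by linarith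
    then have "{k :: 'n. weight d k \<le> weight d i + weight d j} = UNIV" by blast
    moreover have "span (range (\<lambda>k. Y k x)) = UNIV"
      using card_ge_dim_independent[of "range (\<lambda>k. Y k x)" UNIV] frame_Y[OF assms]
      by (auto simp: card_image)
    ultimately show ?thesis by simp
  qed
qed

lemma local_frame: "\<exists>L. local_frame S Y (weight d) L (\<phi> a) r"
proof -
  have "\<exists>l. (\<forall>k. smooth_on S (l k)) \<and> (\<forall>x\<in>S. vf_bracket (Y i) (Y j) x = (\<Sum>k\<in>UNIV. l k x *\<^sub>R Y k x))" for i j
    by (rule frame_coefficients[OF open_S smooth_Y smooth_vf_bracket[OF open_S smooth_Y smooth_Y]])
      (use frame_Y in blast)
  then have "\<exists>L. \<forall>i j. (\<forall>k. smooth_on S (L i j k)) \<and> (\<forall>x\<in>S. vf_bracket (Y i) (Y j) x = (\<Sum>k\<in>UNIV. L i j k x *\<^sub>R Y k x))"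
    by (intro choice allI)
  then obtain L where L: "\<And>i j k. smooth_on S (L i j k)"
    "\<And>i j x. x \<in> S \<Longrightarrow> vf_bracket (Y i) (Y j) x = (\<Sum>k\<in>UNIV. L i j k x *\<^sub>R Y k x)" by blast
  have L0: "L i j k x = 0" if "x \<in> S" "weight d i + weight d j < weight d k" for i j k x
    by (rule coefficient_eq_0[OF frame_Y[OF that(1)], where K = "{k. weight d k \<le> weight d i + weight d j}"])
      (use that bracket_in_span[of x i j] L(2) in auto)
  have w: "0 < weight d j" for j :: 'n using weight_props(1)[of j] by simp
  have "local_frame S Y (weight d) L (\<phi> a) r"
    using open_S smooth_Y L L0 w a_U a_W frame_Y weight_props(2) by unfold_locales auto
  then show ?thesis by blast
qed

end

theorem theorem7p7:
  fixes A :: "('m::{t2_space,second_countable_topology}, 'n::{finite,linorder}) chart set"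
    and r :: nat and d :: "nat \<Rightarrow> nat"
    and H :: "nat \<Rightarrow> 'm \<Rightarrow> ('m, 'n) tvec set"
    and a :: 'm and W :: "'m set" and X :: "'n \<Rightarrow> 'm \<Rightarrow> ('m, 'n) tvec"
    and U :: "'m set" and \<phi> :: "'m \<Rightarrow> (real, 'n) vec"
    and \<Omega> :: "(real, 'n) vec set" and w :: "'n \<Rightarrow> nat" and Y :: "'n \<Rightarrow> 'n vfield"
  assumes "carnot_manifold A r d H"
    and "H_frame_near A d H a W X"
    and "(U, \<phi>) \<in> A" and "a \<in> U"
    and "\<Omega> = \<phi> ` (U \<inter> W)"
    and "w = weight d"
    and "Y = (\<lambda>j. in_chart (U, \<phi>) (X j))"
  shows "\<forall>\<epsilon> :: (real, 'n) vec \<Rightarrow> (real, 'n) vec.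
     ((\<exists>V. carnot_coords \<Omega> r w Y (\<phi> a) V \<epsilon>) \<and>
      (\<exists>T p. affine_map T \<and> T (\<phi> a) = 0 \<and>
             polynomial_diffeomorphism p \<and> at_most_weight_form w p \<and> \<epsilon> = p \<circ> T))
     \<longleftrightarrow> \<epsilon> = eps_carnot \<Omega> w Y (\<phi> a)"
proof -
  interpret carnot_frame A r d H a W X U \<phi> by unfold_locales (fact assms)+
  obtain L where "local_frame \<Omega> Y w L (\<phi> a) r" using local_frame unfolding assms(5-7) by blast
  then show ?thesis by (intro allI local_frame.eps_carnot_characterization)
qed

end
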